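(* Let $f=f(t)\in L^2(\Omega)$ and let $u$ be the solution of $$u''+\alpha u'+Au=f,\ t>0,\qquad u(0)=u_0,\ u'(0)=u_1.$$ Let $u_\infty$ be the unique solution of $Au_\infty=f$ with $u_\infty=0$ on $\partial\Omega$. Let $0<\delta\le\frac13\min\left(\alpha,\frac{\lambda_1}{2\alpha}\right)$. Then, with $w(t)=u(t)-u_\infty$ and, for an integer $j\ge1$, $\mathcal{E}^{(j)}(w)(t)=\frac12\left(\|w^{(j)}(t)\|^2+\|A^{1/2}w^{(j-1)}(t)\|^2\right)$, there holds for all $t\ge0$ $$\mathcal{E}^{(j)}(w)(t)\le 3\,e^{-\delta t}\,\mathcal{E}^{(j)}(w)(0)=3\,e^{-\delta t}\left(\|w^{(j)}(0)\|^2+\|A^{1/2}w^{(j-1)}(0)\|^2\right).$$ Here, for $j=1$, $w^{(j-1)}(0)=w(0)$, and for $j>1$, $w^{(j)}(0)=u^{(j)}(0)$.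
   Context: $\Omega\subset\mathbb{R}^d$ is a convex polygonal or polyhedral domain and $\alpha>0$ is a fixed constant. $\mathbf{A}(x)$ is a real symmetric, uniformly positive definite matrix and $a_0(x)\ge 0$, with smooth coefficients. $\|\cdot\|$ is the norm of $L^2(\Omega)$. $A$ is the self-adjoint positive definite operator on $L^2(\Omega)$ given by $A\phi=-\nabla\cdot(\mathbf{A}(x)\nabla\phi)+a_0(x)\phi$ with domain $D(A)=H^2(\Omega)\cap H^1_0(\Omega)$; $D(A^{1/2})=H^1_0(\Omega)$. $\lambda_1>0$ is the principal (smallest) eigenvalue of $A$. $v^{(j)}$ denotes the $j$-th time derivative of $v$, $v^{(0)}=v$.
   Formalization: The printed equality lacks the factor 1/2 in the definition of the energy and fails whenever the initial energy is nonzero; it is stated with 1/2 restored (the printed outer bound follows). f is taken independent of t, as A u_∞ = f with fixed u_∞ forces. *)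

theory Defs
  imports "HOL-Analysis.Analysis"
begin

section \<open>The Hilbert space of square-integrable functions\<close>

definition square_integrable :: "('a::euclidean_space \<Rightarrow> real) \<Rightarrow> bool" where
  "square_integrable f \<longleftrightarrow>
     f \<in> borel_measurable lborel \<and> integrable lborel (\<lambda>x. (f x)\<^sup>2)"

definition L2_rel :: "('a::euclidean_space \<Rightarrow> real) \<Rightarrow> ('a \<Rightarrow> real) \<Rightarrow> bool" where
  "L2_rel f g \<longleftrightarrow>
     square_integrable f \<and> square_integrable g \<and> (AE x in lborel. f x = g x)"

lemma square_integrable_mult:
  assumes "square_integrable f" "square_integrable g"
  shows "integrable lborel (\<lambda>x. f x * g x)"
proof (rule Bochner_Integration.integrable_bound)
  show "integrable lborel (\<lambda>x. (f x)\<^sup>2 + (g x)\<^sup>2)"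
    using assms by (simp add: square_integrable_def)
  show "(\<lambda>x. f x * g x) \<in> borel_measurable lborel"
    using assms unfolding square_integrable_def by (intro borel_measurable_times) auto
  have "\<bar>f x * g x\<bar> \<le> (f x)\<^sup>2 + (g x)\<^sup>2" for x
  proof -
    have "0 \<le> (\<bar>f x\<bar> - \<bar>g x\<bar>)\<^sup>2" "0 \<le> \<bar>f x\<bar> * \<bar>g x\<bar>" by simp_all
    then show ?thesis unfolding power2_diff abs_mult power2_abs by linarith
  qed
  then show "AE x in lborel. norm (f x * g x) \<le> norm ((f x)\<^sup>2 + (g x)\<^sup>2)"
    by simp
qed

lemma square_integrable_zero: "square_integrable (\<lambda>x. 0)"
  by (simp add: square_integrable_def)

lemma square_integrable_scale: "square_integrable f \<Longrightarrow> square_integrable (\<lambda>x. c * f x)"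
  unfolding square_integrable_def
  by (auto simp: power_mult_distrib intro!: borel_measurable_times)

lemma square_integrable_add:
  assumes "square_integrable f" "square_integrable g"
  shows "square_integrable (\<lambda>x. f x + g x)"
  using assms square_integrable_mult[OF assms] unfolding square_integrable_def
  by (auto simp: power2_sum mult.assoc intro!: borel_measurable_add)

quotient_type (overloaded) 'a L2 = "'a::euclidean_space \<Rightarrow> real" / partial: L2_rel
  morphisms L2_fun L2_class
proof (rule part_equivpI)
  show "\<exists>f. L2_rel f f"
    using square_integrable_zero by (auto simp: L2_rel_def)
  show "symp L2_rel"
    by (auto simp: symp_def L2_rel_def)
  show "transp L2_rel"
    unfolding transp_def L2_rel_def by auto
qed

instantiation L2 :: (euclidean_space) real_vector
begin

lift_definition zero_L2 :: "'a L2" is "\<lambda>x. 0"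
  by (simp add: L2_rel_def square_integrable_zero)

lift_definition plus_L2 :: "'a L2 \<Rightarrow> 'a L2 \<Rightarrow> 'a L2" is "\<lambda>f g x. f x + g x"
  unfolding L2_rel_def by (auto intro: square_integrable_add)

lift_definition scaleR_L2 :: "real \<Rightarrow> 'a L2 \<Rightarrow> 'a L2" is "\<lambda>c f x. c * f x"
  unfolding L2_rel_def by (auto intro: square_integrable_scale)

definition "uminus (v::'a L2) = (-1) *\<^sub>R v"
definition "minus (v::'a L2) w = v + (-1) *\<^sub>R w"
instance
proof
  fix u v w :: "'a L2" and a b :: real
  show "u + v + w = u + (v + w)"
    by transfer (auto simp: L2_rel_def add.assoc intro!: square_integrable_add)
  show "u + v = v + u"
    by transfer (auto simp: L2_rel_def add.commute intro!: square_integrable_add)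
  show "0 + u = u"
    by transfer (auto simp: L2_rel_def)
  have *: "(0::real) *\<^sub>R u = 0"
    by transfer (auto simp: L2_rel_def square_integrable_zero)
  show add_l: "(a + b) *\<^sub>R u = a *\<^sub>R u + b *\<^sub>R u" for a b and u :: "'a L2"
    by transfer (auto simp: L2_rel_def distrib_right
        intro!: square_integrable_add square_integrable_scale)
  have one: "1 *\<^sub>R u = u" for u :: "'a L2"
    by transfer (auto simp: L2_rel_def)
  then show "1 *\<^sub>R u = u" .
  show "- u + u = 0"
    using add_l[of "-1" 1 u] * by (simp add: uminus_L2_def one)
  show "u - v = u + - v"
    by (simp add: minus_L2_def uminus_L2_def)
  show "a *\<^sub>R (u + v) = a *\<^sub>R u + a *\<^sub>R v"
    by transfer (auto simp: L2_rel_def distrib_left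
        intro!: square_integrable_add square_integrable_scale)
  show "a *\<^sub>R b *\<^sub>R u = (a * b) *\<^sub>R u"
    by transfer (auto simp: L2_rel_def mult.assoc intro!: square_integrable_scale)
qed

end

instantiation L2 :: (euclidean_space) real_inner
begin

lift_definition inner_L2 :: "'a L2 \<Rightarrow> 'a L2 \<Rightarrow> real"
  is "\<lambda>f g. \<integral>x. f x * g x \<partial>lborel"
  unfolding L2_rel_def square_integrable_def by (intro integral_cong_AE) auto

definition "norm (v::'a L2) = sqrt (inner v v)"
definition "sgn (v::'a L2) = inverse (norm v) *\<^sub>R v"
definition "dist (v::'a L2) w = norm (v - w)"
definition [code del]:
  "(uniformity :: ('a L2 \<times> 'a L2) filter) = (INF e\<in>{0 <..}. principal {(v, w). dist v w < e})"
definition [code del]: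
  "open (U :: 'a L2 set) \<longleftrightarrow> (\<forall>v\<in>U. eventually (\<lambda>(v', w). v' = v \<longrightarrow> w \<in> U) uniformity)"

instance
proof
  fix u v w :: "'a L2" and a b :: real and U :: "'a L2 set"
  show "inner u v = inner v u"
    by transfer (simp add: mult.commute)
  show "inner (u + v) w = inner u w + inner v w"
    by transfer (simp add: L2_rel_def distrib_right square_integrable_mult)
  show "inner (a *\<^sub>R u) v = a * inner u v"
    by transfer (simp add: mult.assoc)
  show "0 \<le> inner u u"
    by transfer (simp add: integral_nonneg_AE)
  show "inner u u = 0 \<longleftrightarrow> u = 0"
  proof (transfer, unfold L2_rel_def)
    fix f :: "'a \<Rightarrow> real"
    assume "square_integrable f \<and> square_integrable f \<and> (AE x in lborel. f x = f x)"
    then have f: "square_integrable f" by simp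
    then have "integrable lborel (\<lambda>x. f x * f x)"
      by (simp add: square_integrable_def power2_eq_square)
    then have "(\<integral>x. f x * f x \<partial>lborel) = 0 \<longleftrightarrow> (AE x in lborel. f x * f x = 0)"
      by (intro integral_nonneg_eq_0_iff_AE) auto
    then show "(\<integral>x. f x * f x \<partial>lborel) = 0 \<longleftrightarrow>
        square_integrable f \<and> square_integrable (\<lambda>x. 0) \<and> (AE x in lborel. f x = 0)"
      using f by (simp add: square_integrable_zero)
  qed
  show "norm u = sqrt (inner u u)" by (rule norm_L2_def)
  show "sgn u = u /\<^sub>R norm u" by (simp add: sgn_L2_def)
  show "dist u v = norm (u - v)" by (rule dist_L2_def)
  show "(uniformity :: ('a L2 \<times> 'a L2) filter)
      = (INF e\<in>{0 <..}. principal {(v, w). dist v w < e})"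
    by (rule uniformity_L2_def)
  show "open U \<longleftrightarrow> (\<forall>v\<in>U. eventually (\<lambda>(v', w). v' = v \<longrightarrow> w \<in> U) uniformity)"
    by (rule open_L2_def)
qed

end

text \<open>
  An element of $L^2(\Omega)$ is identified with its extension by zero, so that its
  \<^const>\<open>norm\<close> is the norm of $L^2(\Omega)$.
\<close>

definition L2_on :: "'a::euclidean_space set \<Rightarrow> 'a L2 set" where
  "L2_on \<Omega> = {v. AE x in lborel. x \<notin> \<Omega> \<longrightarrow> L2_fun v x = 0}"

text \<open>
  \<^const>\<open>L2_class\<close> \<open>f\<close> is meaningful only for square-integrable \<open>f\<close>. Below \<open>a\<close> is smooth and
  \<open>v\<close> vanishes outside a bounded set, so the product qualifies.
\<close>

definition mult_L2 :: "('a::euclidean_space \<Rightarrow> real) \<Rightarrow> 'a L2 \<Rightarrow> 'a L2" where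
  "mult_L2 a v = L2_class (\<lambda>x. a x * L2_fun v x)"


section \<open>Sobolev spaces\<close>

definition partial_deriv :: "'n::finite \<Rightarrow> (real^'n \<Rightarrow> real) \<Rightarrow> real^'n \<Rightarrow> real" where
  "partial_deriv i \<phi> x = frechet_derivative \<phi> (at x) (axis i 1)"

primrec Ck :: "nat \<Rightarrow> (real^'n::finite \<Rightarrow> real) \<Rightarrow> bool" where
  "Ck 0 \<phi> \<longleftrightarrow> continuous_on UNIV \<phi>"
| "Ck (Suc k) \<phi> \<longleftrightarrow> \<phi> differentiable_on UNIV \<and> (\<forall>i. Ck k (partial_deriv i \<phi>))"

definition smooth :: "(real^'n::finite \<Rightarrow> real) \<Rightarrow> bool" where
  "smooth \<phi> \<longleftrightarrow> (\<forall>k. Ck k \<phi>)"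

definition test_functions :: "(real^'n::finite) set \<Rightarrow> (real^'n \<Rightarrow> real) set" where
  "test_functions \<Omega> =
     {\<phi>. smooth \<phi> \<and> compact (closure {x. \<phi> x \<noteq> 0}) \<and> closure {x. \<phi> x \<noteq> 0} \<subseteq> \<Omega>}"

definition has_weak_partial ::
  "(real^'n::finite) set \<Rightarrow> 'n \<Rightarrow> (real^'n) L2 \<Rightarrow> (real^'n) L2 \<Rightarrow> bool" where
  "has_weak_partial \<Omega> i v g \<longleftrightarrow> g \<in> L2_on \<Omega> \<and>
     (\<forall>\<phi>\<in>test_functions \<Omega>. inner v (L2_class (partial_deriv i \<phi>)) = - inner g (L2_class \<phi>))"

definition weak_partial ::
  "(real^'n::finite) set \<Rightarrow> 'n \<Rightarrow> (real^'n) L2 \<Rightarrow> (real^'n) L2" where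
  "weak_partial \<Omega> i v = (THE g. has_weak_partial \<Omega> i v g)"

definition H1 :: "(real^'n::finite) set \<Rightarrow> (real^'n) L2 set" where
  "H1 \<Omega> = {v \<in> L2_on \<Omega>. \<forall>i. \<exists>g. has_weak_partial \<Omega> i v g}"

definition H1_norm :: "(real^'n::finite) set \<Rightarrow> (real^'n) L2 \<Rightarrow> real" where
  "H1_norm \<Omega> v = sqrt ((norm v)\<^sup>2 + (\<Sum>i\<in>UNIV. (norm (weak_partial \<Omega> i v))\<^sup>2))"

definition H10 :: "(real^'n::finite) set \<Rightarrow> (real^'n) L2 set" where
  "H10 \<Omega> = {v \<in> H1 \<Omega>. \<forall>e>0. \<exists>\<phi>\<in>test_functions \<Omega>. H1_norm \<Omega> (v - L2_class \<phi>) < e}"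

definition H2 :: "(real^'n::finite) set \<Rightarrow> (real^'n) L2 set" where
  "H2 \<Omega> = {v \<in> H1 \<Omega>. \<forall>i. weak_partial \<Omega> i v \<in> H1 \<Omega>}"


section \<open>The elliptic operator\<close>

definition elliptic_op ::
  "(real^'n::finite) set \<Rightarrow> (real^'n \<Rightarrow> real^'n^'n) \<Rightarrow> (real^'n \<Rightarrow> real) \<Rightarrow>
     (real^'n) L2 \<Rightarrow> (real^'n) L2" where
  "elliptic_op \<Omega> M a\<^sub>0 v =
     - (\<Sum>i\<in>UNIV. weak_partial \<Omega> i (\<Sum>j\<in>UNIV. mult_L2 (\<lambda>x. M x $ i $ j) (weak_partial \<Omega> j v)))
     + mult_L2 a\<^sub>0 v"

definition elliptic_dom :: "(real^'n::finite) set \<Rightarrow> (real^'n) L2 set" where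
  "elliptic_dom \<Omega> = H2 \<Omega> \<inter> H10 \<Omega>"

text \<open>
  Unbounded operators on a closed subspace \<open>H\<close> are given by a domain \<open>D\<close> and a total
  function \<open>T\<close> whose values matter only on \<open>D\<close>. The equivalence says that the adjoint of
  \<open>T\<close> has domain \<open>D\<close> and agrees with \<open>T\<close> there.
\<close>

definition self_adjoint_on :: "'h::real_inner set \<Rightarrow> 'h set \<Rightarrow> ('h \<Rightarrow> 'h) \<Rightarrow> bool" where
  "self_adjoint_on H D T \<longleftrightarrow>
     subspace D \<and> D \<subseteq> H \<and> H \<subseteq> closure D \<and> T ` D \<subseteq> H \<and>
     (\<forall>y\<in>H. \<forall>z\<in>H. (\<forall>x\<in>D. inner (T x) y = inner x z) \<longleftrightarrow> y \<in> D \<and> T y = z)"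

text \<open>
  \<open>S\<close> with domain \<open>V\<close> is the positive self-adjoint square root of \<open>T\<close> with domain \<open>D\<close>;
  for self-adjoint nonnegative \<open>T\<close> this determines \<open>V\<close>, and \<open>S\<close> on \<open>V\<close>.
\<close>

definition positive_sqrt_on ::
  "'h::real_inner set \<Rightarrow> 'h set \<Rightarrow> ('h \<Rightarrow> 'h) \<Rightarrow> 'h set \<Rightarrow> ('h \<Rightarrow> 'h) \<Rightarrow> bool" where
  "positive_sqrt_on H D T V S \<longleftrightarrow>
     self_adjoint_on H V S \<and> (\<forall>x\<in>V. 0 \<le> inner (S x) x) \<and>
     D = {x \<in> V. S x \<in> V} \<and> (\<forall>x\<in>D. S (S x) = T x)"

definition eigenvalue_on :: "'h::real_vector set \<Rightarrow> ('h \<Rightarrow> 'h) \<Rightarrow> real \<Rightarrow> bool" where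
  "eigenvalue_on D T \<mu> \<longleftrightarrow> (\<exists>v\<in>D. v \<noteq> 0 \<and> T v = \<mu> *\<^sub>R v)"

definition smallest_eigenvalue_on :: "'h::real_vector set \<Rightarrow> ('h \<Rightarrow> 'h) \<Rightarrow> real \<Rightarrow> bool" where
  "smallest_eigenvalue_on D T \<mu> \<longleftrightarrow>
     eigenvalue_on D T \<mu> \<and> (\<forall>\<nu>. eigenvalue_on D T \<nu> \<longrightarrow> \<mu> \<le> \<nu>)"


section \<open>The damped wave equation\<close>

text \<open>Derivatives in time are taken on $[0,\infty)$, hence are one-sided at $0$.\<close>

definition time_deriv :: "nat \<Rightarrow> (real \<Rightarrow> 'h::real_normed_vector) \<Rightarrow> real \<Rightarrow> 'h" where
  "time_deriv j v = ((\<lambda>z t. vector_derivative z (at t within {0..})) ^^ j) v"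

definition Ck_time :: "nat \<Rightarrow> (real \<Rightarrow> 'h::real_normed_vector) \<Rightarrow> bool" where
  "Ck_time k v \<longleftrightarrow>
     (\<forall>i<k. \<forall>t\<ge>0. (time_deriv i v has_vector_derivative time_deriv (Suc i) v t) (at t within {0..}))
     \<and> continuous_on {0..} (time_deriv k v)"

text \<open>
  Finite energy solutions of $u'' + \alpha u' + Tu = f$, $u(0) = u_0$, $u'(0) = u_1$: \<open>u\<close> is
  in $C^1([0,\infty); L^2)$ and $C([0,\infty); V)$, where \<open>V\<close> is the domain of \<open>S\<close>, the
  square root of \<open>T\<close>, with its graph norm; the equation is tested against the
  domain \<open>D\<close> of \<open>T\<close>, so that \<open>u\<close> itself need not take values in \<open>D\<close>. The lemma below
  shows that solutions for which the equation holds literally are included.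
\<close>

definition damped_wave_solution ::
  "'h::real_inner set \<Rightarrow> ('h \<Rightarrow> 'h) \<Rightarrow> 'h set \<Rightarrow> ('h \<Rightarrow> 'h) \<Rightarrow>
     real \<Rightarrow> 'h \<Rightarrow> 'h \<Rightarrow> 'h \<Rightarrow> (real \<Rightarrow> 'h) \<Rightarrow> bool" where
  "damped_wave_solution D T V S \<alpha> f u\<^sub>0 u\<^sub>1 u \<longleftrightarrow>
     Ck_time 1 u \<and> (\<forall>t\<ge>0. u t \<in> V) \<and> continuous_on {0..} (\<lambda>t. S (u t)) \<and>
     u 0 = u\<^sub>0 \<and> time_deriv 1 u 0 = u\<^sub>1 \<and>
     (\<forall>\<phi>\<in>D. \<forall>t>0. ((\<lambda>s. inner (time_deriv 1 u s) \<phi>) has_real_derivative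
        inner f \<phi> - \<alpha> * inner (time_deriv 1 u t) \<phi> - inner (u t) (T \<phi>)) (at t))"

lemma damped_wave_solutionI_strong:
  assumes sa: "self_adjoint_on H D T"
    and reg: "Ck_time 1 u" "\<forall>t\<ge>0. u t \<in> V" "continuous_on {0..} (\<lambda>t. S (u t))"
    and init: "u 0 = u\<^sub>0" "time_deriv 1 u 0 = u\<^sub>1"
    and D: "\<And>t. t > 0 \<Longrightarrow> u t \<in> D"
    and deriv: "\<And>t. t > 0 \<Longrightarrow> (time_deriv 1 u has_vector_derivative time_deriv 2 u t) (at t)"
    and eq: "\<And>t. t > 0 \<Longrightarrow> time_deriv 2 u t + \<alpha> *\<^sub>R time_deriv 1 u t + T (u t) = f"
  shows "damped_wave_solution D T V S \<alpha> f u\<^sub>0 u\<^sub>1 u"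
  unfolding damped_wave_solution_def
proof (intro conjI ballI allI impI reg init)
  show "u t \<in> V" if "0 \<le> t" for t using reg that by simp
next
  fix \<phi> t assume \<phi>: "\<phi> \<in> D" and t: "(t::real) > 0"
  have "T \<phi> \<in> H" "\<phi> \<in> H"
    using sa \<phi> by (auto simp: self_adjoint_on_def)
  then have sym: "inner (T (u t)) \<phi> = inner (u t) (T \<phi>)"
    using sa \<phi> D[OF t] unfolding self_adjoint_on_def by blast
  have "((\<lambda>s. inner (time_deriv 1 u s) \<phi>) has_vector_derivative inner (time_deriv 2 u t) \<phi>) (at t)"
    by (rule bounded_linear.has_vector_derivative[OF bounded_linear_inner_left deriv[OF t]])
  moreover have "time_deriv 2 u t = f - \<alpha> *\<^sub>R time_deriv 1 u t - T (u t)"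
    using eq[OF t] by (simp add: algebra_simps)
  ultimately show "((\<lambda>s. inner (time_deriv 1 u s) \<phi>) has_real_derivative
      inner f \<phi> - \<alpha> * inner (time_deriv 1 u t) \<phi> - inner (u t) (T \<phi>)) (at t)"
    by (simp add: has_real_derivative_iff_has_vector_derivative inner_diff_left sym)
qed

definition energy :: "('h \<Rightarrow> 'h::real_inner) \<Rightarrow> nat \<Rightarrow> (real \<Rightarrow> 'h) \<Rightarrow> real \<Rightarrow> real" where
  "energy S j w t =
     1/2 * ((norm (time_deriv j w t))\<^sup>2 + (norm (S (time_deriv (j - 1) w t)))\<^sup>2)"

end

theory Submission
  imports Defs
begin

text \<open>
  Put \<open>W = time_deriv (j - 1) w\<close>, which solves the homogeneous equation weakly, and
  \<open>E = \<parallel>W'\<parallel>\<^sup>2/2 + \<parallel>S W\<parallel>\<^sup>2/2\<close>. Since \<open>E' = -\<alpha> \<parallel>W'\<parallel>\<^sup>2\<close> and \<open>\<langle>W', W\<rangle> + \<alpha> \<parallel>W\<parallel>\<^sup>2/2\<close> has derivative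
  \<open>\<parallel>W'\<parallel>\<^sup>2 - \<parallel>S W\<parallel>\<^sup>2\<close>, the functional \<open>L = E + \<delta> (\<langle>W', W\<rangle> + \<alpha> \<parallel>W\<parallel>\<^sup>2/2)\<close> satisfies \<open>L' \<le> -\<delta> L\<close>, and
  it is comparable to \<open>E\<close>, once \<open>lambda1 \<parallel>v\<parallel>\<^sup>2 \<le> \<parallel>S v\<parallel>\<^sup>2\<close> holds on \<open>H10 \<Omega>\<close>. The latter says that
  the smallest eigenvalue is the bottom of the spectrum: the infimum of the Rayleigh quotient is
  attained, because the embedding of \<open>H10 \<Omega>\<close> into \<open>L\<^sup>2\<close> is compact, and is therefore an eigenvalue.
  Compactness follows from a Poincare inequality on the cubes of a fine grid. The test functions
  are dense in \<open>L2_on \<Omega>\<close> because the domain of the self-adjoint operator is, and this makes weak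
  derivatives unique.
\<close>

section \<open>Self-adjoint operators on a complete subspace\<close>

text \<open>Two gaps in the data shape the argument. First, \<open>S\<close> is an abstract square
  root and meets gradients only through <A v, v> = |S v|^2, where integration by parts asks for
  \<open>v \<in> D\<close>; estimates for \<open>S\<close> are therefore proved on \<open>D\<close>
  and carried to \<open>H10 \<Omega>\<close> by density of \<open>D\<close> in the graph norm.
  Second, the equation is tested against \<open>D\<close>, while \<open>W\<close> lies only in
  \<open>H10 \<Omega>\<close> and \<open>W'\<close> only in L^2. Graph density enlarges the test
  space to \<open>H10 \<Omega>\<close>, which admits \<open>W\<close> but still not
  \<open>W'\<close>, so the formula for \<open>E'\<close> cannot be read off by inserting
  \<open>W'\<close>; difference quotients of \<open>W\<close> take its place. The constant 3 has
  slack: \<open>L\<close> lies between 3/4 and 7/5 of \<open>E\<close>, and the quotient 28/15 is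
  below 3. The bound \<delta> \<le> \<alpha>/3 pays for the term \<delta> |W'|^2 created by the
  correction, and \<delta> \<le> lambda1/(6 \<alpha>) keeps \<alpha> \<delta> |W|^2 below |S W|^2/6.
  The load, constant in time, drops out by subtracting the steady state if j = 1 and by
  differentiation if j > 1.\<close>

lemma complete_subspace_projection:
  fixes K :: "'a::real_inner set"
  assumes sub: "subspace K" and comp: "complete K"
  obtains q where "q \<in> K" "\<And>k. k \<in> K \<Longrightarrow> inner (p - q) k = 0"
proof -
  define R where "R = (\<lambda>k. (norm (p - k))\<^sup>2) ` K"
  have Rne: "R \<noteq> {}" using sub by (auto simp: R_def subspace_def)
  have Rbdd: "bdd_below R" by (rule bdd_belowI[of _ 0]) (auto simp: R_def)
  define d where "d = Inf R"
  have dle: "d \<le> (norm (p - k))\<^sup>2" if "k \<in> K" for k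
    unfolding d_def by (rule cInf_lower[OF _ Rbdd]) (use that in \<open>auto simp: R_def\<close>)
  have "\<exists>k\<in>K. (norm (p - k))\<^sup>2 < d + 1 / real (Suc n)" for n
    using cInf_lessD[OF Rne, of "d + 1 / real (Suc n)"] by (auto simp: R_def d_def)
  then obtain k where kK: "\<And>n. k n \<in> K" and kd: "\<And>n. (norm (p - k n))\<^sup>2 < d + 1 / real (Suc n)"
    by metis
  have est: "(norm (k m - k n))\<^sup>2 \<le> 2 / real (Suc m) + 2 / real (Suc n)" for m n
  proof -
    \<comment> \<open>The midpoint of two near-minimisers is again in \<open>K\<close>, hence at
      squared distance at least \<open>d\<close>; the parallelogram law then leaves only the two
      errors for |k m - k n|^2.\<close>
    have "(1/2) *\<^sub>R (k m + k n) \<in> K"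
      using kK sub by (intro subspace_scale subspace_add) auto
    from dle[OF this] have "4 * d \<le> (norm ((p - k m) + (p - k n)))\<^sup>2"
    proof -
      have "(p - k m) + (p - k n) = 2 *\<^sub>R (p - (1/2) *\<^sub>R (k m + k n))"
        by (simp add: scaleR_diff_right scaleR_2)
      then have "(norm ((p - k m) + (p - k n)))\<^sup>2 = 4 * (norm (p - (1/2) *\<^sub>R (k m + k n)))\<^sup>2"
        by (simp add: power_mult_distrib)
      then show ?thesis using dle[OF \<open>(1/2) *\<^sub>R (k m + k n) \<in> K\<close>] by simp
    qed
    moreover have "(norm ((p - k m) + (p - k n)))\<^sup>2 + (norm (k m - k n))\<^sup>2
        = 2 * (norm (p - k m))\<^sup>2 + 2 * (norm (p - k n))\<^sup>2"
      by (simp add: power2_norm_eq_inner inner_add inner_diff inner_commute algebra_simps)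
    moreover have "2 / real (Suc i) = 2 * (1 / real (Suc i))" for i by simp
    ultimately show ?thesis using kd[of m] kd[of n] by simp
  qed
  have "Cauchy k"
  proof (rule CauchyI)
    fix e :: real assume e: "0 < e"
    obtain M where M: "inverse (real (Suc M)) < e\<^sup>2 / 4" using reals_Archimedean[of "e\<^sup>2/4"] e by auto
    have "norm (k m - k n) < e" if "m \<ge> M" "n \<ge> M" for m n
    proof -
      have "1 / real (Suc m) \<le> inverse (real (Suc M))" "1 / real (Suc n) \<le> inverse (real (Suc M))"
        using that by (auto simp: field_simps)
      then have "(norm (k m - k n))\<^sup>2 < e\<^sup>2" using est[of m n] M by linarith
      then show ?thesis using e by (meson less_imp_le power_less_imp_less_base)
    qed
    then show "\<exists>M. \<forall>m\<ge>M. \<forall>n\<ge>M. norm (k m - k n) < e" by blast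
  qed
  then obtain q where qK: "q \<in> K" and q: "k \<longlonglongrightarrow> q"
    using comp[unfolded complete_def, rule_format, of k] kK by auto
  have qd: "(norm (p - q))\<^sup>2 \<le> d"
  proof (rule LIMSEQ_le)
    show "(\<lambda>n. (norm (p - k n))\<^sup>2) \<longlonglongrightarrow> (norm (p - q))\<^sup>2" by (intro tendsto_intros q)
    show "(\<lambda>n. d + inverse (real (Suc n))) \<longlonglongrightarrow> d"
      using tendsto_add[OF tendsto_const[of d] LIMSEQ_inverse_real_of_nat] by simp
    show "\<exists>N. \<forall>n\<ge>N. (norm (p - k n))\<^sup>2 \<le> d + inverse (real (Suc n))"
      using kd by (auto simp: less_imp_le inverse_eq_divide)
  qed
  have "inner (p - q) z = 0" if z: "z \<in> K" for z
  proof (cases "z = 0")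
    case False
    \<comment> \<open>The minimiser of the quadratic t \<mapsto> |p - q - t z|^2. There the squared
      distance drops by <p - q, z>^2 / |z|^2, which minimality of \<open>q\<close> forces to be
      0.\<close>
    define t where "t = inner (p - q) z / (norm z)\<^sup>2"
    have "q + t *\<^sub>R z \<in> K" using qK z sub by (intro subspace_scale subspace_add) auto
    from dle[OF this] qd have "(norm (p - q))\<^sup>2 \<le> (norm ((p - q) - t *\<^sub>R z))\<^sup>2"
      unfolding diff_diff_eq by linarith
    also have "\<dots> = (norm (p - q))\<^sup>2 - 2 * t * inner (p - q) z + t\<^sup>2 * (norm z)\<^sup>2"
      unfolding power2_norm_eq_inner by (simp add: inner_diff inner_commute algebra_simps power2_eq_square)
    also have "\<dots> = (norm (p - q))\<^sup>2 - (inner (p - q) z)\<^sup>2 / (norm z)\<^sup>2"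
      using False by (simp add: t_def field_simps power2_eq_square)
    finally have "(inner (p - q) z)\<^sup>2 / (norm z)\<^sup>2 \<le> 0" by simp
    then show ?thesis using False
      by (metis divide_eq_0_iff norm_eq_zero order_antisym power2_eq_iff_nonneg zero_le_divide_iff zero_le_power2 power_eq_0_iff zero_neq_numeral)
  qed simp
  with qK that show ?thesis by blast
qed

section \<open>Operators given by their adjoint relation, and the ground state\<close>

locale self_adjoint_operator =
  fixes H V :: "'h::real_inner set" and S :: "'h \<Rightarrow> 'h"
  assumes H_subspace: "subspace H" and H_complete: "complete H"
    and self_adjoint: "self_adjoint_on H V S"
begin

lemma V_subspace: "subspace V" and V_in_H: "x \<in> V \<Longrightarrow> x \<in> H" and S_in_H: "x \<in> V \<Longrightarrow> S x \<in> H"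
  using self_adjoint unfolding self_adjoint_on_def by auto

lemma adjoint_iff:
  "y \<in> H \<Longrightarrow> z \<in> H \<Longrightarrow> (\<forall>x\<in>V. inner (S x) y = inner x z) \<longleftrightarrow> y \<in> V \<and> S y = z"
  using self_adjoint unfolding self_adjoint_on_def by auto

lemma symmetric: "x \<in> V \<Longrightarrow> y \<in> V \<Longrightarrow> inner (S x) y = inner x (S y)"
  using adjoint_iff[of y "S y"] V_in_H S_in_H by auto

text \<open>Linearity is not part of \<open>self_adjoint_on\<close>; it follows from maximality. The
  relation <S v, y> = <v, z> for all \<open>v \<in> V\<close> characterises the graph of
  \<open>S\<close> and is linear in the pair (y, z).\<close>

lemma S_add: "x \<in> V \<Longrightarrow> y \<in> V \<Longrightarrow> S (x + y) = S x + S y"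
  using adjoint_iff[of "x + y" "S x + S y"] V_in_H S_in_H symmetric
  by (auto simp: inner_add_right subspace_add[OF H_subspace])

lemma S_scale: "x \<in> V \<Longrightarrow> S (c *\<^sub>R x) = c *\<^sub>R S x"
  using adjoint_iff[of "c *\<^sub>R x" "c *\<^sub>R S x"] V_in_H S_in_H symmetric
  by (auto simp: subspace_scale[OF H_subspace])

lemma S_diff: "x \<in> V \<Longrightarrow> y \<in> V \<Longrightarrow> S (x - y) = S x - S y"
  using S_add[of x "(-1) *\<^sub>R y"] S_scale[of y "-1"] subspace_scale[OF V_subspace, of y "-1"] by simp

lemma H_limit: "(\<And>n. x n \<in> H) \<Longrightarrow> x \<longlonglongrightarrow> l \<Longrightarrow> l \<in> H"
  using complete_imp_closed[OF H_complete] closed_sequentially by blast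

lemma H_Cauchy: "(\<And>n. x n \<in> H) \<Longrightarrow> Cauchy x \<Longrightarrow> convergent x"
  using H_complete[unfolded complete_def, rule_format, of x] by (auto simp: convergent_def)

text \<open>The graph of \<open>S\<close> is cut out by the equations <S v, y> = <v, z>, each
  continuous in y and z, so it is closed under limits of pairs.\<close>

lemma closed_operator:
  assumes xV: "\<And>n. x n \<in> V" and x: "x \<longlonglongrightarrow> l" and Sx: "(\<lambda>n. S (x n)) \<longlonglongrightarrow> m"
  shows "l \<in> V" "S l = m"
proof -
  have H: "l \<in> H" "m \<in> H"
    using H_limit[OF V_in_H[OF xV] x] H_limit[OF S_in_H[OF xV] Sx] by auto
  have "inner (S v) l = inner v m" if v: "v \<in> V" for v
  proof (rule LIMSEQ_unique)
    show "(\<lambda>n. inner (S v) (x n)) \<longlonglongrightarrow> inner (S v) l" by (intro tendsto_intros x)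
    show "(\<lambda>n. inner (S v) (x n)) \<longlonglongrightarrow> inner v m"
      unfolding symmetric[OF v xV] by (intro tendsto_intros Sx)
  qed
  then show "l \<in> V" "S l = m" using adjoint_iff[OF H] by auto
qed

text \<open>A normalised minimising sequence is Cauchy, because the compactness hypothesis bounds
  \<open>\<parallel>y\<^sub>m - y\<^sub>n\<parallel>\<close> by the nonnegative quadratic form \<open>q\<close>, for which the parallelogram law holds.\<close>

lemma ground_state:
  assumes compact_embedding: "\<And>\<epsilon>. 0 < \<epsilon> \<Longrightarrow> \<exists>E C. finite E \<and>
      (\<forall>v\<in>V. (norm v)\<^sup>2 \<le> \<epsilon> * (norm (S v))\<^sup>2 + C * (\<Sum>e\<in>E. (inner v e)\<^sup>2))"
    and nontrivial: "v0 \<in> V" "v0 \<noteq> 0"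
  shows "\<exists>\<mu> x. x \<in> V \<and> x \<noteq> 0 \<and> S x \<in> V \<and> S (S x) = \<mu> *\<^sub>R x \<and>
      (\<forall>v\<in>V. \<mu> * (norm v)\<^sup>2 \<le> (norm (S v))\<^sup>2)"
proof -
  define R where "R = (\<lambda>v. (norm (S v))\<^sup>2) ` {v \<in> V. norm v = 1}"
  have "(1 / norm v0) *\<^sub>R v0 \<in> V" "norm ((1 / norm v0) *\<^sub>R v0) = 1"
    using nontrivial by (auto intro: subspace_scale[OF V_subspace])
  then have Rne: "R \<noteq> {}" by (auto simp: R_def)
  have Rbdd: "bdd_below R" by (rule bdd_belowI[of _ 0]) (auto simp: R_def)
  define \<mu> where "\<mu> = Inf R"
  have mu0: "0 \<le> \<mu>" unfolding \<mu>_def by (rule cInf_greatest[OF Rne]) (auto simp: R_def)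
  have lower: "\<mu> * (norm v)\<^sup>2 \<le> (norm (S v))\<^sup>2" if v: "v \<in> V" for v
  proof (cases "v = 0")
    case False
    have "\<mu> \<le> (norm (S ((1 / norm v) *\<^sub>R v)))\<^sup>2"
      unfolding \<mu>_def by (rule cInf_lower[OF _ Rbdd])
        (use v False in \<open>auto simp: R_def intro!: imageI subspace_scale[OF V_subspace]\<close>)
    also have "\<dots> = (norm (S v))\<^sup>2 / (norm v)\<^sup>2"
      by (simp add: S_scale[OF v] power_divide)
    finally show ?thesis using False by (simp add: field_simps)
  qed simp
  have "\<exists>v\<in>V. norm v = 1 \<and> (norm (S v))\<^sup>2 < \<mu> + 1 / real (Suc n)" for n
    using cInf_lessD[OF Rne, of "\<mu> + 1 / real (Suc n)"] by (auto simp: R_def \<mu>_def)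
  then obtain y0 where y0V: "\<And>n. y0 n \<in> V" and y0n: "\<And>n. norm (y0 n) = 1"
    and y0S: "\<And>n. (norm (S (y0 n)))\<^sup>2 < \<mu> + 1 / real (Suc n)" by metis
  \<comment> \<open>Chosen so that \<epsilon> \<mu> \<le> 1/2: writing |S v|^2 = q v + \<mu> |v|^2
    in the compactness estimate, the part with |v|^2 is absorbed on the left.\<close>
  define \<epsilon> where "\<epsilon> = 1 / (2 * (\<mu> + 1))"
  have eps: "0 < \<epsilon>" "\<epsilon> * \<mu> \<le> 1/2" using mu0 by (auto simp: \<epsilon>_def field_simps)
  obtain E C where E: "finite E"
    and emb: "\<And>v. v \<in> V \<Longrightarrow> (norm v)\<^sup>2 \<le> \<epsilon> * (norm (S v))\<^sup>2 + C * (\<Sum>e\<in>E. (inner v e)\<^sup>2)"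
    using compact_embedding[OF eps(1)] by blast
  \<comment> \<open>Since \<open>E\<close> is finite and \<epsilon> is fixed, finitely many
    successive extractions suffice; no diagonal sequence over varying \<epsilon> is formed.\<close>
  have "\<exists>r::nat\<Rightarrow>nat. strict_mono r \<and> (\<forall>e\<in>E. convergent (\<lambda>n. inner (y0 (r n)) e))"
    using E
  proof (induction E rule: finite_induct)
    case empty
    show ?case using strict_mono_id by blast
  next
    case (insert e F)
    then obtain r :: "nat \<Rightarrow> nat" where r: "strict_mono r"
      "\<And>e. e \<in> F \<Longrightarrow> convergent (\<lambda>n. inner (y0 (r n)) e)" by blast
    have "\<bar>inner (y0 (r n)) e\<bar> \<le> norm e" for n
      using Cauchy_Schwarz_ineq2[of "y0 (r n)" e] y0n by simp
    then have "bounded (range (\<lambda>n. inner (y0 (r n)) e))"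
      unfolding bounded_iff by auto
    then obtain l s where s: "strict_mono s" "((\<lambda>n. inner (y0 (r n)) e) \<circ> s) \<longlonglongrightarrow> l"
      using bounded_imp_convergent_subsequence by blast
    have "convergent (\<lambda>n. inner (y0 ((r \<circ> s) n)) e')" if "e' \<in> insert e F" for e'
    proof (cases "e' = e")
      case True
      then show ?thesis using s(2) by (auto simp: convergent_def comp_def)
    next
      case False
      then show ?thesis
        using convergent_subseq_convergent[OF r(2) s(1), of e'] that by (simp add: comp_def)
    qed
    then show ?case using strict_mono_o[OF r(1) s(1)] by blast
  qed
  then obtain r :: "nat \<Rightarrow> nat" where r: "strict_mono r"
    and rconv: "\<And>e. e \<in> E \<Longrightarrow> convergent (\<lambda>n. inner (y0 (r n)) e)" by blast
  define y where "y n = y0 (r n)" for n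
  define q where "q v = (norm (S v))\<^sup>2 - \<mu> * (norm v)\<^sup>2" for v
  have yV: "y n \<in> V" and yn: "norm (y n) = 1" for n using y0V y0n by (auto simp: y_def)
  have yq: "q (y n) \<le> 1 / real (Suc n)" for n
  proof -
    have "1 / real (Suc (r n)) \<le> 1 / real (Suc n)"
      using seq_suble[OF r, of n] by (auto simp: field_simps)
    then show ?thesis using y0S[of "r n"] y0n[of "r n"] by (simp add: q_def y_def)
  qed
  have q0: "0 \<le> q v" if "v \<in> V" for v using lower[OF that] by (simp add: q_def)
  have qdiff: "q (y m - y n) \<le> 2 / real (Suc m) + 2 / real (Suc n)" for m n
  proof -
    have "q (y m + y n) + q (y m - y n) = 2 * q (y m) + 2 * q (y n)"
      unfolding q_def S_add[OF yV yV] S_diff[OF yV yV] power2_norm_eq_inner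
      by (simp add: inner_add inner_diff inner_commute algebra_simps)
    moreover have "0 \<le> q (y m + y n)" using yV by (intro q0 subspace_add[OF V_subspace])
    ultimately show ?thesis using yq[of m] yq[of n] by simp
  qed
  define c where "c e = lim (\<lambda>n. inner (y n) e)" for e
  have c: "(\<lambda>n. inner (y n) e) \<longlonglongrightarrow> c e" if "e \<in> E" for e
    using rconv[OF that] by (simp add: c_def convergent_LIMSEQ_iff y_def)
  \<comment> \<open>One error term per index. The factors 4 are 2 from the absorption times 2 from
    \<open>qdiff\<close>, respectively from (r - s)^2 \<le> 2 r^2 + 2 s^2.\<close>
  define b where "b n = 4 * \<epsilon> / real (Suc n) + 4 * \<bar>C\<bar> * (\<Sum>e\<in>E. (inner (y n) e - c e)\<^sup>2)" for n
  have "(\<lambda>n. 4 * \<epsilon> * inverse (real (Suc n)) + 4 * \<bar>C\<bar> * (\<Sum>e\<in>E. (inner (y n) e - c e)\<^sup>2))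
      \<longlonglongrightarrow> 4 * \<epsilon> * 0 + 4 * \<bar>C\<bar> * (\<Sum>e\<in>E. (c e - c e)\<^sup>2)"
    by (intro tendsto_intros LIMSEQ_inverse_real_of_nat c)
  then have b0: "b \<longlonglongrightarrow> 0" by (simp add: b_def[abs_def] divide_inverse)
  have ydiff: "(norm (y m - y n))\<^sup>2 \<le> b m + b n" for m n
  proof -
    have dV: "y m - y n \<in> V" using yV by (intro subspace_diff[OF V_subspace])
    have "(norm (y m - y n))\<^sup>2 \<le> \<epsilon> * (norm (S (y m - y n)))\<^sup>2
        + C * (\<Sum>e\<in>E. (inner (y m - y n) e)\<^sup>2)" by (rule emb[OF dV])
    also have "\<epsilon> * (norm (S (y m - y n)))\<^sup>2 = \<epsilon> * q (y m - y n) + (\<epsilon> * \<mu>) * (norm (y m - y n))\<^sup>2"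
      by (simp add: q_def algebra_simps)
    also have "(\<epsilon> * \<mu>) * (norm (y m - y n))\<^sup>2 \<le> 1/2 * (norm (y m - y n))\<^sup>2"
      by (rule mult_right_mono[OF eps(2)]) simp
    also have "\<epsilon> * q (y m - y n) \<le> \<epsilon> * (2 / real (Suc m) + 2 / real (Suc n))"
      by (rule mult_left_mono[OF qdiff]) (use eps in simp)
    also have "C * (\<Sum>e\<in>E. (inner (y m - y n) e)\<^sup>2)
        \<le> \<bar>C\<bar> * (\<Sum>e\<in>E. 2 * (inner (y m) e - c e)\<^sup>2 + 2 * (inner (y n) e - c e)\<^sup>2)"
    proof (intro mult_mono sum_mono)
      fix e
      have "0 \<le> ((inner (y m) e - c e) + (inner (y n) e - c e))\<^sup>2" by simp
      then show "(inner (y m - y n) e)\<^sup>2 \<le> 2 * (inner (y m) e - c e)\<^sup>2 + 2 * (inner (y n) e - c e)\<^sup>2"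
        unfolding inner_diff_left by (simp add: power2_eq_square algebra_simps)
    qed (auto intro: sum_nonneg)
    finally have "(norm (y m - y n))\<^sup>2 \<le> 2 * (\<epsilon> * (2 / real (Suc m) + 2 / real (Suc n))
      + \<bar>C\<bar> * (\<Sum>e\<in>E. 2 * (inner (y m) e - c e)\<^sup>2 + 2 * (inner (y n) e - c e)\<^sup>2))" by simp
    also have "\<dots> = b m + b n"
      by (simp add: b_def sum.distrib sum_distrib_left algebra_simps)
    finally show ?thesis .
  qed
  have Cauchy_from: "Cauchy X" if Xg: "\<And>m n. (norm (X m - X n))\<^sup>2 \<le> g m + g n" and g0: "g \<longlonglongrightarrow> (0::real)"
    for X :: "nat \<Rightarrow> 'h" and g
  proof (rule CauchyI)
    fix e :: real assume e: "0 < e"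
    then obtain N where N: "\<And>n. n \<ge> N \<Longrightarrow> \<bar>g n\<bar> < e\<^sup>2/2"
      using LIMSEQ_D[OF g0, of "e\<^sup>2/2"] by auto
    have "norm (X m - X n) < e" if mn: "m \<ge> N" "n \<ge> N" for m n
    proof -
      have "(norm (X m - X n))\<^sup>2 < e\<^sup>2"
        using Xg[of m n] N[OF mn(1)] N[OF mn(2)] by linarith
      then show ?thesis using e by (meson less_imp_le power_less_imp_less_base)
    qed
    then show "\<exists>M. \<forall>m\<ge>M. \<forall>n\<ge>M. norm (X m - X n) < e" by blast
  qed
  have "Cauchy y" by (rule Cauchy_from[OF ydiff b0])
  then obtain x where x: "y \<longlonglongrightarrow> x"
    using H_Cauchy[of y, OF V_in_H[OF yV]] by (auto simp: convergent_def)
  have "Cauchy (\<lambda>n. S (y n))"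
  proof (rule Cauchy_from)
    \<comment> \<open>Convergence of \<open>y\<close> in norm lifts to the graph norm because |S
      v|^2 = q v + \<mu> |v|^2 and both terms are small for v = y m - y n.\<close>
    show "(norm (S (y m) - S (y n)))\<^sup>2
        \<le> (2 * inverse (real (Suc m)) + \<mu> * b m) + (2 * inverse (real (Suc n)) + \<mu> * b n)" for m n
      using qdiff[of m n] mult_left_mono[OF ydiff[of m n] mu0]
      by (simp add: q_def S_diff[OF yV yV] algebra_simps divide_inverse)
    have "(\<lambda>n. 2 * inverse (real (Suc n)) + \<mu> * b n) \<longlonglongrightarrow> 2 * 0 + \<mu> * 0"
      by (intro tendsto_intros LIMSEQ_inverse_real_of_nat b0)
    then show "(\<lambda>n. 2 * inverse (real (Suc n)) + \<mu> * b n) \<longlonglongrightarrow> 0" by simp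
  qed
  then obtain m where m: "(\<lambda>n. S (y n)) \<longlonglongrightarrow> m"
    using H_Cauchy[of "\<lambda>n. S (y n)", OF S_in_H[OF yV]] by (auto simp: convergent_def)
  have xV: "x \<in> V" and Sx: "S x = m" using closed_operator[OF yV x m] by auto
  have xn: "norm x = 1" using LIMSEQ_unique[OF tendsto_norm[OF x]] yn by simp
  have qx: "q x = 0"
  proof (rule antisym[OF _ q0[OF xV]])
    show "q x \<le> 0"
    proof (rule LIMSEQ_le)
      show "(\<lambda>n. q (y n)) \<longlonglongrightarrow> q x" unfolding q_def Sx by (intro tendsto_intros x m)
      show "(\<lambda>n. inverse (real (Suc n))) \<longlonglongrightarrow> 0" by (rule LIMSEQ_inverse_real_of_nat)
      show "\<exists>N. \<forall>n\<ge>N. q (y n) \<le> inverse (real (Suc n))" using yq by (auto simp: inverse_eq_divide)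
    qed
  qed
  have stat: "inner (S \<phi>) (S x) = inner \<phi> (\<mu> *\<^sub>R x)" if phi: "\<phi> \<in> V" for \<phi>
  proof -
    define B where "B = inner (S \<phi>) (S x) - \<mu> * inner \<phi> x"
    have ineq: "0 \<le> 2 * t * B + t\<^sup>2 * q \<phi>" for t
    proof -
      have "q (x + t *\<^sub>R \<phi>) = q x + 2 * t * B + t\<^sup>2 * q \<phi>"
        unfolding q_def B_def S_add[OF xV subspace_scale[OF V_subspace phi]] S_scale[OF phi] power2_norm_eq_inner
        by (simp add: inner_add inner_commute algebra_simps power2_eq_square)
      moreover have "0 \<le> q (x + t *\<^sub>R \<phi>)"
        using xV phi by (intro q0 subspace_add[OF V_subspace] subspace_scale[OF V_subspace])
      ultimately show ?thesis using qx by simp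
    qed
    have "B = 0"
    proof (rule ccontr)
      assume B: "B \<noteq> 0"
      have qp: "0 < q \<phi> + 1" using q0[OF phi] by simp
      \<comment> \<open>This value of t makes the quadratic negative when B is nonzero; the added 1
        keeps the denominator positive even if \<open>q \<phi> = 0\<close>.\<close>
      have "0 \<le> 2 * (- B / (q \<phi> + 1)) * B + (- B / (q \<phi> + 1))\<^sup>2 * q \<phi>" by (rule ineq)
      also have "\<dots> \<le> 2 * (- B / (q \<phi> + 1)) * B + (- B / (q \<phi> + 1))\<^sup>2 * (q \<phi> + 1)"
        by (intro add_left_mono mult_left_mono) auto
      also have "\<dots> = - (B\<^sup>2 / (q \<phi> + 1))"
        using qp by (simp add: power2_eq_square)
      also have "\<dots> < 0" using B qp by simp
      finally show False by simp
    qed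
    then show ?thesis by (simp add: B_def)
  qed
  \<comment> \<open>The Euler-Lagrange equation \<open>stat\<close> is literally the adjoint
    relation for the pair \<open>S x\<close>, \<mu> x, so the regularity \<open>S x \<in> V\<close>
    comes for free.\<close>
  have "S x \<in> V \<and> S (S x) = \<mu> *\<^sub>R x"
    using adjoint_iff[of "S x" "\<mu> *\<^sub>R x"] stat xV V_in_H S_in_H subspace_scale[OF H_subspace] by blast
  moreover have "x \<noteq> 0" using xn by auto
  ultimately show ?thesis using xV lower by blast
qed

end

section \<open>The square root: graph density of \<open>D\<close> and the lowest eigenvalue\<close>

lemma complete_Times:
  fixes A :: "'a::metric_space set" and B :: "'b::metric_space set"
  assumes "complete A" "complete B"
  shows "complete (A \<times> B)"
  unfolding complete_def
proof (intro allI impI, elim conjE)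
  fix f :: "nat \<Rightarrow> 'a \<times> 'b" assume f: "\<forall>n. f n \<in> A \<times> B" "Cauchy f"
  have "Cauchy (\<lambda>n. fst (f n))" "Cauchy (\<lambda>n. snd (f n))"
    using f(2) by (simp_all add: Cauchy_fst Cauchy_snd)
  moreover have "\<forall>n. fst (f n) \<in> A" "\<forall>n. snd (f n) \<in> B" using f(1) by (auto simp: mem_Times_iff)
  ultimately obtain a b where "a \<in> A" "(\<lambda>n. fst (f n)) \<longlonglongrightarrow> a" "b \<in> B" "(\<lambda>n. snd (f n)) \<longlonglongrightarrow> b"
    using assms[unfolded complete_def, rule_format] by metis
  then show "\<exists>l\<in>A \<times> B. f \<longlonglongrightarrow> l"
    using tendsto_Pair[of "\<lambda>n. fst (f n)" a sequentially "\<lambda>n. snd (f n)" b] by auto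
qed

locale square_root_operator = self_adjoint_operator H V S
  for H V :: "'h::real_inner set" and S +
  fixes D :: "'h set" and T :: "'h \<Rightarrow> 'h"
  assumes square_root: "D = {x \<in> V. S x \<in> V}" "\<And>x. x \<in> D \<Longrightarrow> S (S x) = T x"
    and T_self_adjoint: "self_adjoint_on H D T"
begin

lemma D_subspace: "subspace D"
  using T_self_adjoint unfolding self_adjoint_on_def by auto

lemma D_in_V: "x \<in> D \<Longrightarrow> x \<in> V" and S_in_V: "x \<in> D \<Longrightarrow> S x \<in> V"
  using square_root by auto

lemma inner_S_S: "v \<in> V \<Longrightarrow> x \<in> D \<Longrightarrow> inner (S v) (S x) = inner v (T x)"
  using symmetric[of v "S x"] square_root(2) S_in_V by auto

text \<open>\<open>D\<close> is a core of \<open>S\<close>: a vector of \<open>V\<close> that is orthogonal to \<open>D\<close> in the graph inner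
  product satisfies \<open>T v = -v\<close>.\<close>

lemma core:
  assumes v: "v \<in> V"
  obtains x where "\<And>n. x n \<in> D" "x \<longlonglongrightarrow> v" "(\<lambda>n. S (x n)) \<longlonglongrightarrow> S v"
proof -
  define G where "G = (\<lambda>x. (x, S x)) ` D"
  have subG: "subspace G"
  proof (rule subspaceI)
    show "0 \<in> G" using subspace_0[OF D_subspace] S_scale[of 0 0] D_in_V
      by (auto simp: G_def zero_prod_def intro!: image_eqI[of _ _ 0])
    show "a + b \<in> G" if "a \<in> G" "b \<in> G" for a b
      using that S_add D_in_V subspace_add[OF D_subspace] by (auto simp: G_def intro!: image_eqI)
    show "c *\<^sub>R a \<in> G" if "a \<in> G" for c a
      using that S_scale D_in_V subspace_scale[OF D_subspace] by (auto simp: G_def intro!: image_eqI)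
  qed
  have cHH: "complete (H \<times> H)" by (intro complete_Times H_complete)
  \<comment> \<open>The graph inner product is the inner product of pairs, so the projection is
    taken in the product space; \<open>closure G\<close> is complete as a closed subset of
    \<open>H \<times> H\<close>.\<close>
  have "G \<subseteq> H \<times> H" using D_in_V V_in_H S_in_H by (auto simp: G_def)
  then have "closure G \<subseteq> H \<times> H" by (rule closure_minimal) (rule complete_imp_closed[OF cHH])
  then have cl: "complete (closure G)"
    using complete_closed_subset[OF closed_closure _ cHH] by blast
  have subcl: "subspace (closure G)"
  proof (rule subspaceI)
    show "0 \<in> closure G" using subspace_0[OF subG] closure_subset by blast
  next
    fix a b assume "a \<in> closure G" "b \<in> closure G"
    then obtain p q where "\<And>n. p n \<in> G" "p \<longlonglongrightarrow> a" "\<And>n. q n \<in> G" "q \<longlonglongrightarrow> b"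
      unfolding closure_sequential by blast
    then have "\<And>n. p n + q n \<in> G" "(\<lambda>n. p n + q n) \<longlonglongrightarrow> a + b"
      by (auto intro: subspace_add[OF subG] tendsto_add)
    then show "a + b \<in> closure G" unfolding closure_sequential by fast
  next
    fix a c assume "a \<in> closure G"
    then obtain p where "\<And>n. p n \<in> G" "p \<longlonglongrightarrow> a"
      unfolding closure_sequential by blast
    then have "\<And>n. c *\<^sub>R p n \<in> G" "(\<lambda>n. c *\<^sub>R p n) \<longlonglongrightarrow> c *\<^sub>R a"
      by (auto intro: subspace_scale[OF subG] tendsto_intros)
    then show "c *\<^sub>R a \<in> closure G" unfolding closure_sequential by fast
  qed
  obtain q where q: "q \<in> closure G" "\<And>k. k \<in> closure G \<Longrightarrow> inner ((v, S v) - q) k = 0"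
    using complete_subspace_projection[OF subcl cl] by blast
  have seq: "\<exists>x. (\<forall>n. x n \<in> D) \<and> x \<longlonglongrightarrow> fst p \<and> (\<lambda>n. S (x n)) \<longlonglongrightarrow> snd p" if p: "p \<in> closure G" for p
  proof -
    obtain g where g: "\<And>n. g n \<in> G" "g \<longlonglongrightarrow> p" using p unfolding closure_sequential by blast
    have "\<forall>n. \<exists>x\<in>D. g n = (x, S x)" using g(1) by (auto simp: G_def)
    then obtain x where x: "\<And>n. x n \<in> D" "\<And>n. g n = (x n, S (x n))" by metis
    then show ?thesis using tendsto_fst[OF g(2)] tendsto_snd[OF g(2)] by auto
  qed
  obtain x where x: "\<And>n. x n \<in> D" "x \<longlonglongrightarrow> fst q" "(\<lambda>n. S (x n)) \<longlonglongrightarrow> snd q"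
    using seq[OF q(1)] by blast
  have qV: "fst q \<in> V" "S (fst q) = snd q" using closed_operator[OF D_in_V[OF x(1)] x(2,3)] by auto
  define z where "z = v - fst q"
  have zV: "z \<in> V" and Sz: "S z = S v - snd q"
    using v qV S_diff subspace_diff[OF V_subspace] by (auto simp: z_def)
  have orth: "inner (T y) z = inner y (- z)" if y: "y \<in> D" for y
  proof -
    have "(y, S y) \<in> closure G" using y closure_subset[of G] by (auto simp: G_def)
    moreover have "inner ((v, S v) - q) (y, S y) = inner z y + inner (S z) (S y)"
      unfolding Sz by (simp add: inner_prod_def z_def)
    ultimately have "inner z y + inner (S z) (S y) = 0" using q(2) by simp
    then show ?thesis using inner_S_S[OF zV y] by (simp add: inner_commute)
  qed
  \<comment> \<open>Self-adjointness of \<open>T\<close> is applied to the pair \<open>z\<close>,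
    \<open>- z\<close>; the membership \<open>z \<in> D\<close> is thereby a conclusion and need not
    be known beforehand.\<close>
  have "z \<in> H" "- z \<in> H" using zV V_in_H H_subspace by (auto simp: subspace_neg)
  then have zD: "z \<in> D" "T z = - z"
    using orth T_self_adjoint unfolding self_adjoint_on_def by blast+
  have "(norm (S z))\<^sup>2 = - (norm z)\<^sup>2"
    using inner_S_S[OF zV zD(1)] zD(2) by (simp add: power2_norm_eq_inner)
  then have "z = 0" using zero_le_power2[of "norm (S z)"] by (smt (verit) zero_less_power2 norm_eq_zero)
  then have "fst q = v" by (simp add: z_def)
  with that x qV show ?thesis by metis
qed

text \<open>The compactness estimate is demanded on \<open>D\<close> only, where |S v|^2 = <v, T v>
  can be computed; it is continuous in the graph norm and passes to \<open>V\<close>. The minimiser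
  then found in \<open>V\<close> satisfies \<open>S x \<in> V\<close>, so it lies in
  \<open>D\<close> and is an eigenvector of \<open>T\<close>, whence \<kappa> \<le> \<mu>.\<close>

lemma lower_bound_by_smallest_eigenvalue:
  assumes compact_embedding: "\<And>\<epsilon>. 0 < \<epsilon> \<Longrightarrow> \<exists>E C. finite E \<and>
      (\<forall>v\<in>D. (norm v)\<^sup>2 \<le> \<epsilon> * (norm (S v))\<^sup>2 + C * (\<Sum>e\<in>E. (inner v e)\<^sup>2))"
    and smallest: "smallest_eigenvalue_on D T \<kappa>" and v: "v \<in> V"
  shows "\<kappa> * (norm v)\<^sup>2 \<le> (norm (S v))\<^sup>2"
proof (cases "v = 0")
  case False
  have embV: "\<exists>E C. finite E \<and>
      (\<forall>v\<in>V. (norm v)\<^sup>2 \<le> \<epsilon> * (norm (S v))\<^sup>2 + C * (\<Sum>e\<in>E. (inner v e)\<^sup>2))" if "0 < \<epsilon>" for \<epsilon>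
  proof -
    obtain E C where E: "finite E"
      "\<And>v. v \<in> D \<Longrightarrow> (norm v)\<^sup>2 \<le> \<epsilon> * (norm (S v))\<^sup>2 + C * (\<Sum>e\<in>E. (inner v e)\<^sup>2)"
      using compact_embedding[OF \<open>0 < \<epsilon>\<close>] by blast
    have "(norm v)\<^sup>2 \<le> \<epsilon> * (norm (S v))\<^sup>2 + C * (\<Sum>e\<in>E. (inner v e)\<^sup>2)" if v: "v \<in> V" for v
    proof -
      obtain x where x: "\<And>n. x n \<in> D" "x \<longlonglongrightarrow> v" "(\<lambda>n. S (x n)) \<longlonglongrightarrow> S v"
        using core[OF v] by blast
      show ?thesis
      proof (rule LIMSEQ_le)
        show "(\<lambda>n. (norm (x n))\<^sup>2) \<longlonglongrightarrow> (norm v)\<^sup>2" by (intro tendsto_intros x)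
        show "(\<lambda>n. \<epsilon> * (norm (S (x n)))\<^sup>2 + C * (\<Sum>e\<in>E. (inner (x n) e)\<^sup>2))
          \<longlonglongrightarrow> \<epsilon> * (norm (S v))\<^sup>2 + C * (\<Sum>e\<in>E. (inner v e)\<^sup>2)" by (intro tendsto_intros x)
      qed (use E(2) x(1) in auto)
    qed
    with E(1) show ?thesis by blast
  qed
  have "\<exists>\<mu> x. x \<in> V \<and> x \<noteq> 0 \<and> S x \<in> V \<and> S (S x) = \<mu> *\<^sub>R x \<and>
      (\<forall>v\<in>V. \<mu> * (norm v)\<^sup>2 \<le> (norm (S v))\<^sup>2)"
    by (rule ground_state[OF embV v False])
  then obtain \<mu> x where x: "x \<in> V" "x \<noteq> 0" "S x \<in> V" "S (S x) = \<mu> *\<^sub>R x"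
    "\<And>v. v \<in> V \<Longrightarrow> \<mu> * (norm v)\<^sup>2 \<le> (norm (S v))\<^sup>2"
    by metis
  then have "eigenvalue_on D T \<mu>"
    unfolding eigenvalue_on_def using square_root by (intro bexI[of _ x]) auto
  then have "\<kappa> \<le> \<mu>" using smallest unfolding smallest_eigenvalue_on_def by blast
  then show ?thesis using x(5)[OF v] mult_right_mono[of \<kappa> \<mu> "(norm v)\<^sup>2"] by simp
next
  case True
  then show ?thesis by simp
qed

end

section \<open>Energy decay for weak solutions of the damped wave equation\<close>

lemma uniform_limit_bound:
  assumes "\<And>n x. x \<in> X \<Longrightarrow> dist (f n x) (g x) \<le> b n" and "b \<longlonglongrightarrow> (0::real)"
  shows "uniform_limit X f g sequentially"
proof (rule uniform_limitI)
  fix e :: real assume "0 < e"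
  then have "\<forall>\<^sub>F n in sequentially. b n < e" using assms(2) by (rule order_tendstoD(2)[rotated])
  then show "\<forall>\<^sub>F n in sequentially. \<forall>x\<in>X. dist (f n x) (g x) < e"
    by eventually_elim (use assms(1) le_less_trans in blast)
qed

text \<open>The common device for the enlarged weak equation and for the energy identity: a function
  that cannot be differentiated directly is a limit of differentiable ones whose derivatives
  converge uniformly near \<open>t\<close>. The convergence theorem only yields some limit
  \<open>k\<close>, which equals \<open>g\<close> on the interval and hence near
  \<open>t\<close>.\<close>

lemma real_derivative_sequence:
  fixes f :: "nat \<Rightarrow> real \<Rightarrow> real"
  assumes t: "a < t" "t < b"
    and derf: "\<And>n x. x \<in> {a..b} \<Longrightarrow> (f n has_real_derivative f' n x) (at x)"
    and unif: "uniform_limit {a..b} f' g' sequentially"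
    and lim: "\<And>x. x \<in> {a..b} \<Longrightarrow> (\<lambda>n. f n x) \<longlonglongrightarrow> g x"
  shows "(g has_real_derivative g' t) (at t)"
proof -
  have tab: "t \<in> {a..b}" using t by auto
  have "\<exists>k. \<forall>x\<in>{a..b}. (\<lambda>n. f n x) \<longlonglongrightarrow> k x \<and> (k has_derivative (*) (g' x)) (at x within {a..b})"
  proof (rule has_derivative_sequence[where f = f and f' = "\<lambda>n x. (*) (f' n x)" and g' = "\<lambda>x. (*) (g' x)",
          OF _ _ _ tab lim[OF tab]])
    show "(f n has_derivative (*) (f' n x)) (at x within {a..b})" if "x \<in> {a..b}" for n x
      using derf[OF that, of n] unfolding has_field_derivative_def by (rule has_derivative_at_withinI)
    show "\<forall>\<^sub>F n in sequentially. \<forall>x\<in>{a..b}. \<forall>h. norm (f' n x * h - g' x * h) \<le> e * norm h"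
      if "0 < e" for e
      using uniform_limitD[OF unif that]
      by eventually_elim
        (auto simp: dist_real_def abs_mult left_diff_distrib[symmetric] intro!: mult_right_mono intro: less_imp_le)
  qed simp
  then obtain k where k: "\<And>x. x \<in> {a..b} \<Longrightarrow> (\<lambda>n. f n x) \<longlonglongrightarrow> k x"
    and dk: "(k has_derivative (*) (g' t)) (at t within {a..b})" using tab by blast
  have "(k has_real_derivative g' t) (at t)"
    using dk t by (simp add: has_field_derivative_def at_within_Icc_at)
  then show ?thesis
  proof (rule DERIV_cong_ev[THEN iffD1, rotated -1])
    have "\<forall>\<^sub>F x in nhds t. x \<in> {a<..<b}" using t by (intro eventually_nhds_in_open) auto
    then show "\<forall>\<^sub>F x in nhds t. k x = g x"
      by eventually_elim (use LIMSEQ_unique[OF k lim] in auto)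
  qed auto
qed

lemma has_vector_derivative_shift_real:
  assumes "(W has_vector_derivative d) (at (s + h))"
  shows "((\<lambda>s. W (s + h)) has_vector_derivative d) (at (s::real))"
proof -
  have "((\<lambda>s. s + h) has_vector_derivative 1) (at s)"
    by (auto intro!: derivative_eq_intros)
  from vector_diff_chain_at[OF this assms] show ?thesis by (simp add: o_def)
qed

text \<open>A test vector in \<open>V\<close> is approximated from \<open>D\<close> in the graph
  norm. On the compact interval from t/2 to 2t both \<open>W'\<close> and \<open>S W\<close> are
  bounded, so the right-hand sides, rewritten with <S W, S x> in place of <W, T x>, converge
  uniformly there.\<close>

lemma (in square_root_operator) extend_weak_equation:
  fixes W W' :: "real \<Rightarrow> 'h"
  assumes W: "\<And>t. 0 \<le> t \<Longrightarrow> W t \<in> V" and cont: "continuous_on {0..} W'" "continuous_on {0..} (\<lambda>t. S (W t))"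
    and weak: "\<And>\<phi> t. \<phi> \<in> D \<Longrightarrow> 0 < t \<Longrightarrow> ((\<lambda>s. inner (W' s) \<phi>) has_real_derivative
        - \<alpha> * inner (W' t) \<phi> - inner (W t) (T \<phi>)) (at t)"
    and phi: "\<phi> \<in> V" and t: "0 < t"
  shows "((\<lambda>s. inner (W' s) \<phi>) has_real_derivative
        - \<alpha> * inner (W' t) \<phi> - inner (S (W t)) (S \<phi>)) (at t)"
proof -
  obtain x where x: "\<And>n. x n \<in> D" "x \<longlonglongrightarrow> \<phi>" "(\<lambda>n. S (x n)) \<longlonglongrightarrow> S \<phi>"
    using core[OF phi] by blast
  define I where "I = {t/2..2*t}"
  have I: "compact I" "I \<subseteq> {0..}" using t by (auto simp: I_def)
  have "bounded (W' ` I)" "bounded ((\<lambda>t. S (W t)) ` I)"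
    using I by (auto intro!: compact_imp_bounded compact_continuous_image continuous_on_subset[OF cont(1)]
        continuous_on_subset[OF cont(2)])
  then obtain B1 B2 where B1: "\<And>s. s \<in> I \<Longrightarrow> norm (W' s) \<le> B1" and B2: "\<And>s. s \<in> I \<Longrightarrow> norm (S (W s)) \<le> B2"
    unfolding bounded_iff by auto
  show ?thesis
  proof (rule real_derivative_sequence[where f = "\<lambda>n s. inner (W' s) (x n)" and a = "t/2" and b = "2*t"
        and f' = "\<lambda>n s. - \<alpha> * inner (W' s) (x n) - inner (S (W s)) (S (x n))"
        and g' = "\<lambda>s. - \<alpha> * inner (W' s) \<phi> - inner (S (W s)) (S \<phi>)"])
    show "t/2 < t" "t < 2*t" using t by auto
    show "((\<lambda>s. inner (W' s) (x n)) has_real_derivative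
        - \<alpha> * inner (W' s) (x n) - inner (S (W s)) (S (x n))) (at s)" if "s \<in> {t/2..2*t}" for n s
      using weak[OF x(1), of s n] inner_S_S[OF W x(1), of s n] that t by simp
    show "(\<lambda>n. inner (W' s) (x n)) \<longlonglongrightarrow> inner (W' s) \<phi>" for s by (intro tendsto_intros x)
    show "uniform_limit {t/2..2*t} (\<lambda>n s. - \<alpha> * inner (W' s) (x n) - inner (S (W s)) (S (x n)))
        (\<lambda>s. - \<alpha> * inner (W' s) \<phi> - inner (S (W s)) (S \<phi>)) sequentially"
    proof (rule uniform_limit_bound)
      fix n s assume "s \<in> {t/2..2*t}"
      then have s: "s \<in> I" by (simp add: I_def)
      have "dist (- \<alpha> * inner (W' s) (x n) - inner (S (W s)) (S (x n)))
          (- \<alpha> * inner (W' s) \<phi> - inner (S (W s)) (S \<phi>))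
        = \<bar>- \<alpha> * inner (W' s) (x n - \<phi>) - inner (S (W s)) (S (x n) - S \<phi>)\<bar>"
        by (simp add: dist_real_def inner_diff_right algebra_simps)
      also have "\<dots> \<le> \<bar>\<alpha>\<bar> * \<bar>inner (W' s) (x n - \<phi>)\<bar> + \<bar>inner (S (W s)) (S (x n) - S \<phi>)\<bar>"
        by (rule order_trans[OF abs_triangle_ineq4]) (simp add: abs_mult)
      also have "\<dots> \<le> \<bar>\<alpha>\<bar> * (B1 * norm (x n - \<phi>)) + B2 * norm (S (x n) - S \<phi>)"
        by (intro add_mono mult_left_mono order_trans[OF Cauchy_Schwarz_ineq2] mult_right_mono B1 B2 s) auto
      finally show "dist (- \<alpha> * inner (W' s) (x n) - inner (S (W s)) (S (x n)))
          (- \<alpha> * inner (W' s) \<phi> - inner (S (W s)) (S \<phi>))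
          \<le> \<bar>\<alpha>\<bar> * (B1 * norm (x n - \<phi>)) + B2 * norm (S (x n) - S \<phi>)" .
    next
      have "(\<lambda>n. \<bar>\<alpha>\<bar> * (B1 * norm (x n - \<phi>)) + B2 * norm (S (x n) - S \<phi>))
          \<longlonglongrightarrow> \<bar>\<alpha>\<bar> * (B1 * norm (\<phi> - \<phi>)) + B2 * norm (S \<phi> - S \<phi>)"
        by (intro tendsto_intros x)
      then show "(\<lambda>n. \<bar>\<alpha>\<bar> * (B1 * norm (x n - \<phi>)) + B2 * norm (S (x n) - S \<phi>)) \<longlonglongrightarrow> 0" by simp
    qed
  qed
qed

section \<open>The homogeneous equation: energy identity and Lyapunov functional\<close>

locale homogeneous_damped_wave = self_adjoint_operator H V S
  for H V :: "'h::real_inner set" and S +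
  fixes \<alpha> :: real and W W' :: "real \<Rightarrow> 'h"
  assumes W_in_V: "0 \<le> t \<Longrightarrow> W t \<in> V"
    and W_deriv: "0 \<le> t \<Longrightarrow> (W has_vector_derivative W' t) (at t within {0..})"
    and W'_cont: "continuous_on {0..} W'"
    and SW_cont: "continuous_on {0..} (\<lambda>t. S (W t))"
    and weak: "\<phi> \<in> V \<Longrightarrow> 0 < t \<Longrightarrow> ((\<lambda>s. inner (W' s) \<phi>) has_real_derivative
        - \<alpha> * inner (W' t) \<phi> - inner (S (W t)) (S \<phi>)) (at t)"
begin

lemma W_deriv_at: "0 < t \<Longrightarrow> (W has_vector_derivative W' t) (at t)"
  using W_deriv[of t] at_within_interior[of t "{0..}"] by simp

lemma W_cont: "continuous_on {0..} W"
  using W_deriv has_vector_derivative_continuous by (force simp: continuous_on_eq_continuous_within)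

text \<open>\<open>W'\<close> is only weakly differentiable, so this product rule is not an instance of the usual one.\<close>

lemma weak_product_rule:
  assumes t: "0 < t" and phiV: "\<phi> t \<in> V" and dphi: "(\<phi> has_vector_derivative \<phi>') (at t)"
  shows "((\<lambda>s. inner (W' s) (\<phi> s)) has_real_derivative
      inner (W' t) \<phi>' - \<alpha> * inner (W' t) (\<phi> t) - inner (S (W t)) (S (\<phi> t))) (at t)"
proof -
  \<comment> \<open>The product is split as <W' s, \<phi> s - \<phi> t> + <W' s, \<phi> t>. The
    second part is the weak equation for a fixed test vector; the first vanishes at \<open>t\<close>
    and has the slope function \<open>g\<close>, whose continuity at \<open>t\<close> asks only for
    continuity of \<open>W'\<close> and differentiability of \<phi>.\<close>
  define g where "g s = inner (W' s) (if s = t then \<phi>' else (1 / (s - t)) *\<^sub>R (\<phi> s - \<phi> t))" for s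
  have "(\<lambda>s. (1 / (s - t)) *\<^sub>R (\<phi> s - \<phi> t)) \<midarrow>t\<rightarrow> \<phi>'"
  proof (rule LIM_zero_cancel, rule tendsto_norm_zero_cancel)
    have "((\<lambda>s. norm (\<phi> s - \<phi> t - (s - t) *\<^sub>R \<phi>') / norm (s - t)) \<longlongrightarrow> 0) (at t)"
      using dphi unfolding has_vector_derivative_def has_derivative_iff_norm by auto
    moreover have "\<forall>\<^sub>F s in at t. norm (\<phi> s - \<phi> t - (s - t) *\<^sub>R \<phi>') / norm (s - t)
        = norm ((1 / (s - t)) *\<^sub>R (\<phi> s - \<phi> t) - \<phi>')"
    proof (rule eventually_at_topological[THEN iffD2], intro exI[of _ UNIV] conjI ballI impI)
      fix s assume "s \<noteq> t"
      then have "(1 / (s - t)) *\<^sub>R (\<phi> s - \<phi> t) - \<phi>' = (1 / (s - t)) *\<^sub>R (\<phi> s - \<phi> t - (s - t) *\<^sub>R \<phi>')"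
        by (simp add: scaleR_diff_right)
      then show "norm (\<phi> s - \<phi> t - (s - t) *\<^sub>R \<phi>') / norm (s - t)
        = norm ((1 / (s - t)) *\<^sub>R (\<phi> s - \<phi> t) - \<phi>')" by (simp add: divide_inverse mult.commute)
    qed auto
    ultimately show "((\<lambda>s. norm ((1 / (s - t)) *\<^sub>R (\<phi> s - \<phi> t) - \<phi>')) \<longlongrightarrow> 0) (at t)"
      by (rule Lim_transform_eventually)
  qed
  then have "isCont (\<lambda>s. if s = t then \<phi>' else (1 / (s - t)) *\<^sub>R (\<phi> s - \<phi> t)) t"
    unfolding isCont_def by (auto cong: LIM_cong)
  moreover have "isCont W' t"
    using W'_cont t by (auto simp: continuous_on_eq_continuous_within at_within_interior[of t "{0..}"]
        dest!: bspec[of _ _ t])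
  ultimately have "isCont g t" unfolding g_def by (intro continuous_intros)
  moreover have "inner (W' s) (\<phi> s - \<phi> t) - inner (W' t) (\<phi> t - \<phi> t) = g s * (s - t)" for s
    by (auto simp: g_def)
  ultimately have "((\<lambda>s. inner (W' s) (\<phi> s - \<phi> t)) has_real_derivative g t) (at t)"
    unfolding CARAT_DERIV by blast
  then have "((\<lambda>s. inner (W' s) (\<phi> s - \<phi> t)) has_real_derivative inner (W' t) \<phi>') (at t)"
    by (simp add: g_def)
  from DERIV_add[OF this weak[OF phiV t]] show ?thesis
    by (simp add: inner_diff_right algebra_simps)
qed

lemma W'_isCont: "0 < t \<Longrightarrow> isCont W' t" and SW_isCont: "0 < t \<Longrightarrow> isCont (\<lambda>t. S (W t)) t"
  using W'_cont SW_cont interior_real_atLeast[of 0]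
  by (auto intro: continuous_on_interior)

text \<open>Since \<open>W'\<close> is not an admissible test function, the equation is tested with the symmetric
  difference \<open>W(t + h) - W(t - h)\<close>. With \<open>P\<close> an antiderivative of \<open>K\<close> below, the terms without
  \<open>\<alpha>\<close> are the derivative of \<open>P(t) - P(t - h)\<close>.\<close>

lemma energy_derivative:
  assumes t: "0 < t"
  shows "((\<lambda>s. (norm (W' s))\<^sup>2 + (norm (S (W s)))\<^sup>2) has_real_derivative - 2 * \<alpha> * (norm (W' t))\<^sup>2) (at t)"
proof -
  \<comment> \<open>The bound h \<le> t/4 keeps s - h positive and s + h below 3t for every s
    between t/2 and 2t.\<close>
  define h where "h n = t / 4 * inverse (real (Suc n))" for n
  have h: "0 < h n" "h n \<le> t/4" for n
    using t by (auto simp: h_def field_simps)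
  have h0: "h \<longlonglongrightarrow> 0"
    using tendsto_mult[OF tendsto_const[of "t/4"] LIMSEQ_inverse_real_of_nat] by (simp add: h_def[abs_def])
  define K where "K n s = inner (W' s) (W' (s + h n)) - inner (S (W s)) (S (W (s + h n)))" for n s
  define F where "F n s = inner (W' s) (W (s + h n) - W (s - h n))" for n s
  define P where "P n s = integral {0..s} (K n)" for n s
  have contK: "continuous_on {0..} (K n)" for n
    unfolding K_def using h(1)[of n]
    by (intro continuous_intros W'_cont SW_cont continuous_on_compose2[OF W'_cont]
        continuous_on_compose2[OF SW_cont, of _ "\<lambda>s. s + h n"]) auto
  have dP: "(P n has_real_derivative K n s) (at s)" if s: "0 < s" for n s
  proof -
    have "((\<lambda>x. integral {0..x} (K n)) has_real_derivative K n s) (at s within {0..s+1})"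
      by (rule integral_has_real_derivative) (use s in \<open>auto intro: continuous_on_subset[OF contK]\<close>)
    then show ?thesis using s at_within_Icc_at[of 0 s "s+1"] by (simp add: P_def[abs_def])
  qed
  \<comment> \<open>By symmetry of the inner product the terms containing s - h n form
    \<open>K n (s - h n)\<close>, so that, apart from the damping term, \<open>F n\<close> has the
    derivative of the increment of \<open>P n\<close>.\<close>
  have dF: "(F n has_real_derivative K n s - K n (s - h n) - \<alpha> * F n s) (at s)" if s: "t/2 \<le> s" for n s
  proof -
    have pos: "0 < s" "0 < s - h n" "0 < s + h n" using s t h[of n] by auto
    have "((\<lambda>s. W (s + h n) - W (s + - h n)) has_vector_derivative W' (s + h n) - W' (s + - h n)) (at s)"
      using pos by (intro has_vector_derivative_diff has_vector_derivative_shift_real W_deriv_at) auto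
    from weak_product_rule[OF pos(1) _ this]
    have d: "((\<lambda>s. inner (W' s) (W (s + h n) - W (s + - h n))) has_real_derivative
        inner (W' s) (W' (s + h n) - W' (s + - h n)) - \<alpha> * inner (W' s) (W (s + h n) - W (s + - h n))
        - inner (S (W s)) (S (W (s + h n) - W (s + - h n)))) (at s)"
      using pos W_in_V subspace_diff[OF V_subspace] by auto
    have Seq: "S (W (s + h n) - W (s + - h n)) = S (W (s + h n)) - S (W (s + - h n))"
      using pos by (intro S_diff W_in_V) auto
    show ?thesis
      using d[unfolded Seq] unfolding F_def[abs_def] by (simp add: K_def inner_diff_right inner_commute algebra_simps)
  qed
  show ?thesis
  proof (rule real_derivative_sequence[where a = "t/2" and b = "2*t"
        and f = "\<lambda>n s. (F n s - (P n s - P n (s - h n))) / h n"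
        and f' = "\<lambda>n s. - \<alpha> * (F n s / h n)" and g' = "\<lambda>s. - 2 * \<alpha> * (norm (W' s))\<^sup>2"])
    show "t/2 < t" "t < 2*t" using t by auto
    show "((\<lambda>s. (F n s - (P n s - P n (s - h n))) / h n) has_real_derivative - \<alpha> * (F n s / h n)) (at s)"
      if s: "s \<in> {t/2..2*t}" for n s
    proof -
      have pos: "0 < s" "0 < s - h n" using s t h[of n] by auto
      have dP': "((\<lambda>s. P n (s - h n)) has_real_derivative K n (s - h n)) (at s)"
        using DERIV_shift[of "P n" "K n (s - h n)" s "- h n"] dP[OF pos(2)] by simp
      have "((\<lambda>s. (F n s - (P n s - P n (s - h n))) / h n) has_real_derivative
         (K n s - K n (s - h n) - \<alpha> * F n s - (K n s - K n (s - h n))) / h n) (at s)"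
        by (rule DERIV_cdivide, rule DERIV_diff[OF dF DERIV_diff[OF dP[OF pos(1)] dP']]) (use s in auto)
      then show ?thesis by simp
    qed
    have uc: "uniformly_continuous_on {0..3*t} W'"
      by (rule compact_uniformly_continuous[OF continuous_on_subset[OF W'_cont]]) auto
    \<comment> \<open>By the mean value inequality W(s + h) - W(s - h) = 2 h W'(s) up to 2 h times
      the oscillation of \<open>W'\<close>, which is uniformly small on the compact interval; after
      division by h only 2 |W'|^2 remains.\<close>
    have unifF: "uniform_limit {t/2..2*t} (\<lambda>n s. F n s / h n) (\<lambda>s. 2 * (norm (W' s))\<^sup>2) sequentially"
    proof (rule uniform_limitI)
      fix e :: real assume e: "0 < e"
      have "bounded (W' ` {0..3*t})"
        by (intro compact_imp_bounded compact_continuous_image continuous_on_subset[OF W'_cont]) auto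
      then obtain B where B: "0 < B" "\<And>s. s \<in> {0..3*t} \<Longrightarrow> norm (W' s) \<le> B"
        unfolding bounded_pos by auto
      \<comment> \<open>With this choice the final bound B * (2 h e') / h equals e/2.\<close>
      define e' where "e' = e / (4 * B)"
      have "0 < e'" using e B by (simp add: e'_def)
      then obtain d where d: "0 < d" "\<And>s r. s \<in> {0..3*t} \<Longrightarrow> r \<in> {0..3*t} \<Longrightarrow> dist r s < d \<Longrightarrow> dist (W' r) (W' s) < e'"
        using uc unfolding uniformly_continuous_on_def by metis
      have "\<forall>\<^sub>F n in sequentially. h n < d" by (rule order_tendstoD(2)[OF h0 d(1)])
      then show "\<forall>\<^sub>F n in sequentially. \<forall>s\<in>{t/2..2*t}. dist (F n s / h n) (2 * (norm (W' s))\<^sup>2) < e"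
      proof (eventually_elim, intro ballI)
        fix n s assume hd: "h n < d" and s: "s \<in> {t/2..2*t}"
        have sub: "{s - h n..s + h n} \<subseteq> {0..3*t}" using s t h[of n] by auto
        have "norm (W (s + h n) - W (s - h n) - ((s + h n) - (s - h n)) *\<^sub>R W' s)
            \<le> norm ((s + h n) - (s - h n)) * e'"
        proof (rule vector_differentiable_bound_linearization[where S = "{s - h n..s + h n}"])
          show "(W has_vector_derivative W' r) (at r within {s - h n..s + h n})" if "r \<in> {s - h n..s + h n}" for r
            using W_deriv[of r] sub that by (intro has_vector_derivative_within_subset[OF W_deriv]) auto
          show "closed_segment (s - h n) (s + h n) \<subseteq> {s - h n..s + h n}"
            using h(1)[of n] by (simp add: closed_segment_eq_real_ivl)
          show "s \<in> {s - h n..s + h n}" using h(1)[of n] by simp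
          show "norm (W' r - W' s) \<le> e'" if "r \<in> {s - h n..s + h n}" for r
            using d(2)[of s r] that sub s t hd h(1)[of n] by (auto simp: dist_norm abs_le_iff intro!: less_imp_le)
        qed
        then have lin: "norm (W (s + h n) - W (s - h n) - (2 * h n) *\<^sub>R W' s) \<le> 2 * h n * e'"
          using h(1)[of n] by simp
        have "F n s / h n - 2 * (norm (W' s))\<^sup>2
            = inner (W' s) (W (s + h n) - W (s - h n) - (2 * h n) *\<^sub>R W' s) / h n"
          using h(1)[of n] by (simp add: F_def inner_diff_right inner_add_right power2_norm_eq_inner field_simps)
        then have "dist (F n s / h n) (2 * (norm (W' s))\<^sup>2)
            \<le> norm (W' s) * norm (W (s + h n) - W (s - h n) - (2 * h n) *\<^sub>R W' s) / h n"
          using h(1)[of n] by (simp add: dist_real_def divide_right_mono[OF Cauchy_Schwarz_ineq2])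
        also have "\<dots> \<le> B * (2 * h n * e') / h n"
          using h(1)[of n] B s t lin by (intro divide_right_mono mult_mono) auto
        also have "\<dots> = e / 2" using h(1)[of n] B by (simp add: e'_def)
        also have "\<dots> < e" using e by simp
        finally show "dist (F n s / h n) (2 * (norm (W' s))\<^sup>2) < e" .
      qed
    qed
    have "uniform_limit {t/2..2*t} (\<lambda>n s. - \<alpha> * (F n s / h n)) (\<lambda>s. - \<alpha> * (2 * (norm (W' s))\<^sup>2)) sequentially"
      by (rule bounded_linear.uniform_limit[OF bounded_linear_mult_right unifF])
    then show "uniform_limit {t/2..2*t} (\<lambda>n s. - \<alpha> * (F n s / h n)) (\<lambda>s. - 2 * \<alpha> * (norm (W' s))\<^sup>2) sequentially"
      by (simp add: mult.assoc mult.left_commute)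
    show "(\<lambda>n. (F n s - (P n s - P n (s - h n))) / h n) \<longlonglongrightarrow> (norm (W' s))\<^sup>2 + (norm (S (W s)))\<^sup>2"
      if s: "s \<in> {t/2..2*t}" for s
    proof -
      \<comment> \<open>\<open>P n\<close> changes with n, so its derivative at the fixed point
        \<open>s\<close> is no help; the mean value theorem evaluates \<open>K n\<close> at a point
        that moves towards \<open>s\<close>. The limit is 2 |W'|^2 - (|W'|^2 - |S W|^2), the
        quantity to be differentiated.\<close>
      have "\<exists>\<xi>. s - h n < \<xi> \<and> \<xi> < s \<and> P n s - P n (s - h n) = h n * K n \<xi>" for n
        using MVT2[of "s - h n" s "P n" "K n"] dP[of _ n] h[of n] s t by auto
      then obtain \<xi> where xi: "\<And>n. s - h n < \<xi> n" "\<And>n. \<xi> n < s"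
        and P: "\<And>n. P n s - P n (s - h n) = h n * K n (\<xi> n)" by metis
      have s0: "0 < s" using s t by simp
      have xis: "\<xi> \<longlonglongrightarrow> s"
      proof (rule real_tendsto_sandwich[where f = "\<lambda>n. s - h n" and h = "\<lambda>n. s"])
        have "(\<lambda>n. s - h n) \<longlonglongrightarrow> s - 0" by (intro tendsto_intros h0)
        then show "(\<lambda>n. s - h n) \<longlonglongrightarrow> s" by simp
      qed (use xi in \<open>auto intro!: always_eventually less_imp_le\<close>)
      have xihs: "(\<lambda>n. \<xi> n + h n) \<longlonglongrightarrow> s" using tendsto_add[OF xis h0] by simp
      have "(\<lambda>n. K n (\<xi> n)) \<longlonglongrightarrow> inner (W' s) (W' s) - inner (S (W s)) (S (W s))"
        unfolding K_def
        by (intro tendsto_intros isCont_tendsto_compose[OF W'_isCont[OF s0]]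
            isCont_tendsto_compose[OF SW_isCont[OF s0]] xis xihs)
      then have "(\<lambda>n. F n s / h n - K n (\<xi> n)) \<longlonglongrightarrow> 2 * (norm (W' s))\<^sup>2 - (inner (W' s) (W' s) - inner (S (W s)) (S (W s)))"
        by (intro tendsto_diff tendsto_uniform_limitI[OF unifF s])
      moreover have "F n s / h n - K n (\<xi> n) = (F n s - (P n s - P n (s - h n))) / h n" for n
        using h(1)[of n] by (simp add: P diff_divide_distrib)
      ultimately show ?thesis by (simp add: power2_norm_eq_inner)
    qed
  qed
qed

text \<open>\<open>E\<close> is twice the energy here. From 3 \<delta> \<le> \<alpha> and 6 \<alpha>
  \<delta> \<le> \<kappa> follows 18 \<delta>^2 \<le> \<kappa>, so \<alpha> \<delta> |W|^2 and
  \<delta>^2 |W|^2 are small multiples of |S W|^2. The correction in \<open>L\<close> is thus small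
  against \<open>E\<close>, yet it supplies the dissipation -\<delta> |S W|^2 that friction alone
  lacks.\<close>

lemma lyapunov_decay:
  assumes coercive: "\<And>v. v \<in> V \<Longrightarrow> \<kappa> * (norm v)\<^sup>2 \<le> (norm (S v))\<^sup>2"
    and alpha: "0 < \<alpha>" and delta: "0 < \<delta>" "\<delta> \<le> 1/3 * min \<alpha> (\<kappa> / (2 * \<alpha>))" and t: "0 \<le> t"
  shows "(norm (W' t))\<^sup>2 + (norm (S (W t)))\<^sup>2
      \<le> 3 * exp (- \<delta> * t) * ((norm (W' 0))\<^sup>2 + (norm (S (W 0)))\<^sup>2)"
proof -
  have d1: "3 * \<delta> \<le> \<alpha>" using delta(2) by linarith
  have d2: "6 * \<alpha> * \<delta> \<le> \<kappa>"
  proof -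
    have "3 * \<delta> \<le> \<kappa> / (2 * \<alpha>)" using delta(2) by linarith
    then show ?thesis using alpha by (simp add: field_simps)
  qed
  have d3: "18 * \<delta>\<^sup>2 \<le> 6 * \<alpha> * \<delta>"
    using mult_right_mono[OF d1, of "6 * \<delta>"] delta(1) by (simp add: power2_eq_square)
  define E where "E s = (norm (W' s))\<^sup>2 + (norm (S (W s)))\<^sup>2" for s
  define L where "L s = E s / 2 + \<delta> * (inner (W' s) (W s) + \<alpha> / 2 * (norm (W s))\<^sup>2)" for s
  have cross: "\<bar>\<delta> * inner (W' s) (W s)\<bar> \<le> (norm (W' s))\<^sup>2 / 8 + (norm (S (W s)))\<^sup>2 / 9"
    and low: "\<delta> * (\<alpha> / 2 * (norm (W s))\<^sup>2) \<le> (norm (S (W s)))\<^sup>2 / 12" if s: "0 \<le> s" for s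
  proof -
    have c: "\<kappa> * (norm (W s))\<^sup>2 \<le> (norm (S (W s)))\<^sup>2" using coercive W_in_V s by blast
    have c2: "6 * \<alpha> * \<delta> * (norm (W s))\<^sup>2 \<le> \<kappa> * (norm (W s))\<^sup>2" using d2 by (intro mult_right_mono) auto
    have c3: "18 * \<delta>\<^sup>2 * (norm (W s))\<^sup>2 \<le> 6 * \<alpha> * \<delta> * (norm (W s))\<^sup>2" using d3 by (intro mult_right_mono) auto
    show "\<delta> * (\<alpha> / 2 * (norm (W s))\<^sup>2) \<le> (norm (S (W s)))\<^sup>2 / 12" using c c2 by (simp add: algebra_simps)
    \<comment> \<open>The weight 4 \<delta> gives |\<delta> <W', W>| \<le> |W'|^2/8 + 2 \<delta>^2
      |W|^2, and 18 \<delta>^2 |W|^2 \<le> |S W|^2 turns the last term into |S W|^2/9.\<close>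
    have "0 \<le> (norm (W' s + (4 * \<delta>) *\<^sub>R W s))\<^sup>2" "0 \<le> (norm (W' s - (4 * \<delta>) *\<^sub>R W s))\<^sup>2" by simp_all
    then have "\<bar>8 * (\<delta> * inner (W' s) (W s))\<bar> \<le> (norm (W' s))\<^sup>2 + 16 * (\<delta>\<^sup>2 * (norm (W s))\<^sup>2)"
      unfolding power2_norm_eq_inner
      by (simp add: inner_add inner_diff inner_commute algebra_simps power2_eq_square abs_le_iff)
    then show "\<bar>\<delta> * inner (W' s) (W s)\<bar> \<le> (norm (W' s))\<^sup>2 / 8 + (norm (S (W s)))\<^sup>2 / 9"
      using c c2 c3 by (simp add: abs_le_iff)
  qed
  have L_upper: "L s \<le> 7/10 * E s" and L_lower: "3/8 * E s \<le> L s" if s: "0 \<le> s" for s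
  proof -
    have pos: "0 \<le> \<delta> * (\<alpha> / 2 * (norm (W s))\<^sup>2)" using delta alpha by simp
    have Leq: "L s = E s / 2 + \<delta> * inner (W' s) (W s) + \<delta> * (\<alpha> / 2 * (norm (W s))\<^sup>2)"
      by (simp add: L_def distrib_left)
    \<comment> \<open>Here p = |W'|^2 and q = |S W|^2. From above the coefficients are 1/2 + 1/8 =
      5/8 and 1/2 + 1/9 + 1/12 = 25/36, both at most 7/10; from below they are 1/2 - 1/8 = 3/8 and
      1/2 - 1/9 = 7/18.\<close>
    have num: "l \<le> 7/10 * (p + q) \<and> 3/8 * (p + q) \<le> l"
      if "l = (p + q) / 2 + x + y" "0 \<le> y" "\<bar>x\<bar> \<le> p / 8 + q / 9" "y \<le> q / 12" "0 \<le> p" "0 \<le> q"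
      for l p q x y :: real using that by (simp add: add_divide_distrib abs_le_iff)
    have "L s \<le> 7/10 * E s \<and> 3/8 * E s \<le> L s"
      unfolding E_def by (rule num[OF Leq[unfolded E_def] pos cross[OF s] low[OF s]]) simp_all
    then show "L s \<le> 7/10 * E s" "3/8 * E s \<le> L s" by auto
  qed
  define L' where "L' s = - \<alpha> * (norm (W' s))\<^sup>2 + \<delta> * ((norm (W' s))\<^sup>2 - (norm (S (W s)))\<^sup>2)" for s
  have dL: "(L has_real_derivative L' s) (at s)" if s: "0 < s" for s
  proof -
    have "((\<lambda>s. inner (W s) (W s)) has_real_derivative 2 * inner (W' s) (W s)) (at s)"
      unfolding has_real_derivative_iff_has_vector_derivative
      using bounded_bilinear.has_vector_derivative[OF bounded_bilinear_inner W_deriv_at[OF s] W_deriv_at[OF s]]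
      by (simp add: inner_commute)
    then have d1: "((\<lambda>s. (norm (W s))\<^sup>2) has_real_derivative 2 * inner (W' s) (W s)) (at s)"
      by (simp add: power2_norm_eq_inner)
    have d2: "((\<lambda>s. inner (W' s) (W s)) has_real_derivative
      inner (W' s) (W' s) - \<alpha> * inner (W' s) (W s) - inner (S (W s)) (S (W s))) (at s)"
      using weak_product_rule[OF s _ W_deriv_at[OF s]] W_in_V s by auto
    \<comment> \<open>The derivative of \<alpha>/2 |W|^2 is \<alpha> <W', W> and cancels the
      friction term in the derivative of <W', W>; this is why \<open>L\<close> contains it.\<close>
    have "(L has_real_derivative - 2 * \<alpha> * (norm (W' s))\<^sup>2 / 2 +
        \<delta> * ((inner (W' s) (W' s) - \<alpha> * inner (W' s) (W s) - inner (S (W s)) (S (W s)))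
          + \<alpha> / 2 * (2 * inner (W' s) (W s)))) (at s)"
      unfolding L_def[abs_def] E_def[abs_def]
      by (intro DERIV_add DERIV_cdivide DERIV_cmult energy_derivative[OF s] d1 d2)
    then show ?thesis by (simp add: L'_def power2_norm_eq_inner)
  qed
  have L'_le: "L' s + \<delta> * L s \<le> 0" if s: "0 \<le> s" for s
  proof -
    have "\<delta> * L s \<le> \<delta> * (E s / 2 + ((norm (W' s))\<^sup>2 / 8 + (norm (S (W s)))\<^sup>2 / 9) + (norm (S (W s)))\<^sup>2 / 12)"
    proof (rule mult_left_mono)
      show "L s \<le> E s / 2 + ((norm (W' s))\<^sup>2 / 8 + (norm (S (W s)))\<^sup>2 / 9) + (norm (S (W s)))\<^sup>2 / 12"
        unfolding L_def distrib_left using abs_le_D1[OF cross[OF s]] low[OF s] by linarith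
    qed (use delta(1) in simp)
    also have "\<dots> = \<delta> * (norm (W' s))\<^sup>2 * (5/8) + \<delta> * (norm (S (W s)))\<^sup>2 * (25/36)"
      by (simp add: E_def add_divide_distrib algebra_simps)
    finally have 1: "\<delta> * L s \<le> \<delta> * (norm (W' s))\<^sup>2 * (5/8) + \<delta> * (norm (S (W s)))\<^sup>2 * (25/36)" .
    \<comment> \<open>In L' + \<delta> L the coefficient of |W'|^2 is at most (-3 + 1 + 5/8)
      \<delta> and that of |S W|^2 at most (-1 + 25/36) \<delta>; both are negative.\<close>
    have 2: "3 * \<delta> * (norm (W' s))\<^sup>2 \<le> \<alpha> * (norm (W' s))\<^sup>2" using d1 by (intro mult_right_mono) auto
    have 3: "0 \<le> \<delta> * (norm (W' s))\<^sup>2" "0 \<le> \<delta> * (norm (S (W s)))\<^sup>2" using delta(1) by auto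
    show ?thesis using 1 2 3 unfolding L'_def by (simp add: algebra_simps)
  qed
  have contL: "continuous_on {0..} L"
    unfolding L_def[abs_def] E_def[abs_def] by (intro continuous_intros W'_cont SW_cont W_cont) auto
  have "exp (\<delta> * t) * L t \<le> exp (\<delta> * 0) * L 0"
  proof (rule DERIV_nonpos_imp_decreasing_open[OF t])
    show "\<exists>y. ((\<lambda>s. exp (\<delta> * s) * L s) has_real_derivative y) (at s) \<and> y \<le> 0" if "0 < s" "s < t" for s
    proof (intro exI conjI)
      show "((\<lambda>s. exp (\<delta> * s) * L s) has_real_derivative exp (\<delta> * s) * (L' s + \<delta> * L s)) (at s)"
        by (rule derivative_eq_intros dL[OF that(1)] refl)+ (simp add: algebra_simps)
      show "exp (\<delta> * s) * (L' s + \<delta> * L s) \<le> 0"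
        using L'_le[of s] that by (intro mult_nonneg_nonpos) auto
    qed
    show "continuous_on {0..t} (\<lambda>s. exp (\<delta> * s) * L s)"
      by (intro continuous_intros continuous_on_subset[OF contL]) auto
  qed
  then have "L t \<le> exp (- \<delta> * t) * L 0" by (simp add: exp_minus field_simps)
  also have "\<dots> \<le> exp (- \<delta> * t) * (7/10 * E 0)" by (intro mult_left_mono L_upper) auto
  finally have "3/8 * E t \<le> exp (- \<delta> * t) * (7/10 * E 0)" using L_lower[OF t] by linarith
  moreover have "exp (- \<delta> * t) * (7/10 * E 0) = 7/10 * (exp (- \<delta> * t) * E 0)" by simp
  moreover have "0 \<le> exp (- \<delta> * t) * E 0" by (simp add: E_def)
  ultimately have "E t \<le> 3 * (exp (- \<delta> * t) * E 0)" by linarith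
  then show ?thesis by (simp add: E_def mult.assoc)
qed

end

section \<open>Time derivatives and reduction to the homogeneous equation\<close>

lemma time_deriv_0 [simp]: "time_deriv 0 v = v"
  and time_deriv_Suc: "time_deriv (Suc k) v t = vector_derivative (time_deriv k v) (at t within {0..})"
  by (simp_all add: time_deriv_def)

lemma Ck_time_has_vector_derivative:
  "Ck_time j u \<Longrightarrow> k < j \<Longrightarrow> 0 \<le> t \<Longrightarrow>
    (time_deriv k u has_vector_derivative time_deriv (Suc k) u t) (at t within {0..})"
  by (simp add: Ck_time_def)

lemma Ck_time_has_vector_derivative_at:
  "Ck_time j u \<Longrightarrow> k < j \<Longrightarrow> 0 < t \<Longrightarrow>
    (time_deriv k u has_vector_derivative time_deriv (Suc k) u t) (at t)"
  using Ck_time_has_vector_derivative[of j u k t] at_within_interior[of t "{0..}"] by simp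

lemma time_deriv_diff_const:
  fixes u :: "real \<Rightarrow> 'h::real_normed_vector"
  assumes u: "Ck_time j u" and k: "k \<le> j" and t: "0 \<le> t"
  shows "time_deriv k (\<lambda>s. u s - c) t = time_deriv k u t - (if k = 0 then c else 0)"
  using k t
proof (induction k arbitrary: t)
  case (Suc k)
  let ?w = "\<lambda>s. u s - c"
  have "((\<lambda>s. time_deriv k u s - (if k = 0 then c else 0)) has_vector_derivative time_deriv (Suc k) u t - 0) (at t within {0..})"
    using Suc.prems by (intro has_vector_derivative_diff Ck_time_has_vector_derivative[OF u] has_vector_derivative_const) auto
  then have d: "((\<lambda>s. time_deriv k u s - (if k = 0 then c else 0)) has_vector_derivative time_deriv (Suc k) u t) (at t within {0..})"
    by simp
  have "(time_deriv k ?w has_vector_derivative time_deriv (Suc k) u t) (at t within {0..})"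
    by (rule has_vector_derivative_transform[OF _ _ d]) (use Suc in auto)
  \<comment> \<open>Needed to read off the value of \<open>vector_derivative\<close>: one-sided
    derivatives are unique, also at t = 0, because the filter contains the right-hand neighbourhoods
    of \<open>t\<close>.\<close>
  moreover have "at t within {0..} \<noteq> bot"
  proof
    assume "at t within {0..} = bot"
    moreover have "at_right t \<le> at t within {0..}" using Suc.prems by (intro at_le) auto
    ultimately show False using trivial_limit_at_right_real[of t] by (simp add: bot_unique)
  qed
  ultimately show ?case by (simp add: time_deriv_Suc[of k ?w] vector_derivative_within)
qed simp

text \<open>The equation is given for \<open>u\<close> alone. What has to be shown is that
  \<open>time_deriv (j - 1) w\<close> solves the homogeneous weak equation against \<open>D\<close>;
  then the test space is enlarged to \<open>V\<close> and the Lyapunov estimate applies. Viewing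
  \<open>T\<close> as a second instance of the locale provides its symmetry.\<close>

lemma (in square_root_operator) damped_wave_energy_decay:
  assumes coercive: "\<And>v. v \<in> V \<Longrightarrow> \<kappa> * (norm v)\<^sup>2 \<le> (norm (S v))\<^sup>2"
    and alpha: "0 < \<alpha>" and delta: "0 < \<delta>" "\<delta> \<le> 1/3 * min \<alpha> (\<kappa> / (2 * \<alpha>))"
    and sol: "damped_wave_solution D T V S \<alpha> f u\<^sub>0 u\<^sub>1 u"
    and steady: "v \<in> D" "T v = f"
    and j: "1 \<le> j"
    and reg: "Ck_time j u" "\<And>t. 0 \<le> t \<Longrightarrow> time_deriv (j - 1) u t \<in> V"
      "continuous_on {0..} (\<lambda>t. S (time_deriv (j - 1) u t))"
    and t: "0 \<le> t"
  shows "energy S j (\<lambda>t. u t - v) t \<le> 3 * exp (- \<delta> * t) * energy S j (\<lambda>t. u t - v) 0"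
proof -
  interpret T: self_adjoint_operator H D T
    by unfold_locales (rule H_subspace H_complete T_self_adjoint)+
  define w where "w = (\<lambda>t. u t - v)"
  \<comment> \<open>Subtracting a constant is felt only by the derivative of order 0, and j - 1 is
    that order exactly if j = 1.\<close>
  define c where "c = (if j = 1 then v else 0)"
  have cV: "c \<in> V" using steady D_in_V subspace_0[OF V_subspace] by (simp add: c_def)
  have W: "time_deriv (j - 1) w t = time_deriv (j - 1) u t - c" if "0 \<le> t" for t
    using time_deriv_diff_const[OF reg(1) _ that, of "j - 1" v] j by (auto simp: w_def c_def)
  have W': "time_deriv j w t = time_deriv j u t" if "0 \<le> t" for t
    using time_deriv_diff_const[OF reg(1) _ that, of j v] j by (simp add: w_def)
  have weak_u: "((\<lambda>s. inner (time_deriv k u s) \<phi>) has_real_derivative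
      (if k = 1 then inner f \<phi> else 0) - \<alpha> * inner (time_deriv k u t) \<phi> - inner (time_deriv (k - 1) u t) (T \<phi>)) (at t)"
    if phi: "\<phi> \<in> D" and k: "1 \<le> k" "k \<le> j" and t: "0 < t" for \<phi> k t
    using k t
  proof (induction k arbitrary: t rule: dec_induct)
    case base
    then show ?case using sol phi by (simp add: damped_wave_solution_def)
  next
    case (step k)
    let ?r = "\<lambda>s. (if k = 1 then inner f \<phi> else 0) - \<alpha> * inner (time_deriv k u s) \<phi> - inner (time_deriv (k - 1) u s) (T \<phi>)"
    have d: "((\<lambda>s. inner (time_deriv i u s) \<psi>) has_real_derivative inner (time_deriv (Suc i) u s) \<psi>) (at s)"
      if "i < j" "0 < s" for i s \<psi>
      unfolding has_real_derivative_iff_has_vector_derivative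
      by (rule bounded_linear.has_vector_derivative[OF bounded_linear_inner_left
            Ck_time_has_vector_derivative_at[OF reg(1) that]])
    \<comment> \<open>The derivative of <u^(k), \<phi>> is known twice, from the weak equation and
      from smoothness of \<open>u\<close> in time. Uniqueness yields a pointwise identity for
      positive times, whose other side can be differentiated term by term.\<close>
    have eq: "?r s = inner (time_deriv (Suc k) u s) \<phi>" if "0 < s" for s
      using DERIV_unique[OF step.IH[OF _ that] d[of k s \<phi>]] step.prems that by simp
    have "(?r has_real_derivative 0 - \<alpha> * inner (time_deriv (Suc k) u t) \<phi> - inner (time_deriv (Suc (k - 1)) u t) (T \<phi>)) (at t)"
      using step.prems step.hyps by (intro DERIV_diff DERIV_const DERIV_cmult d) auto
    then have "((\<lambda>s. inner (time_deriv (Suc k) u s) \<phi>) has_real_derivative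
        0 - \<alpha> * inner (time_deriv (Suc k) u t) \<phi> - inner (time_deriv (Suc (k - 1)) u t) (T \<phi>)) (at t)"
      by (rule has_field_derivative_transform_within_open[where S = "{0<..}"]) (use step.prems eq in auto)
    then show ?case using step.hyps by simp
  qed
  have contW': "continuous_on {0..} (time_deriv j w)"
    by (rule continuous_on_eq[of _ "time_deriv j u"]) (use reg(1) W' in \<open>auto simp: Ck_time_def\<close>)
  have contSW: "continuous_on {0..} (\<lambda>t. S (time_deriv (j - 1) w t))"
  proof -
    have "continuous_on {0..} (\<lambda>t. S (time_deriv (j - 1) u t) - S c)"
      by (intro continuous_intros reg(3))
    then show ?thesis by (rule continuous_on_eq) (simp only: W S_diff[OF reg(2) cV] atLeast_iff)
  qed
  have WV: "time_deriv (j - 1) w t \<in> V" if "0 \<le> t" for t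
    unfolding W[OF that] by (intro subspace_diff[OF V_subspace] reg(2) that cV)
  have weak_w: "((\<lambda>s. inner (time_deriv j w s) \<phi>) has_real_derivative
      - \<alpha> * inner (time_deriv j w t) \<phi> - inner (time_deriv (j - 1) w t) (T \<phi>)) (at t)"
    if phi: "\<phi> \<in> D" and t: "0 < t" for \<phi> t
  proof -
    \<comment> \<open>For j = 1 this reads <f, \<phi>> = <T v, \<phi>> = <v, T \<phi>>, so the shift
      absorbs the load; for j > 1 both sides are 0.\<close>
    have "(if j = 1 then inner f \<phi> else 0) = inner c (T \<phi>)"
      using T.symmetric[OF steady(1) phi] steady(2) by (simp add: c_def)
    then have "(if j = 1 then inner f \<phi> else 0) - \<alpha> * inner (time_deriv j u t) \<phi> - inner (time_deriv (j - 1) u t) (T \<phi>)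
        = - \<alpha> * inner (time_deriv j w t) \<phi> - inner (time_deriv (j - 1) w t) (T \<phi>)"
      unfolding W[OF less_imp_le[OF t]] W'[OF less_imp_le[OF t]] inner_diff_left by linarith
    with weak_u[OF phi j order_refl t]
    have "((\<lambda>s. inner (time_deriv j u s) \<phi>) has_real_derivative
      - \<alpha> * inner (time_deriv j w t) \<phi> - inner (time_deriv (j - 1) w t) (T \<phi>)) (at t)"
      by (simp only:)
    then show ?thesis
      by (rule has_field_derivative_transform_within_open[where S = "{0<..}"]) (use t W' in auto)
  qed
  interpret homogeneous_damped_wave H V S \<alpha> "time_deriv (j - 1) w" "time_deriv j w"
  proof unfold_locales
    show "(time_deriv (j - 1) w has_vector_derivative time_deriv j w t) (at t within {0..})" if "0 \<le> t" for t
    proof (rule has_vector_derivative_transform[where f = "\<lambda>s. time_deriv (j - 1) u s - c"])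
      have "((\<lambda>s. time_deriv (j - 1) u s - c) has_vector_derivative time_deriv (Suc (j - 1)) u t - 0) (at t within {0..})"
        using j that by (intro has_vector_derivative_diff Ck_time_has_vector_derivative[OF reg(1)] has_vector_derivative_const) auto
      then show "((\<lambda>s. time_deriv (j - 1) u s - c) has_vector_derivative time_deriv j w t) (at t within {0..})"
        using j that by (simp add: W')
    qed (use that W in auto)
  qed (use WV contW' contSW extend_weak_equation[OF WV contW' contSW weak_w] in auto)
  from lyapunov_decay[OF coercive alpha delta t]
  show ?thesis by (simp add: energy_def w_def)
qed

section \<open>The space \<open>L\<^sup>2\<close>\<close>

lemma L2_class_fun [simp]: "L2_class (L2_fun v) = v"
  using Quotient3_abs_rep[OF Quotient3_L2] .

lemma L2_rel_fun: "L2_rel (L2_fun v) (L2_fun v)"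
  using Quotient3_rep_reflp[OF Quotient3_L2] .

lemma square_integrable_L2_fun: "square_integrable (L2_fun v)"
  using L2_rel_fun[of v] by (simp add: L2_rel_def)

lemma L2_fun_measurable [measurable]: "L2_fun v \<in> borel_measurable borel"
  using square_integrable_L2_fun[of v] by (simp add: square_integrable_def)

lemma L2_class_eqI:
  "square_integrable f \<Longrightarrow> square_integrable g \<Longrightarrow> AE x in lborel. f x = g x \<Longrightarrow> L2_class f = L2_class g"
  using Quotient3_rel[OF Quotient3_L2, of f g] by (auto simp: L2_rel_def)

lemma L2_eqI: "AE x in lborel. L2_fun v x = L2_fun w x \<Longrightarrow> v = w"
  using L2_class_eqI[OF square_integrable_L2_fun square_integrable_L2_fun, of v w] by simp

lemma L2_fun_class:
  assumes "square_integrable f"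
  shows "AE x in lborel. L2_fun (L2_class f) x = f x"
proof -
  have "L2_rel f f" using assms by (simp add: L2_rel_def)
  then have "L2_rel (L2_fun (L2_class f)) f"
    using rep_abs_rsp_left[OF Quotient3_L2] by metis
  then show ?thesis by (simp add: L2_rel_def)
qed

lemma L2_fun_plus: "AE x in lborel. L2_fun (v + w) x = L2_fun v x + L2_fun w x"
proof -
  have "v + w = L2_class (\<lambda>x. L2_fun v x + L2_fun w x)"
    using plus_L2.abs_eq[OF L2_rel_fun L2_rel_fun, of v w] by simp
  then show ?thesis
    using L2_fun_class[OF square_integrable_add[OF square_integrable_L2_fun square_integrable_L2_fun], of v w]
    by simp
qed

lemma L2_fun_scaleR: "AE x in lborel. L2_fun (c *\<^sub>R v) x = c * L2_fun v x"
proof -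
  have "c *\<^sub>R v = L2_class (\<lambda>x. c * L2_fun v x)"
    using scaleR_L2.abs_eq[OF L2_rel_fun, of c v] by simp
  then show ?thesis
    using L2_fun_class[OF square_integrable_scale[OF square_integrable_L2_fun], of c v] by simp
qed

lemma L2_fun_diff: "AE x in lborel. L2_fun (v - w) x = L2_fun v x - L2_fun w x"
  using L2_fun_plus[of v "(-1) *\<^sub>R w"] L2_fun_scaleR[of "-1" w] by eventually_elim simp

lemma L2_fun_zero: "AE x in lborel. L2_fun 0 x = 0"
  using L2_fun_scaleR[of 0 0] by simp

lemma inner_L2_eq: "inner v w = (\<integral>x. L2_fun v x * L2_fun w x \<partial>lborel)"
  using inner_L2.abs_eq[OF L2_rel_fun L2_rel_fun, of v w] by simp

lemma inner_L2_class:
  assumes "square_integrable f"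
  shows "inner v (L2_class f) = (\<integral>x. L2_fun v x * f x \<partial>lborel)"
proof -
  have "inner (L2_class (L2_fun v)) (L2_class f) = (\<integral>x. L2_fun v x * f x \<partial>lborel)"
    using assms by (intro inner_L2.abs_eq L2_rel_fun) (simp add: L2_rel_def)
  then show ?thesis by simp
qed

lemma norm_L2_power2: "(norm v)\<^sup>2 = (\<integral>x. (L2_fun v x)\<^sup>2 \<partial>lborel)"
  unfolding power2_norm_eq_inner inner_L2_eq by (simp add: power2_eq_square)

lemma nn_integral_L2: "(\<integral>\<^sup>+x. ennreal ((L2_fun v x)\<^sup>2) \<partial>lborel) = ennreal ((norm v)\<^sup>2)"
  unfolding norm_L2_power2 using square_integrable_L2_fun[of v]
  by (intro nn_integral_eq_integral) (auto simp: square_integrable_def)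

lemma L2_class_diff:
  assumes "square_integrable f" "square_integrable g"
  shows "L2_class f - L2_class g = L2_class (\<lambda>x. f x - g x)"
proof (rule L2_eqI)
  have "square_integrable (\<lambda>x. f x - g x)"
    using square_integrable_add[OF assms(1) square_integrable_scale[OF assms(2), of "-1"]] by simp
  from L2_fun_class[OF this] L2_fun_class[OF assms(1)] L2_fun_class[OF assms(2)]
    L2_fun_diff[of "L2_class f" "L2_class g"]
  show "AE x in lborel. L2_fun (L2_class f - L2_class g) x = L2_fun (L2_class (\<lambda>x. f x - g x)) x"
    by eventually_elim simp
qed

lemma nn_integral_L2_diff:
  "(\<integral>\<^sup>+x. ennreal ((L2_fun v x - L2_fun w x)\<^sup>2) \<partial>lborel) = ennreal ((norm (v - w))\<^sup>2)"
proof -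
  have "(\<integral>\<^sup>+x. ennreal ((L2_fun v x - L2_fun w x)\<^sup>2) \<partial>lborel) = (\<integral>\<^sup>+x. ennreal ((L2_fun (v - w) x)\<^sup>2) \<partial>lborel)"
    using L2_fun_diff[of v w] by (intro nn_integral_cong_AE) (auto elim!: eventually_mono)
  then show ?thesis by (simp add: nn_integral_L2)
qed

text \<open>The weights 2^k still leave the integrals of 2^k d_k^2 summable, since these are at most
  2^k 4^(-k). Hence the weighted sum of squares is finite almost everywhere, and with the weights it
  dominates the sum of the |d_k|.\<close>

lemma L2_Cauchy_pointwise_limit:
  fixes Y :: "nat \<Rightarrow> ('a::euclidean_space) L2"
  assumes "\<And>k. norm (Y (Suc k) - Y k) \<le> (1/2) ^ k"
  shows "AE x in lborel. convergent (\<lambda>k. L2_fun (Y k) x)"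
proof -
  define d where "d k x = L2_fun (Y (Suc k)) x - L2_fun (Y k) x" for k x
  have [measurable]: "d k \<in> borel_measurable borel" for k
    unfolding d_def[abs_def] by measurable
  have "(\<integral>\<^sup>+x. (\<Sum>k. ennreal (2 ^ k * (d k x)\<^sup>2)) \<partial>lborel) = (\<Sum>k. \<integral>\<^sup>+x. ennreal (2 ^ k * (d k x)\<^sup>2) \<partial>lborel)"
    by (rule nn_integral_suminf) simp
  also have "\<dots> \<le> (\<Sum>k. ennreal ((1/2) ^ k))"
  proof (intro suminf_le)
    fix k
    have "(\<integral>\<^sup>+x. ennreal (2 ^ k * (d k x)\<^sup>2) \<partial>lborel) = ennreal (2 ^ k) * ennreal ((norm (Y (Suc k) - Y k))\<^sup>2)"
      unfolding nn_integral_L2_diff[symmetric] d_def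
      by (subst nn_integral_cmult[symmetric]) (auto simp: ennreal_mult'[symmetric])
    also have "\<dots> = ennreal (2 ^ k * (norm (Y (Suc k) - Y k))\<^sup>2)" by (simp add: ennreal_mult')
    also have "2 ^ k * (norm (Y (Suc k) - Y k))\<^sup>2 \<le> 2 ^ k * ((1/2) ^ k)\<^sup>2"
      by (intro mult_left_mono power_mono assms) auto
    also have "\<dots> = (1/2::real) ^ k" by (simp add: power2_eq_square power_divide field_simps)
    finally show "(\<integral>\<^sup>+x. ennreal (2 ^ k * (d k x)\<^sup>2) \<partial>lborel) \<le> ennreal ((1/2) ^ k)"
      by (simp add: ennreal_leI)
  qed auto
  also have "\<dots> = ennreal (\<Sum>k. (1/2) ^ k)"
    by (intro suminf_ennreal2) (auto simp: summable_geometric)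
  also have "\<dots> < \<infinity>" by simp
  finally have "AE x in lborel. (\<Sum>k. ennreal (2 ^ k * (d k x)\<^sup>2)) \<noteq> \<infinity>"
    by (intro nn_integral_PInf_AE) auto
  then show ?thesis
  proof eventually_elim
    fix x assume "(\<Sum>k. ennreal (2 ^ k * (d k x)\<^sup>2)) \<noteq> \<infinity>"
    then have s: "summable (\<lambda>k. 2 ^ k * (d k x)\<^sup>2)"
      by (intro summable_suminf_not_top) auto
    have "summable (\<lambda>k. d k x)"
    proof (rule summable_comparison_test')
      show "summable (\<lambda>k. 2 ^ k * (d k x)\<^sup>2 + (1/2) ^ k)"
        by (intro summable_add s summable_geometric) auto
      show "norm (d k x) \<le> 2 ^ k * (d k x)\<^sup>2 + (1/2) ^ k" for k
      proof -
        \<comment> \<open>Expanding the square gives 2 |d_k| \<le> 2^k d_k^2 + 2^(-k), the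
          comparison with two summable series.\<close>
        have "0 \<le> (1/2) ^ k * (2 ^ k * \<bar>d k x\<bar> - 1)\<^sup>2" by simp
        also have "\<dots> = ((1/2) ^ k * 2 ^ k) * (2 ^ k * \<bar>d k x\<bar>\<^sup>2) - 2 * (((1/2) ^ k * 2 ^ k) * \<bar>d k x\<bar>) + (1/2) ^ k"
          by (simp only: power2_eq_square algebra_simps mult_1_right)
        also have "(1/2) ^ k * 2 ^ k = (1::real)" by (simp flip: power_mult_distrib)
        finally show ?thesis by simp
      qed
    qed
    then have "convergent (\<lambda>n. \<Sum>k<n. d k x)" by (simp add: summable_iff_convergent)
    moreover have "(\<Sum>k<n. d k x) = L2_fun (Y n) x - L2_fun (Y 0) x" for n
      unfolding d_def by (rule sum_lessThan_telescope)
    ultimately have "convergent (\<lambda>n. L2_fun (Y n) x - L2_fun (Y 0) x)" by simp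
    from convergent_add[OF this convergent_const[of "L2_fun (Y 0) x"]]
    show "convergent (\<lambda>k. L2_fun (Y k) x)" by simp
  qed
qed

text \<open>Riesz-Fischer: a rapidly converging subsequence has a pointwise limit almost everywhere,
  and Fatou's lemma turns it into a limit in norm.\<close>

lemma complete_L2: "complete (UNIV :: ('a::euclidean_space) L2 set)"
  unfolding complete_def
proof (intro allI impI)
  fix X :: "nat \<Rightarrow> 'a L2" assume "(\<forall>n. X n \<in> UNIV) \<and> Cauchy X"
  then have X: "Cauchy X" by simp
  have "\<exists>N. \<forall>m\<ge>N. \<forall>n\<ge>N. norm (X m - X n) < (1/2) ^ k" for k
    using CauchyD[OF X, of "(1/2)^k"] by auto
  then obtain N where N: "\<And>k m n. m \<ge> N k \<Longrightarrow> n \<ge> N k \<Longrightarrow> norm (X m - X n) < (1/2) ^ k" by metis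
  \<comment> \<open>A sum rather than \<open>N k\<close> itself: it dominates every
    \<open>N i\<close> with i \<le> k, so consecutive members of \<open>Y\<close> both lie beyond
    \<open>N k\<close>.\<close>
  define r where "r k = (\<Sum>i\<le>k. N i)" for k
  have r: "N k \<le> r m" if "k \<le> m" for k m
    unfolding r_def by (rule member_le_sum) (use that in auto)
  define Y where "Y k = X (r k)" for k
  define F where "F x = lim (\<lambda>k. L2_fun (Y k) x)" for x
  have [measurable]: "F \<in> borel_measurable borel"
    unfolding F_def[abs_def] by (intro borel_measurable_lim_metric) simp
  have conv: "AE x in lborel. (\<lambda>k. L2_fun (Y k) x) \<longlonglongrightarrow> F x"
  proof -
    have "AE x in lborel. convergent (\<lambda>k. L2_fun (Y k) x)"
      by (rule L2_Cauchy_pointwise_limit) (auto simp: Y_def intro!: less_imp_le N r)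
    then show ?thesis by (simp add: F_def convergent_LIMSEQ_iff)
  qed
  \<comment> \<open>Only the second function runs along the subsequence; \<open>X n\<close> is
    arbitrary beyond \<open>N k\<close>, so the bound yields convergence of the whole
    sequence.\<close>
  have fatou: "(\<integral>\<^sup>+x. ennreal ((L2_fun (X n) x - F x)\<^sup>2) \<partial>lborel) \<le> ennreal (((1/2) ^ k)\<^sup>2)" if n: "n \<ge> N k" for n k
  proof -
    have "(\<integral>\<^sup>+x. ennreal ((L2_fun (X n) x - F x)\<^sup>2) \<partial>lborel)
        = (\<integral>\<^sup>+x. liminf (\<lambda>m. ennreal ((L2_fun (X n) x - L2_fun (Y m) x)\<^sup>2)) \<partial>lborel)"
    proof (intro nn_integral_cong_AE)
      show "AE x in lborel. ennreal ((L2_fun (X n) x - F x)\<^sup>2)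
          = liminf (\<lambda>m. ennreal ((L2_fun (X n) x - L2_fun (Y m) x)\<^sup>2))"
        using conv
      proof eventually_elim
        fix x assume "(\<lambda>k. L2_fun (Y k) x) \<longlonglongrightarrow> F x"
        then have "(\<lambda>m. ennreal ((L2_fun (X n) x - L2_fun (Y m) x)\<^sup>2)) \<longlonglongrightarrow> ennreal ((L2_fun (X n) x - F x)\<^sup>2)"
          by (intro tendsto_intros)
        from lim_imp_Liminf[OF _ this]
        show "ennreal ((L2_fun (X n) x - F x)\<^sup>2) = liminf (\<lambda>m. ennreal ((L2_fun (X n) x - L2_fun (Y m) x)\<^sup>2))"
          by simp
      qed
    qed
    also have "\<dots> \<le> liminf (\<lambda>m. \<integral>\<^sup>+x. ennreal ((L2_fun (X n) x - L2_fun (Y m) x)\<^sup>2) \<partial>lborel)"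
      by (intro nn_integral_liminf) simp
    also have "\<dots> \<le> ennreal (((1/2) ^ k)\<^sup>2)"
      unfolding nn_integral_L2_diff
    proof (rule Liminf_le)
      show "\<forall>\<^sub>F m in sequentially. ennreal ((norm (X n - Y m))\<^sup>2) \<le> ennreal (((1/2) ^ k)\<^sup>2)"
        unfolding eventually_sequentially
        using N[OF n] r
        by (intro exI[of _ k] allI impI ennreal_leI power_mono norm_ge_zero) (auto simp: Y_def intro!: less_imp_le)
    qed simp
    finally show ?thesis .
  qed
  \<comment> \<open>Square integrability of \<open>F\<close> is not yet known. The bound with k = 0
    gives it for the difference to \<open>X (N 0)\<close>, and adding that element back gives it for
    \<open>F\<close>.\<close>
  define G where "G x = F x - L2_fun (X (N 0)) x" for x
  have [measurable]: "G \<in> borel_measurable borel" unfolding G_def[abs_def] by measurable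
  have "square_integrable G"
    unfolding square_integrable_def
  proof
    show "integrable lborel (\<lambda>x. (G x)\<^sup>2)"
    proof (rule integrableI_bounded)
      have "(\<integral>\<^sup>+x. ennreal (norm ((G x)\<^sup>2)) \<partial>lborel) = (\<integral>\<^sup>+x. ennreal ((L2_fun (X (N 0)) x - F x)\<^sup>2) \<partial>lborel)"
        by (simp add: G_def power2_commute)
      also have "\<dots> \<le> ennreal (((1/2) ^ 0)\<^sup>2)" by (rule fatou) simp
      also have "\<dots> < \<infinity>" by simp
      finally show "(\<integral>\<^sup>+x. ennreal (norm ((G x)\<^sup>2)) \<partial>lborel) < \<infinity>" .
    qed simp
  qed simp
  from square_integrable_add[OF this square_integrable_L2_fun[of "X (N 0)"]]
  have siF: "square_integrable F" by (simp add: G_def)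
  have bound: "norm (X n - L2_class F) \<le> (1/2) ^ k" if n: "n \<ge> N k" for n k
  proof -
    have "ennreal ((norm (X n - L2_class F))\<^sup>2) = (\<integral>\<^sup>+x. ennreal ((L2_fun (X n) x - L2_fun (L2_class F) x)\<^sup>2) \<partial>lborel)"
      by (rule nn_integral_L2_diff[symmetric])
    also have "\<dots> = (\<integral>\<^sup>+x. ennreal ((L2_fun (X n) x - F x)\<^sup>2) \<partial>lborel)"
      using L2_fun_class[OF siF] by (intro nn_integral_cong_AE) (auto elim!: eventually_mono)
    also have "\<dots> \<le> ennreal (((1/2) ^ k)\<^sup>2)" by (rule fatou[OF n])
    finally have "(norm (X n - L2_class F))\<^sup>2 \<le> ((1/2) ^ k)\<^sup>2" by simp
    then show ?thesis by (rule power2_le_imp_le) simp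
  qed
  have "X \<longlonglongrightarrow> L2_class F"
  proof (rule LIMSEQ_I)
    fix e :: real assume e: "0 < e"
    obtain k where k: "(1/2) ^ k < e" using real_arch_pow_inv[OF e, of "1/2"] by auto
    then show "\<exists>no. \<forall>n\<ge>no. norm (X n - L2_class F) < e" using bound le_less_trans by blast
  qed
  then show "\<exists>l\<in>UNIV. X \<longlonglongrightarrow> l" by blast
qed

section \<open>The closed subspace of functions vanishing off \<Omega>\<close>

lemma subspace_L2_on: "subspace (L2_on \<Omega>)"
proof (rule subspaceI)
  show "0 \<in> L2_on \<Omega>" using L2_fun_zero by (auto simp: L2_on_def elim!: eventually_mono)
  show "v + w \<in> L2_on \<Omega>" if "v \<in> L2_on \<Omega>" "w \<in> L2_on \<Omega>" for v w
    using that L2_fun_plus[of v w] unfolding L2_on_def by (auto elim: eventually_elim2)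
  show "c *\<^sub>R v \<in> L2_on \<Omega>" if "v \<in> L2_on \<Omega>" for c v
    using that L2_fun_scaleR[of c v] unfolding L2_on_def by (auto elim: eventually_elim2)
qed

text \<open>The part \<open>k\<close> of the limit \<open>l\<close> outside \<Omega> is orthogonal
  to every \<open>x n\<close>, hence to \<open>l\<close>; but <l, k> is the squared norm of
  \<open>k\<close>.\<close>

lemma closed_L2_on:
  fixes \<Omega> :: "('a::euclidean_space) set"
  assumes [measurable]: "\<Omega> \<in> sets borel"
  shows "closed (L2_on \<Omega>)"
  unfolding closed_sequential_limits
proof (intro allI impI, elim conjE)
  fix x and l :: "'a L2" assume x: "\<forall>n. x n \<in> L2_on \<Omega>" "x \<longlonglongrightarrow> l"
  define k where "k y = indicator (- \<Omega>) y * L2_fun l y" for y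
  have [measurable]: "k \<in> borel_measurable borel" unfolding k_def[abs_def] by measurable
  have k: "square_integrable k"
    unfolding square_integrable_def
  proof
    show "integrable lborel (\<lambda>x. (k x)\<^sup>2)"
    proof (rule Bochner_Integration.integrable_bound)
      show "integrable lborel (\<lambda>x. (L2_fun l x)\<^sup>2)"
        using square_integrable_L2_fun by (simp add: square_integrable_def)
    qed (auto simp: k_def indicator_def)
  qed simp
  have "inner (x n) (L2_class k) = 0" for n
  proof -
    have "AE y in lborel. L2_fun (x n) y * k y = 0"
      using x(1) unfolding L2_on_def k_def by (auto simp: indicator_def elim: eventually_mono)
    then show ?thesis unfolding inner_L2_class[OF k] by (rule integral_eq_zero_AE)
  qed
  moreover have "(\<lambda>n. inner (x n) (L2_class k)) \<longlonglongrightarrow> inner l (L2_class k)"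
    by (intro tendsto_intros x)
  ultimately have "(\<lambda>n. 0) \<longlonglongrightarrow> inner l (L2_class k)" by simp
  from LIMSEQ_unique[OF this tendsto_const] have "inner l (L2_class k) = 0" .
  moreover have "L2_fun l y * k y = (k y)\<^sup>2" for y by (auto simp: k_def indicator_def power2_eq_square)
  ultimately have "(\<integral>y. (k y)\<^sup>2 \<partial>lborel) = 0" by (simp add: inner_L2_class[OF k])
  then have "AE y in lborel. (k y)\<^sup>2 = 0"
    using k by (subst (asm) integral_nonneg_eq_0_iff_AE) (auto simp: square_integrable_def)
  then show "l \<in> L2_on \<Omega>" unfolding L2_on_def by (auto simp: k_def indicator_def elim: eventually_mono)
qed

lemma complete_L2_on: "\<Omega> \<in> sets borel \<Longrightarrow> complete (L2_on \<Omega>)"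
  using complete_closed_subset[OF closed_L2_on _ complete_L2] by blast

section \<open>Smooth functions and test functions\<close>

lemma partial_deriv_eq:
  "(f has_derivative f') (at x) \<Longrightarrow> partial_deriv i f x = f' (axis i 1)"
  unfolding partial_deriv_def by (metis frechet_derivative_at)

lemma Ck_Suc_imp: "Ck (Suc k) f \<Longrightarrow> Ck k f"
  by (induction k arbitrary: f) (auto intro: differentiable_imp_continuous_on)

lemma Ck_differentiable: "Ck (Suc k) f \<Longrightarrow> (f has_derivative frechet_derivative f (at x)) (at x)"
  by (simp add: differentiable_on_def frechet_derivative_works)

lemma Ck_add: "Ck k f \<Longrightarrow> Ck k g \<Longrightarrow> Ck k (\<lambda>x. f x + g x)"
proof (induction k arbitrary: f g)
  case 0
  then show ?case by (auto intro: continuous_intros)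
next
  case (Suc k)
  have "partial_deriv i (\<lambda>x. f x + g x) = (\<lambda>x. partial_deriv i f x + partial_deriv i g x)" for i
    by (rule ext, subst partial_deriv_eq[OF has_derivative_add[OF Ck_differentiable[OF Suc.prems(1)]
      Ck_differentiable[OF Suc.prems(2)]]]) (simp add: partial_deriv_def)
  then show ?case using Suc by (auto intro: differentiable_on_add)
qed

lemma partial_deriv_mult:
  assumes "f differentiable (at x)" "g differentiable (at x)"
  shows "partial_deriv i (\<lambda>x. f x * g x) x = f x * partial_deriv i g x + partial_deriv i f x * g x"
  by (subst partial_deriv_eq[OF has_derivative_mult[OF frechet_derivative_works[THEN iffD1, OF assms(1)]
      frechet_derivative_works[THEN iffD1, OF assms(2)]]]) (simp add: partial_deriv_def)

lemma Ck_mult: "Ck k f \<Longrightarrow> Ck k g \<Longrightarrow> Ck k (\<lambda>x. f x * g x)"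
proof (induction k arbitrary: f g)
  case 0
  then show ?case by (auto intro: continuous_intros)
next
  case (Suc k)
  have "partial_deriv i (\<lambda>x. f x * g x) = (\<lambda>x. f x * partial_deriv i g x + partial_deriv i f x * g x)" for i
    using Suc.prems by (intro ext partial_deriv_mult) (auto simp: differentiable_on_def)
  then show ?case
    using Suc Ck_Suc_imp[OF Suc.prems(1)] Ck_Suc_imp[OF Suc.prems(2)]
    by (auto intro!: differentiable_on_mult Ck_add)
qed

lemma smooth_mult: "smooth f \<Longrightarrow> smooth g \<Longrightarrow> smooth (\<lambda>x. f x * g x)"
  by (simp add: smooth_def Ck_mult)

lemma smooth_partial_deriv: "smooth f \<Longrightarrow> smooth (partial_deriv i f)"
  unfolding smooth_def by (metis Ck.simps(2))

lemma smooth_continuous_on: "smooth f \<Longrightarrow> continuous_on X f"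
  unfolding smooth_def by (metis Ck.simps(1) continuous_on_subset subset_UNIV)

lemma smooth_differentiable: "smooth f \<Longrightarrow> f differentiable (at x)"
  unfolding smooth_def by (metis Ck.simps(2) differentiable_on_def UNIV_I)

lemma smooth_measurable [measurable_dest]: "smooth f \<Longrightarrow> f \<in> borel_measurable borel"
  by (intro borel_measurable_continuous_onI smooth_continuous_on)

lemma smooth_has_derivative:
  fixes f :: "real^'n \<Rightarrow> real"
  assumes "smooth f"
  shows "(f has_derivative (\<lambda>h. \<Sum>i\<in>UNIV. h $ i * partial_deriv i f x)) (at x)"
proof -
  let ?D = "frechet_derivative f (at x)"
  have d: "(f has_derivative ?D) (at x)"
    using smooth_differentiable[OF assms] by (simp add: frechet_derivative_works)
  then have lin: "linear ?D" by (simp add: has_derivative_linear)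
  have "?D h = (\<Sum>i\<in>UNIV. h $ i * partial_deriv i f x)" for h
  proof -
    have "?D h = ?D (\<Sum>i\<in>UNIV. h $ i *\<^sub>R axis i 1)"
      using basis_expansion[of h] by (simp add: scalar_mult_eq_scaleR)
    also have "\<dots> = (\<Sum>i\<in>UNIV. h $ i * partial_deriv i f x)"
      by (simp add: linear_sum[OF lin] linear_cmul[OF lin] partial_deriv_def)
    finally show ?thesis .
  qed
  then have "?D = (\<lambda>h. \<Sum>i\<in>UNIV. h $ i * partial_deriv i f x)" by (rule ext)
  with d show ?thesis by simp
qed

lemma test_functionsD:
  assumes "\<phi> \<in> test_functions \<Omega>"
  shows "smooth \<phi>" "compact (closure {x. \<phi> x \<noteq> 0})" "\<phi> x \<noteq> 0 \<Longrightarrow> x \<in> \<Omega>" "bounded {x. \<phi> x \<noteq> 0}"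
  using assms closure_subset[of "{x. \<phi> x \<noteq> 0}"]
    bounded_subset[OF compact_imp_bounded closure_subset, of "{x. \<phi> x \<noteq> 0}"]
  by (auto simp: test_functions_def)

lemma test_functions_shrink:
  assumes "\<phi> \<in> test_functions \<Omega>" "smooth \<psi>" "\<And>x. \<psi> x \<noteq> 0 \<Longrightarrow> x \<in> closure {x. \<phi> x \<noteq> 0}"
  shows "\<psi> \<in> test_functions \<Omega>"
proof -
  have "closure {x. \<psi> x \<noteq> 0} \<subseteq> closure {x. \<phi> x \<noteq> 0}"
    using assms(3) by (intro closure_minimal) auto
  then show ?thesis
    using assms(1,2) closed_Int_compact[OF closed_closure[of "{x. \<psi> x \<noteq> 0}"], of "closure {x. \<phi> x \<noteq> 0}"]
    by (auto simp: test_functions_def Int_absorb2)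
qed

lemma test_functions_partial_deriv:
  assumes "\<phi> \<in> test_functions \<Omega>"
  shows "partial_deriv i \<phi> \<in> test_functions \<Omega>"
proof (rule test_functions_shrink[OF assms])
  show "smooth (partial_deriv i \<phi>)" by (intro smooth_partial_deriv test_functionsD(1)[OF assms])
  show "x \<in> closure {x. \<phi> x \<noteq> 0}" if "partial_deriv i \<phi> x \<noteq> 0" for x
  proof (rule ccontr)
    assume x: "x \<notin> closure {x. \<phi> x \<noteq> 0}"
    have "(\<phi> has_derivative (\<lambda>h. 0)) (at x)"
    proof (rule has_derivative_transform_within_open[of "\<lambda>x. 0" _ x UNIV "- closure {x. \<phi> x \<noteq> 0}"])
      show "0 = \<phi> y" if "y \<in> - closure {x. \<phi> x \<noteq> 0}" for y
        using that closure_subset[of "{x. \<phi> x \<noteq> 0}"] by auto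
    qed (use x in auto)
    from partial_deriv_eq[OF this] that show False by simp
  qed
qed

lemma test_functions_mult:
  assumes "\<phi> \<in> test_functions \<Omega>" "smooth a"
  shows "(\<lambda>x. a x * \<phi> x) \<in> test_functions \<Omega>"
  by (rule test_functions_shrink[OF assms(1)])
    (use assms closure_subset[of "{x. \<phi> x \<noteq> 0}"] in \<open>auto intro: smooth_mult test_functionsD\<close>)

lemma integrable_continuous_bounded_support:
  fixes f :: "'a::euclidean_space \<Rightarrow> real"
  assumes "continuous_on UNIV f" "bounded {x. f x \<noteq> 0}"
  shows "integrable lborel f"
proof -
  let ?K = "closure {x. f x \<noteq> 0}"
  have "integrable lborel (\<lambda>x. indicator ?K x *\<^sub>R f x)"
    using assms by (intro borel_integrable_compact) (auto intro: continuous_on_subset)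
  moreover have "(\<lambda>x. indicator ?K x *\<^sub>R f x) = f"
  proof
    show "indicator ?K x *\<^sub>R f x = f x" for x
      using closure_subset[of "{x. f x \<noteq> 0}"] by (cases "f x = 0") (auto simp: indicator_def)
  qed
  ultimately show ?thesis by simp
qed

lemma test_functions_square_integrable:
  assumes "\<phi> \<in> test_functions \<Omega>"
  shows "square_integrable \<phi>"
  unfolding square_integrable_def
proof
  show "\<phi> \<in> borel_measurable lborel" using test_functionsD(1)[OF assms] by (simp add: smooth_measurable)
  show "integrable lborel (\<lambda>x. (\<phi> x)\<^sup>2)"
    using test_functionsD[OF assms]
    by (intro integrable_continuous_bounded_support continuous_intros smooth_continuous_on) auto
qed

lemma L2_class_test_function_in_L2_on:
  assumes "\<phi> \<in> test_functions \<Omega>"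
  shows "L2_class \<phi> \<in> L2_on \<Omega>"
  using L2_fun_class[OF test_functions_square_integrable[OF assms]]
  unfolding L2_on_def mem_Collect_eq
  by (rule eventually_mono) (use test_functionsD(3)[OF assms] in metis)

section \<open>Translation invariance and integration by parts\<close>

lemma nn_integral_lborel_shift:
  assumes [measurable]: "f \<in> borel_measurable borel"
  shows "(\<integral>\<^sup>+x. f (x + c) \<partial>lborel) = (\<integral>\<^sup>+x. f x \<partial>lborel)"
proof -
  have "(\<integral>\<^sup>+x. f x \<partial>lborel) = (\<integral>\<^sup>+x. f x \<partial>distr lborel borel ((+) c))" by (simp add: lborel_distr_plus)
  also have "\<dots> = (\<integral>\<^sup>+x. f (c + x) \<partial>lborel)" by (subst nn_integral_distr) auto
  finally show ?thesis by (simp add: add.commute)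
qed

lemma integral_lborel_shift:
  fixes f :: "'a::euclidean_space \<Rightarrow> real"
  assumes [measurable]: "f \<in> borel_measurable borel"
  shows "(\<integral>x. f (x + c) \<partial>lborel) = (\<integral>x. f x \<partial>lborel)"
proof -
  have "(\<integral>x. f x \<partial>lborel) = (\<integral>x. f x \<partial>distr lborel borel ((+) c))" by (simp add: lborel_distr_plus)
  also have "\<dots> = (\<integral>x. f (c + x) \<partial>lborel)" by (subst integral_distr) auto
  finally show ?thesis by (simp add: add.commute)
qed

lemma smooth_line_derivative:
  fixes f :: "real^'n \<Rightarrow> real"
  assumes "smooth f"
  shows "((\<lambda>t. f (x + t *\<^sub>R z)) has_real_derivative (\<Sum>i\<in>UNIV. z $ i * partial_deriv i f (x + t *\<^sub>R z))) (at t)"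
proof -
  have 1: "((\<lambda>t. x + t *\<^sub>R z) has_derivative (\<lambda>h. h *\<^sub>R z)) (at t)"
    by (auto intro!: derivative_eq_intros)
  have "((\<lambda>t. f (x + t *\<^sub>R z)) has_derivative (\<lambda>h. \<Sum>i\<in>UNIV. (h *\<^sub>R z) $ i * partial_deriv i f (x + t *\<^sub>R z))) (at t)"
    by (rule has_derivative_compose[OF 1 smooth_has_derivative[OF assms]])
  then show ?thesis
    by (simp add: has_field_derivative_def sum_distrib_left mult_ac)
      (simp add: fun_eq_iff sum_distrib_left mult_ac has_derivative_eq_rhs)
qed

text \<open>Each difference quotient has integral 0 by translation invariance of Lebesgue measure,
  and dominated convergence passes this on to the derivative.\<close>

lemma integral_partial_deriv_eq_0:
  fixes f :: "real^'n \<Rightarrow> real"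
  assumes f: "smooth f" "bounded {x. f x \<noteq> 0}"
  shows "(\<integral>x. partial_deriv i f x \<partial>lborel) = 0"
proof -
  let ?e = "axis i 1 :: real^'n"
  define h where "h n = inverse (real (Suc n))" for n
  have h: "0 < h n" "h n \<le> 1" for n by (auto simp: h_def field_simps)
  have h0: "h \<longlonglongrightarrow> 0" unfolding h_def by (rule LIMSEQ_inverse_real_of_nat)
  have [measurable]: "f \<in> borel_measurable borel" "partial_deriv i f \<in> borel_measurable borel"
    using f(1) smooth_partial_deriv[OF f(1)] by (auto intro: smooth_measurable)
  obtain R where R: "\<And>x. f x \<noteq> 0 \<Longrightarrow> norm x \<le> R" using f(2) unfolding bounded_iff by auto
  have "compact (partial_deriv i f ` cball 0 (R + 2))"
    by (intro compact_continuous_image smooth_continuous_on smooth_partial_deriv f) auto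
  from compact_imp_bounded[OF this]
  obtain B where "\<forall>x\<in>cball 0 (R + 2). \<bar>partial_deriv i f x\<bar> \<le> B"
    unfolding bounded_iff by auto
  then have B: "\<bar>partial_deriv i f x\<bar> \<le> B" if "x \<in> cball 0 (R + 2)" for x using that by blast
  have line: "((\<lambda>t. f (x + t *\<^sub>R ?e)) has_real_derivative partial_deriv i f (x + t *\<^sub>R ?e)) (at t)" for x t
    using smooth_line_derivative[OF f(1), of x ?e t]
    by (simp add: axis_def if_distrib[of "\<lambda>c. c * _"] cong: if_cong)
  define q where "q n x = (f (x + h n *\<^sub>R ?e) - f x) / h n" for n x
  have "(\<lambda>n. \<integral>x. q n x \<partial>lborel) \<longlonglongrightarrow> (\<integral>x. partial_deriv i f x \<partial>lborel)"
  proof (rule integral_dominated_convergence)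
    \<comment> \<open>Steps have length at most 1. Outside the ball of radius R + 1 both points miss
      the support; inside, the intermediate point stays in the ball of radius R + 2, where
      \<open>B\<close> bounds the derivative.\<close>
    show "integrable lborel (\<lambda>x. B * indicator (cball 0 (R + 1)) x :: real)"
      by (intro integrable_mult_right integrable_real_indicator) (auto intro: emeasure_bounded_finite[simplified])
    show "AE x in lborel. (\<lambda>n. q n x) \<longlonglongrightarrow> partial_deriv i f x"
    proof (rule AE_I2)
      fix x
      have "((\<lambda>t. (f (x + t *\<^sub>R ?e) - f x) / t) \<longlongrightarrow> partial_deriv i f x) (at 0)"
        using line[of x 0] by (simp add: has_field_derivative_iff)
      then have "((\<lambda>t. (f (x + t *\<^sub>R ?e) - f x) / t) \<circ> h) \<longlonglongrightarrow> partial_deriv i f x"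
        by (rule tendsto_at_iff_sequentially[THEN iffD1, rule_format])
          (use h h0 in \<open>auto simp: less_imp_neq[THEN not_sym]\<close>)
      then show "(\<lambda>n. q n x) \<longlonglongrightarrow> partial_deriv i f x" by (simp add: q_def o_def)
    qed
    show "AE x in lborel. norm (q n x) \<le> B * indicator (cball 0 (R + 1)) x" for n
    proof (rule AE_I2)
      fix x
      show "norm (q n x) \<le> B * indicator (cball 0 (R + 1)) x"
      proof (cases "x \<in> cball 0 (R + 1)")
        case True
        obtain t where t: "0 < t" "t < h n" "f (x + h n *\<^sub>R ?e) - f (x + 0 *\<^sub>R ?e) = (h n - 0) * partial_deriv i f (x + t *\<^sub>R ?e)"
          using MVT2[OF h(1)[of n], of "\<lambda>t. f (x + t *\<^sub>R ?e)" "\<lambda>t. partial_deriv i f (x + t *\<^sub>R ?e)", OF line]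
          by blast
        have "norm (x + t *\<^sub>R ?e) \<le> R + 2"
          using norm_triangle_ineq[of x "t *\<^sub>R ?e"] True t h(2)[of n] by (simp add: norm_axis_1)
        then have "\<bar>partial_deriv i f (x + t *\<^sub>R ?e)\<bar> \<le> B" by (intro B) simp
        moreover have "q n x = partial_deriv i f (x + t *\<^sub>R ?e)" using t h(1)[of n] by (simp add: q_def)
        ultimately show ?thesis using True by simp
      next
        case False
        then have nx: "norm x > R + 1" by simp
        then have "norm (x + h n *\<^sub>R ?e) > R"
          using norm_triangle_ineq2[of x "- (h n *\<^sub>R ?e)"] h[of n] by (simp add: norm_axis_1)
        then have "f (x + h n *\<^sub>R ?e) = 0" "f x = 0" using R nx by (force, force)
        then show ?thesis using False by (simp add: q_def)
      qed
    qed
  qed (simp_all add: q_def)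
  moreover have "(\<integral>x. q n x \<partial>lborel) = 0" for n
  proof -
    have int: "integrable lborel f"
      by (intro integrable_continuous_bounded_support smooth_continuous_on f)
    have "bounded {x. f (x + h n *\<^sub>R ?e) \<noteq> 0}"
    proof -
      have "{x. f (x + h n *\<^sub>R ?e) \<noteq> 0} = (\<lambda>x. x - h n *\<^sub>R ?e) ` {x. f x \<noteq> 0}"
        by (auto simp: image_iff) (metis add_diff_cancel diff_add_cancel)
      then show ?thesis using bounded_translation_minus[OF f(2)] by simp
    qed
    then have "integrable lborel (\<lambda>x. f (x + h n *\<^sub>R ?e))"
      by (intro integrable_continuous_bounded_support continuous_on_compose2[OF smooth_continuous_on[OF f(1), of UNIV]]
          continuous_intros) auto
    then show ?thesis unfolding q_def using int by (simp add: integral_lborel_shift)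
  qed
  ultimately show ?thesis using LIMSEQ_unique[OF tendsto_const] by fastforce
qed

lemma integration_by_parts:
  assumes "\<phi> \<in> test_functions \<Omega>" "\<psi> \<in> test_functions \<Omega>"
  shows "(\<integral>x. \<phi> x * partial_deriv i \<psi> x \<partial>lborel) = - (\<integral>x. partial_deriv i \<phi> x * \<psi> x \<partial>lborel)"
proof -
  note sm = test_functionsD(1)[OF assms(1)] test_functionsD(1)[OF assms(2)]
  have "(\<lambda>x. \<phi> x * \<psi> x) \<in> test_functions \<Omega>" by (rule test_functions_mult[OF assms(2) sm(1)])
  from integral_partial_deriv_eq_0[OF test_functionsD(1,4)[OF this], of i]
  have "(\<integral>x. \<phi> x * partial_deriv i \<psi> x + partial_deriv i \<phi> x * \<psi> x \<partial>lborel) = 0"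
    by (simp add: partial_deriv_mult[OF sm[THEN smooth_differentiable]])
  moreover have "integrable lborel (\<lambda>x. \<phi> x * partial_deriv i \<psi> x)" "integrable lborel (\<lambda>x. partial_deriv i \<phi> x * \<psi> x)"
    by (rule square_integrable_mult;
        rule test_functions_square_integrable, (rule test_functions_partial_deriv)?, rule assms)+
  ultimately show ?thesis by (simp add: Bochner_Integration.integral_add)
qed

section \<open>Compactness\<close>

text \<open>The increment is the integral of the directional derivative along the segment; Jensen's
  inequality moves the square inside and Cauchy-Schwarz splits off |z|^2.\<close>

lemma power2_increment_le:
  fixes f :: "real^'n \<Rightarrow> real"
  assumes f: "smooth f"
  shows "ennreal ((f (x + z) - f x)\<^sup>2) \<le>
    (\<integral>\<^sup>+t. indicator {0..1} t * ennreal ((norm z)\<^sup>2 * (\<Sum>i\<in>UNIV. (partial_deriv i f (x + t *\<^sub>R z))\<^sup>2)) \<partial>lborel)"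
proof -
  define g where "g t = (\<Sum>i\<in>UNIV. z $ i * partial_deriv i f (x + t *\<^sub>R z))" for t
  define d where "d = f (x + z) - f x"
  have cont: "continuous_on X g" for X
    unfolding g_def
    by (intro continuous_intros continuous_on_compose2[OF smooth_continuous_on[OF smooth_partial_deriv[OF f], of UNIV]]) auto
  have "(\<integral>t. indicator {0..1} t *\<^sub>R g t \<partial>lborel) = f (x + 1 *\<^sub>R z) - f (x + 0 *\<^sub>R z)"
  proof (rule integral_FTC_Icc)
    show "((\<lambda>t. f (x + t *\<^sub>R z)) has_vector_derivative g t) (at t within {0..1})" for t
      using smooth_line_derivative[OF f, of x z t]
      by (simp add: g_def has_real_derivative_iff_has_vector_derivative has_vector_derivative_at_within)
  qed (simp_all add: cont)
  then have int: "(\<integral>t. indicator {0..1} t * g t \<partial>lborel) = d" by (simp add: d_def)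
  have i1: "integrable lborel (\<lambda>t. indicator {0..1} t * g t)"
    using borel_integrable_compact[of "{0..1}" g] cont by simp
  have i2: "integrable lborel (\<lambda>t. indicator {0..1} t * (g t)\<^sup>2)"
    using borel_integrable_compact[of "{0..1}" "\<lambda>t. (g t)\<^sup>2"] cont by (simp add: continuous_on_power)
  have i0: "integrable lborel (\<lambda>t. indicator {0..1::real} t * d\<^sup>2)" by simp
  \<comment> \<open>Jensen by hand: 2 d g - d^2 \<le> g^2 pointwise, and the left side integrates to
    d^2 because the mean of \<open>g\<close> over the unit interval is \<open>d\<close>.\<close>
  have "d\<^sup>2 = (\<integral>t. 2 * d * (indicator {0..1} t * g t) - indicator {0..1} t * d\<^sup>2 \<partial>lborel)"
    using i1 i0 int by (simp add: power2_eq_square)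
  also have "\<dots> \<le> (\<integral>t. indicator {0..1} t * (g t)\<^sup>2 \<partial>lborel)"
  proof (rule integral_mono)
    show "2 * d * (indicator {0..1} t * g t) - indicator {0..1} t * d\<^sup>2 \<le> indicator {0..1} t * (g t)\<^sup>2" for t
      using zero_le_power2[of "g t - d"] by (simp add: indicator_def power2_diff algebra_simps)
  qed (use i0 i1 i2 in auto)
  finally have "ennreal (d\<^sup>2) \<le> ennreal (\<integral>t. indicator {0..1} t * (g t)\<^sup>2 \<partial>lborel)" by (rule ennreal_leI)
  also have "\<dots> = (\<integral>\<^sup>+t. ennreal (indicator {0..1} t * (g t)\<^sup>2) \<partial>lborel)"
    by (rule nn_integral_eq_integral[symmetric, OF i2]) simp
  also have "\<dots> \<le> (\<integral>\<^sup>+t. indicator {0..1} t * ennreal ((norm z)\<^sup>2 * (\<Sum>i\<in>UNIV. (partial_deriv i f (x + t *\<^sub>R z))\<^sup>2)) \<partial>lborel)"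
  proof (rule nn_integral_mono)
    fix t
    let ?p = "(\<chi> i. partial_deriv i f (x + t *\<^sub>R z))"
    have "g t = z \<bullet> ?p" by (simp add: g_def inner_vec_def)
    then have "(g t)\<^sup>2 \<le> (norm z)\<^sup>2 * (norm ?p)\<^sup>2"
      using Cauchy_Schwarz_ineq2[of z ?p] power_mono[of "\<bar>z \<bullet> ?p\<bar>" "norm z * norm ?p" 2]
      by (simp add: power_mult_distrib)
    also have "(norm ?p)\<^sup>2 = (\<Sum>i\<in>UNIV. (partial_deriv i f (x + t *\<^sub>R z))\<^sup>2)"
      by (simp add: norm_vec_def L2_set_def sum_nonneg)
    finally show "ennreal (indicator {0..1} t * (g t)\<^sup>2)
        \<le> indicator {0..1} t * ennreal ((norm z)\<^sup>2 * (\<Sum>i\<in>UNIV. (partial_deriv i f (x + t *\<^sub>R z))\<^sup>2))"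
      by (auto simp: indicator_def intro: ennreal_leI)
  qed
  finally show ?thesis by (simp add: d_def)
qed

text \<open>After exchanging the integrals, translation invariance makes the integral over x
  independent of the position t on the segment.\<close>

lemma nn_integral_translation_difference:
  fixes \<phi> :: "real^'n \<Rightarrow> real"
  assumes phi: "\<phi> \<in> test_functions \<Omega>"
  shows "(\<integral>\<^sup>+x. ennreal ((\<phi> (x + z) - \<phi> x)\<^sup>2) \<partial>lborel)
    \<le> ennreal ((norm z)\<^sup>2 * (\<Sum>i\<in>UNIV. (norm (L2_class (partial_deriv i \<phi>)))\<^sup>2))"
proof -
  note sm = test_functionsD(1)[OF phi]
  have [measurable]: "partial_deriv i \<phi> \<in> borel_measurable borel" for i
    by (intro smooth_measurable smooth_partial_deriv sm)
  define q where "q x = (norm z)\<^sup>2 * (\<Sum>i\<in>UNIV. (partial_deriv i \<phi> x)\<^sup>2)" for x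
  have [measurable]: "q \<in> borel_measurable borel" unfolding q_def[abs_def] by measurable
  have si: "square_integrable (partial_deriv i \<phi>)" for i
    by (rule test_functions_square_integrable[OF test_functions_partial_deriv[OF phi]])
  have norm_eq: "(norm (L2_class (partial_deriv i \<phi>)))\<^sup>2 = (\<integral>x. (partial_deriv i \<phi> x)\<^sup>2 \<partial>lborel)" for i
    unfolding norm_L2_power2 using L2_fun_class[OF si[of i]] si[of i]
    by (intro integral_cong_AE) (auto simp: square_integrable_def elim!: eventually_mono)
  have q_int: "(\<integral>\<^sup>+x. ennreal (q x) \<partial>lborel) = ennreal ((norm z)\<^sup>2 * (\<Sum>i\<in>UNIV. (norm (L2_class (partial_deriv i \<phi>)))\<^sup>2))"
  proof -
    have "integrable lborel q"
      unfolding q_def[abs_def] using si by (auto simp: square_integrable_def)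
    then have "(\<integral>\<^sup>+x. ennreal (q x) \<partial>lborel) = ennreal (\<integral>x. q x \<partial>lborel)"
      by (rule nn_integral_eq_integral) (auto simp: q_def sum_nonneg)
    also have "(\<integral>x. q x \<partial>lborel) = (norm z)\<^sup>2 * (\<Sum>i\<in>UNIV. (norm (L2_class (partial_deriv i \<phi>)))\<^sup>2)"
      unfolding norm_eq q_def using si by (simp add: square_integrable_def Bochner_Integration.integral_sum)
    finally show ?thesis .
  qed
  have "(\<integral>\<^sup>+x. ennreal ((\<phi> (x + z) - \<phi> x)\<^sup>2) \<partial>lborel)
      \<le> (\<integral>\<^sup>+x. (\<integral>\<^sup>+t. indicator {0..1::real} t * ennreal (q (x + t *\<^sub>R z)) \<partial>lborel) \<partial>lborel)"
    unfolding q_def by (intro nn_integral_mono power2_increment_le sm)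
  also have "\<dots> = (\<integral>\<^sup>+t. (\<integral>\<^sup>+x. indicator {0..1::real} t * ennreal (q (x + t *\<^sub>R z)) \<partial>lborel) \<partial>lborel)"
    by (rule lborel_pair.Fubini') measurable
  also have "\<dots> = (\<integral>\<^sup>+t. indicator {0..1::real} t * (\<integral>\<^sup>+x. ennreal (q x) \<partial>lborel) \<partial>lborel)"
    by (intro nn_integral_cong)
      (simp add: nn_integral_cmult nn_integral_lborel_shift[of "\<lambda>x. ennreal (q x)"])
  also have "\<dots> = (\<integral>\<^sup>+x. ennreal (q x) \<partial>lborel)"
    by (simp add: nn_integral_multc)
  finally show ?thesis unfolding q_int .
qed

text \<open>The half-open cube with lower corner h k. Floors place every point in exactly one
  cell.\<close>

definition cell :: "real \<Rightarrow> ('n \<Rightarrow> int) \<Rightarrow> (real^'n::finite) set" where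
  "cell h k = {x. \<forall>i. \<lfloor>x $ i / h\<rfloor> = k i}"

lemma mem_cell: "0 < h \<Longrightarrow> x \<in> cell h k \<longleftrightarrow> (\<forall>i. h * k i \<le> x $ i \<and> x $ i < h * k i + h)"
  by (simp add: cell_def floor_eq_iff field_simps)

lemma sum_Basis_component: "(\<Sum>b\<in>(Basis :: (real^'n) set). b $ i) = 1"
proof -
  have "(\<Sum>b\<in>(Basis :: (real^'n) set). b $ i) = (One :: real^'n) $ i" by simp
  also have "\<dots> = inner (One :: real^'n) (axis i 1)" by (simp only: cart_eq_inner_axis)
  also have "\<dots> = 1" by (rule inner_sum_Basis) (simp add: axis_in_Basis_iff)
  finally show ?thesis .
qed

lemma cell_measurable:
  assumes "0 < h" shows "cell h k \<in> sets borel"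
proof -
  have "cell h k = (\<Inter>i. {x. h * k i \<le> x $ i} \<inter> {x. x $ i < h * k i + h})"
    using mem_cell[OF assms] by auto
  moreover have "{x. h * k i \<le> x $ i} \<inter> {x. x $ i < h * k i + h} \<in> sets borel" for i
    using closed_halfspace_component_ge_cart[of "h * k i" i] open_halfspace_component_lt_cart[of i "h * k i + h"]
    by auto
  ultimately show ?thesis by auto
qed

lemma cell_subset_cbox:
  assumes "0 < h"
  shows "cell h k \<subseteq> cbox (\<chi> i. h * k i) ((\<chi> i. h * k i) + h *\<^sub>R One)"
  by (auto simp: mem_cell[OF assms] mem_box_cart sum_Basis_component less_imp_le)

lemma measure_cell_ge:
  fixes k :: "'n::finite \<Rightarrow> int"
  assumes "0 < h"
  shows "h ^ DIM(real^'n) \<le> measure lborel (cell h k)"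
proof -
  let ?a = "(\<chi> i. h * k i) :: real^'n"
  have "h ^ DIM(real^'n) = measure lborel (box ?a (?a + h *\<^sub>R One))"
    using assms by (simp add: measure_lborel_box inner_add_left)
  also have "\<dots> \<le> measure lborel (cell h k)"
  proof (rule measure_mono_fmeasurable)
    show "box ?a (?a + h *\<^sub>R One) \<subseteq> cell h k"
      by (auto simp: mem_cell[OF assms] mem_box_cart sum_Basis_component less_imp_le)
    show "cell h k \<in> fmeasurable lborel"
      using cell_measurable[OF assms] cell_subset_cbox[OF assms]
      by (intro fmeasurableI2[OF fmeasurable_cbox]) auto
  qed auto
  finally show ?thesis .
qed

lemma finite_cells:
  fixes \<Omega> :: "(real^'n) set"
  assumes "bounded \<Omega>" "0 < h"
  shows "finite {k. cell h k \<inter> \<Omega> \<noteq> {}}"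
proof -
  obtain R where R: "\<And>x. x \<in> \<Omega> \<Longrightarrow> norm x \<le> R" using assms(1) unfolding bounded_iff by auto
  have "{k. cell h k \<inter> \<Omega> \<noteq> {}} \<subseteq> Pi\<^sub>E UNIV (\<lambda>_. {\<lfloor>- R / h\<rfloor>..\<lfloor>R / h\<rfloor>})"
  proof
    fix k assume "k \<in> {k. cell h k \<inter> \<Omega> \<noteq> {}}"
    then obtain x where x: "x \<in> \<Omega>" "\<And>i. \<lfloor>x $ i / h\<rfloor> = k i" by (auto simp: cell_def)
    have "- R \<le> x $ i" "x $ i \<le> R" for i
      using component_le_norm_cart[of x i] R[OF x(1)] by linarith+
    then have "- R / h \<le> x $ i / h" "x $ i / h \<le> R / h" for i
      using divide_right_mono[of "- R" "x $ i" h] divide_right_mono[of "x $ i" R h] assms(2)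
      by auto
    then show "k \<in> Pi\<^sub>E UNIV (\<lambda>_. {\<lfloor>- R / h\<rfloor>..\<lfloor>R / h\<rfloor>})"
      by (auto simp: x(2)[symmetric] intro!: floor_mono)
  qed
  then show ?thesis by (rule finite_subset) (auto intro: finite_PiE)
qed

text \<open>On each cube of mesh \<open>h\<close>, \<open>\<phi>\<close> is compared with its mean; the error is controlled by
  translations of length at most \<open>CARD('n) * h\<close>.\<close>

lemma grid_estimate:
  fixes \<Omega> :: "(real^'n) set" and h :: real
  assumes bdd: "bounded \<Omega>" and h: "0 < h"
  shows "\<exists>E C. finite E \<and> (\<forall>\<phi>\<in>test_functions \<Omega>. (norm (L2_class \<phi>))\<^sup>2
    \<le> 2 * 2 ^ DIM(real^'n) * (CARD('n) * h)\<^sup>2 * (\<Sum>i\<in>UNIV. (norm (L2_class (partial_deriv i \<phi>)))\<^sup>2)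
      + C * (\<Sum>e\<in>E. (inner (L2_class \<phi>) e)\<^sup>2))"
proof -
  define K where "K = {k. cell h k \<inter> \<Omega> \<noteq> {}}"
  have K: "finite K" unfolding K_def by (rule finite_cells[OF bdd h])
  define e where "e k = L2_class (indicator (cell h k) :: real^'n \<Rightarrow> real)" for k
  define m where "m = h ^ DIM(real^'n)"
  have m: "0 < m" using h by (simp add: m_def)
  define B :: "(real^'n) set" where "B = cbox (- (h *\<^sub>R One)) (h *\<^sub>R One)"
  note [measurable] = cell_measurable[OF h]
  have [measurable]: "B \<in> sets borel" by (simp add: B_def)
  have cell_fin: "emeasure lborel (cell h k :: (real^'n) set) < \<infinity>" for k
    using emeasure_bounded_finite[OF bounded_subset[OF bounded_cbox cell_subset_cbox[OF h]], of k] .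
  define mk where "mk k = measure lborel (cell h k :: (real^'n) set)" for k
  have mk: "m \<le> mk k" "0 < mk k" for k using measure_cell_ge[OF h, of k] m by (auto simp: mk_def m_def)
  have si_ind: "square_integrable (indicator (cell h k) :: real^'n \<Rightarrow> real)" for k
    using cell_fin[of k] by (auto simp: square_integrable_def power2_eq_square indicator_inter_arith[symmetric])
  have main: "(norm (L2_class \<phi>))\<^sup>2
    \<le> 2 * 2 ^ DIM(real^'n) * (CARD('n) * h)\<^sup>2 * (\<Sum>i\<in>UNIV. (norm (L2_class (partial_deriv i \<phi>)))\<^sup>2)
      + (\<Sum>k\<in>K. 2 / m * (inner (L2_class \<phi>) (e k))\<^sup>2)" if phi: "\<phi> \<in> test_functions \<Omega>" for \<phi>
  proof -
    define G where "G = (\<Sum>i\<in>UNIV. (norm (L2_class (partial_deriv i \<phi>)))\<^sup>2)"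
    have G: "0 \<le> G" by (simp add: G_def sum_nonneg)
    note si = test_functions_square_integrable[OF phi]
    have [measurable]: "\<phi> \<in> borel_measurable borel" using si by (simp add: square_integrable_def)
    define I where "I k = (\<integral>y. \<phi> y * indicator (cell h k) y \<partial>lborel)" for k
    have I: "I k = inner (L2_class \<phi>) (e k)" for k
      unfolding I_def e_def inner_L2_class[OF si_ind] using L2_fun_class[OF si]
      by (intro integral_cong_AE) (auto elim!: eventually_mono)
    \<comment> \<open>\<open>T\<close> no longer refers to a cell: two points of a common cell
      differ by some z in \<open>B\<close>, so integrating over all shifts in \<open>B\<close>
      dominates the oscillation on the cell and can be exchanged with the integral over x.\<close>
    define T where "T x = (\<integral>\<^sup>+z. indicator B z * ennreal ((\<phi> (x + z) - \<phi> x)\<^sup>2) \<partial>lborel)" for x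
    have [measurable]: "T \<in> borel_measurable borel"
      unfolding T_def[abs_def] by measurable
    have pointwise: "ennreal ((\<phi> x)\<^sup>2) \<le> (\<Sum>k\<in>K. indicator (cell h k) x * ennreal (2 * (I k / mk k)\<^sup>2)) + ennreal (2 / m) * T x" for x
    proof (cases "\<phi> x = 0")
      case False
      define k where "k i = \<lfloor>x $ i / h\<rfloor>" for i
      have xk: "x \<in> cell h k" by (simp add: cell_def k_def)
      have kK: "k \<in> K" using xk test_functionsD(3)[OF phi False] by (auto simp: K_def)
      define c where "c = I k / mk k"
      let ?i = "\<lambda>y. indicator (cell h k) y :: real"
      have i1: "integrable lborel (\<lambda>y. \<phi> y * ?i y)" by (rule square_integrable_mult[OF si si_ind])
      have i2: "integrable lborel (\<lambda>y. ?i y * (\<phi> y)\<^sup>2)"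
      proof (rule Bochner_Integration.integrable_bound)
        show "integrable lborel (\<lambda>y. (\<phi> y)\<^sup>2)" using si by (simp add: square_integrable_def)
      qed (auto simp: indicator_def)
      have i0: "integrable lborel ?i" using cell_fin[of k] by simp
      have "integrable lborel (\<lambda>y. ?i y * (\<phi> x)\<^sup>2 - 2 * \<phi> x * (\<phi> y * ?i y) + ?i y * (\<phi> y)\<^sup>2)"
        using i0 i1 i2 by simp
      then have i3: "integrable lborel (\<lambda>y. ?i y * (\<phi> y - \<phi> x)\<^sup>2)"
        by (rule back_subst[of "integrable lborel"]) (simp add: fun_eq_iff power2_diff algebra_simps)
      \<comment> \<open>On the cell, (\<phi> y - \<phi> x)^2 is expanded around the mean
        \<open>c\<close> and (c - \<phi> y)^2 is discarded; the mixed term integrates to 0 since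
        \<open>c\<close> is the mean.\<close>
      have "mk k * (\<phi> x - c)\<^sup>2 = (\<integral>y. (\<phi> x - c)\<^sup>2 * ?i y + 2 * (\<phi> x - c) * (c * ?i y - \<phi> y * ?i y) \<partial>lborel)"
        using i0 i1 mk(2)[of k] by (simp add: I_def[symmetric] mk_def[symmetric] c_def)
      also have "\<dots> \<le> (\<integral>y. ?i y * (\<phi> y - \<phi> x)\<^sup>2 \<partial>lborel)"
      proof (rule integral_mono)
        show "(\<phi> x - c)\<^sup>2 * ?i y + 2 * (\<phi> x - c) * (c * ?i y - \<phi> y * ?i y) \<le> ?i y * (\<phi> y - \<phi> x)\<^sup>2" for y
          using zero_le_power2[of "c - \<phi> y"] by (simp add: indicator_def power2_eq_square algebra_simps)
      qed (use i0 i1 i3 in auto)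
      finally have 1: "mk k * (\<phi> x - c)\<^sup>2 \<le> (\<integral>y. ?i y * (\<phi> y - \<phi> x)\<^sup>2 \<partial>lborel)" .
      have "ennreal (\<integral>y. ?i y * (\<phi> y - \<phi> x)\<^sup>2 \<partial>lborel) = (\<integral>\<^sup>+y. ennreal (?i y * (\<phi> y - \<phi> x)\<^sup>2) \<partial>lborel)"
        by (rule nn_integral_eq_integral[symmetric, OF i3]) simp
      also have "\<dots> = (\<integral>\<^sup>+z. ennreal (?i (z + x) * (\<phi> (z + x) - \<phi> x)\<^sup>2) \<partial>lborel)"
        by (rule nn_integral_lborel_shift[symmetric]) measurable
      also have "\<dots> \<le> T x"
        unfolding T_def
      proof (rule nn_integral_mono)
        fix z
        have "z \<in> B" if "z + x \<in> cell h k"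
          using that xk unfolding mem_cell[OF h] B_def
          by (simp add: mem_box_cart sum_Basis_component) (smt (verit))
        then show "ennreal (?i (z + x) * (\<phi> (z + x) - \<phi> x)\<^sup>2) \<le> indicator B z * ennreal ((\<phi> (x + z) - \<phi> x)\<^sup>2)"
          by (auto simp: indicator_def add.commute)
      qed
      finally have 2: "ennreal (mk k * (\<phi> x - c)\<^sup>2) \<le> T x" using ennreal_leI[OF 1] by (rule order_trans[rotated])
      have "(\<phi> x)\<^sup>2 \<le> 2 * c\<^sup>2 + 2 * (\<phi> x - c)\<^sup>2"
        using zero_le_power2[of "\<phi> x - 2 * c"] by (simp add: power2_eq_square algebra_simps)
      also have "\<dots> \<le> 2 * c\<^sup>2 + 2 / m * (mk k * (\<phi> x - c)\<^sup>2)"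
        using mult_right_mono[OF mk(1)[of k], of "(\<phi> x - c)\<^sup>2"] m by (simp add: field_simps)
      finally have "ennreal ((\<phi> x)\<^sup>2) \<le> ennreal (2 * c\<^sup>2 + 2 / m * (mk k * (\<phi> x - c)\<^sup>2))" by (rule ennreal_leI)
      also have "\<dots> = ennreal (2 * c\<^sup>2) + ennreal (2 / m) * ennreal (mk k * (\<phi> x - c)\<^sup>2)"
      proof -
        have "0 \<le> 2 * c\<^sup>2" "0 \<le> 2 / m" "0 \<le> mk k * (\<phi> x - c)\<^sup>2" using m mk(2)[of k] by auto
        then show ?thesis by (simp only: ennreal_plus ennreal_mult mult_nonneg_nonneg)
      qed
      also have "\<dots> \<le> (\<Sum>k\<in>K. indicator (cell h k) x * ennreal (2 * (I k / mk k)\<^sup>2)) + ennreal (2 / m) * T x"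
      proof (intro add_mono mult_left_mono 2)
        have "ennreal (2 * c\<^sup>2) = indicator (cell h k) x * ennreal (2 * (I k / mk k)\<^sup>2)"
          using xk by (simp add: c_def)
        also have "\<dots> \<le> (\<Sum>k\<in>K. indicator (cell h k) x * ennreal (2 * (I k / mk k)\<^sup>2))"
          by (rule member_le_sum[OF kK _ K]) simp
        finally show "ennreal (2 * c\<^sup>2) \<le> (\<Sum>k\<in>K. indicator (cell h k) x * ennreal (2 * (I k / mk k)\<^sup>2))" .
      qed simp
      finally show ?thesis .
    qed simp
    have T_int: "(\<integral>\<^sup>+x. T x \<partial>lborel) \<le> ennreal ((2 * h) ^ DIM(real^'n) * ((CARD('n) * h)\<^sup>2 * G))"
    proof -
      have "(\<integral>\<^sup>+x. T x \<partial>lborel) = (\<integral>\<^sup>+z. (\<integral>\<^sup>+x. indicator B z * ennreal ((\<phi> (x + z) - \<phi> x)\<^sup>2) \<partial>lborel) \<partial>lborel)"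
        unfolding T_def by (rule lborel_pair.Fubini') measurable
      also have "\<dots> = (\<integral>\<^sup>+z. indicator B z * (\<integral>\<^sup>+x. ennreal ((\<phi> (x + z) - \<phi> x)\<^sup>2) \<partial>lborel) \<partial>lborel)"
        by (intro nn_integral_cong nn_integral_cmult) measurable
      also have "\<dots> \<le> (\<integral>\<^sup>+z. indicator B z * ennreal ((CARD('n) * h)\<^sup>2 * G) \<partial>lborel)"
      proof (rule nn_integral_mono)
        fix z :: "real^'n"
        show "indicator B z * (\<integral>\<^sup>+x. ennreal ((\<phi> (x + z) - \<phi> x)\<^sup>2) \<partial>lborel) \<le> indicator B z * ennreal ((CARD('n) * h)\<^sup>2 * G)"
        proof (cases "z \<in> B")
          case True
          then have "\<bar>z $ i\<bar> \<le> h" for i by (auto simp: B_def mem_box_cart sum_Basis_component abs_le_iff minus_le_iff)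
          then have "norm z \<le> CARD('n) * h"
            using norm_le_l1_cart[of z] sum_bounded_above[of UNIV "\<lambda>i. \<bar>z $ i\<bar>" h] by simp
          then have "(norm z)\<^sup>2 * G \<le> (CARD('n) * h)\<^sup>2 * G"
            using G by (intro mult_right_mono power_mono) auto
          then have "(\<integral>\<^sup>+x. ennreal ((\<phi> (x + z) - \<phi> x)\<^sup>2) \<partial>lborel) \<le> ennreal ((CARD('n) * h)\<^sup>2 * G)"
            using nn_integral_translation_difference[OF phi, of z] unfolding G_def[symmetric]
            by (meson ennreal_leI order_trans)
          then show ?thesis using True by simp
        qed simp
      qed
      also have "\<dots> = emeasure lborel B * ennreal ((CARD('n) * h)\<^sup>2 * G)"
        by (simp add: nn_integral_multc)
      also have "emeasure lborel B = ennreal ((2 * h) ^ DIM(real^'n))"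
      proof -
        have "emeasure lborel B = ennreal (\<Prod>b\<in>Basis. (h *\<^sub>R One - - (h *\<^sub>R One) :: real^'n) \<bullet> b)"
          unfolding B_def using h by (intro emeasure_lborel_cbox) auto
        also have "(\<Prod>b\<in>Basis. (h *\<^sub>R One - - (h *\<^sub>R One) :: real^'n) \<bullet> b) = (\<Prod>b\<in>(Basis :: (real^'n) set). 2 * h)"
        proof (rule prod.cong)
          show "(h *\<^sub>R One - - (h *\<^sub>R One) :: real^'n) \<bullet> b = 2 * h" if "b \<in> Basis" for b
            by (simp only: inner_diff_left inner_minus_left inner_scaleR_left inner_sum_Basis[OF that])
        qed simp
        finally show ?thesis by simp
      qed
      finally show ?thesis using h G by (simp add: ennreal_mult)
    qed
    have "ennreal ((norm (L2_class \<phi>))\<^sup>2) = (\<integral>\<^sup>+x. ennreal ((\<phi> x)\<^sup>2) \<partial>lborel)"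
      unfolding nn_integral_L2[symmetric] using L2_fun_class[OF si]
      by (intro nn_integral_cong_AE) (auto elim!: eventually_mono)
    also have "\<dots> \<le> (\<integral>\<^sup>+x. (\<Sum>k\<in>K. indicator (cell h k) x * ennreal (2 * (I k / mk k)\<^sup>2)) + ennreal (2 / m) * T x \<partial>lborel)"
      by (intro nn_integral_mono pointwise)
    also have "\<dots> = (\<Sum>k\<in>K. emeasure lborel (cell h k :: (real^'n) set) * ennreal (2 * (I k / mk k)\<^sup>2)) + ennreal (2 / m) * (\<integral>\<^sup>+x. T x \<partial>lborel)"
      by (simp add: nn_integral_add nn_integral_sum nn_integral_cmult nn_integral_multc)
    also have "\<dots> \<le> (\<Sum>k\<in>K. ennreal (2 / m * (I k)\<^sup>2)) + ennreal (2 / m) * ennreal ((2 * h) ^ DIM(real^'n) * ((CARD('n) * h)\<^sup>2 * G))"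
    proof (intro add_mono mult_left_mono T_int sum_mono)
      fix k
      have "emeasure lborel (cell h k :: (real^'n) set) * ennreal (2 * (I k / mk k)\<^sup>2) = ennreal (mk k * (2 * (I k / mk k)\<^sup>2))"
        using cell_fin[of k] mk(2)[of k]
        by (simp add: mk_def emeasure_eq_ennreal_measure less_top ennreal_mult)
      also have "mk k * (2 * (I k / mk k)\<^sup>2) = 2 / mk k * (I k)\<^sup>2"
        using mk(2)[of k] by (simp add: power2_eq_square)
      also have "\<dots> \<le> 2 / m * (I k)\<^sup>2"
        using mk[of k] m by (intro mult_right_mono divide_left_mono) auto
      finally show "emeasure lborel (cell h k :: (real^'n) set) * ennreal (2 * (I k / mk k)\<^sup>2) \<le> ennreal (2 / m * (I k)\<^sup>2)"
        by (simp add: ennreal_leI)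
    qed simp
    also have "\<dots> = ennreal ((\<Sum>k\<in>K. 2 / m * (I k)\<^sup>2) + 2 / m * ((2 * h) ^ DIM(real^'n) * ((CARD('n) * h)\<^sup>2 * G)))"
      using m h G by (simp add: sum_ennreal ennreal_plus sum_nonneg flip: ennreal_mult)
    finally have "(norm (L2_class \<phi>))\<^sup>2 \<le> (\<Sum>k\<in>K. 2 / m * (I k)\<^sup>2) + 2 / m * ((2 * h) ^ DIM(real^'n) * ((CARD('n) * h)\<^sup>2 * G))"
      using m h G by (subst (asm) ennreal_le_iff) (auto intro!: add_nonneg_nonneg sum_nonneg)
    \<comment> \<open>The volume (2h)^d of \<open>B\<close> over the lower bound h^d for a cell is
      2^d; with this cancellation only the factor h^2 from the translations is left, which tends to
      0 with the mesh.\<close>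
    also have "2 / m * ((2 * h) ^ DIM(real^'n) * ((CARD('n) * h)\<^sup>2 * G)) = 2 * 2 ^ DIM(real^'n) * (CARD('n) * h)\<^sup>2 * G"
      using m by (simp add: m_def power_mult_distrib[of 2 h])
    finally show ?thesis by (simp add: I G_def)
  qed
  \<comment> \<open>Passing from cells to the set of their classes: injectivity of \<open>e\<close>
    is not established, so each summand is bounded by the full sum over the image, at the price of
    the factor \<open>card K\<close>.\<close>
  have sumK: "(\<Sum>k\<in>K. 2 / m * (inner (L2_class \<phi>) (e k))\<^sup>2) \<le> card K * (2 / m) * (\<Sum>e\<in>e ` K. (inner (L2_class \<phi>) e)\<^sup>2)" for \<phi>
  proof -
    have "(\<Sum>k\<in>K. 2 / m * (inner (L2_class \<phi>) (e k))\<^sup>2) \<le> (\<Sum>k\<in>K. 2 / m * (\<Sum>e\<in>e ` K. (inner (L2_class \<phi>) e)\<^sup>2))"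
      using m K by (intro sum_mono mult_left_mono member_le_sum) auto
    then show ?thesis by simp
  qed
  show ?thesis
    by (intro exI[of _ "e ` K"] exI[of _ "card K * (2 / m)"] conjI ballI order_trans[OF main] add_left_mono sumK)
      (use K in auto)
qed

section \<open>Weak derivatives and the elliptic form\<close>

lemma norm_le_H1_norm: "norm v \<le> H1_norm \<Omega> v"
  unfolding H1_norm_def by (intro real_le_rsqrt) (simp add: sum_nonneg)

text \<open>\<open>weak_partial\<close> is a definite description, so density is what makes its
  values computable; as an assumption it can be discharged from the dense domain of the operator
  without constructing mollifiers.\<close>

locale sobolev_domain =
  fixes \<Omega> :: "(real^'n::finite) set"
  assumes open_domain: "open \<Omega>" and bounded_domain: "bounded \<Omega>"
    and test_functions_dense: "L2_on \<Omega> \<subseteq> closure (L2_class ` test_functions \<Omega>)"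
begin

lemma orthogonal_to_test_functions:
  assumes "g \<in> L2_on \<Omega>" "\<And>\<phi>. \<phi> \<in> test_functions \<Omega> \<Longrightarrow> inner g (L2_class \<phi>) = 0"
  shows "g = 0"
proof -
  have "g \<in> closure (L2_class ` test_functions \<Omega>)" using assms(1) test_functions_dense by blast
  then obtain x where x: "\<And>n. x n \<in> L2_class ` test_functions \<Omega>" "x \<longlonglongrightarrow> g"
    unfolding closure_sequential by blast
  have "(\<lambda>n. inner g (x n)) \<longlonglongrightarrow> inner g g" by (intro tendsto_intros x)
  moreover have "inner g (x n) = 0" for n using x(1)[of n] assms(2) by auto
  ultimately have "(\<lambda>n. 0) \<longlonglongrightarrow> inner g g" by simp
  from LIMSEQ_unique[OF this tendsto_const] show ?thesis by simp
qed

lemma weak_partial_eq: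
  assumes "has_weak_partial \<Omega> i v g"
  shows "weak_partial \<Omega> i v = g"
  unfolding weak_partial_def
proof (rule the_equality[of "has_weak_partial \<Omega> i v", OF assms])
  fix h assume h: "has_weak_partial \<Omega> i v h"
  have "h - g = 0"
    by (rule orthogonal_to_test_functions)
      (use assms h in \<open>auto simp: has_weak_partial_def inner_diff_left intro: subspace_diff[OF subspace_L2_on]\<close>)
  then show "h = g" by simp
qed

lemma H1_has_weak_partial: "v \<in> H1 \<Omega> \<Longrightarrow> has_weak_partial \<Omega> i v (weak_partial \<Omega> i v)"
  unfolding H1_def using weak_partial_eq by force

lemma has_weak_partial_diff:
  "has_weak_partial \<Omega> i v g \<Longrightarrow> has_weak_partial \<Omega> i w h \<Longrightarrow> has_weak_partial \<Omega> i (v - w) (g - h)"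
  by (auto simp: has_weak_partial_def inner_diff_left intro: subspace_diff[OF subspace_L2_on])

lemma has_weak_partial_sum:
  "(\<And>j. j \<in> J \<Longrightarrow> has_weak_partial \<Omega> i (v j) (g j)) \<Longrightarrow> has_weak_partial \<Omega> i (\<Sum>j\<in>J. v j) (\<Sum>j\<in>J. g j)"
  by (auto simp: has_weak_partial_def inner_sum_left sum_negf intro: subspace_sum[OF subspace_L2_on])

lemma has_weak_partial_test_function:
  assumes phi: "\<phi> \<in> test_functions \<Omega>"
  shows "has_weak_partial \<Omega> i (L2_class \<phi>) (L2_class (partial_deriv i \<phi>))"
  unfolding has_weak_partial_def
proof (intro conjI ballI)
  have si: "square_integrable \<phi>" "square_integrable (partial_deriv i \<phi>)" if "\<phi> \<in> test_functions \<Omega>" for \<phi>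
    using test_functions_square_integrable[OF that]
      test_functions_square_integrable[OF test_functions_partial_deriv[OF that]] by auto
  show "L2_class (partial_deriv i \<phi>) \<in> L2_on \<Omega>"
    by (rule L2_class_test_function_in_L2_on[OF test_functions_partial_deriv[OF phi]])
  fix \<psi> assume psi: "\<psi> \<in> test_functions \<Omega>"
  have eq: "inner (L2_class a) (L2_class b) = (\<integral>x. a x * b x \<partial>lborel)"
    if "square_integrable a" "square_integrable b" for a b :: "real^'n \<Rightarrow> real"
    using that by (intro inner_L2.abs_eq) (auto simp: L2_rel_def)
  show "inner (L2_class \<phi>) (L2_class (partial_deriv i \<psi>)) = - inner (L2_class (partial_deriv i \<phi>)) (L2_class \<psi>)"
    using integration_by_parts[OF phi psi, of i] si[OF phi] si[OF psi] by (simp add: eq)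
qed

lemma smooth_bounded_on_domain:
  assumes "smooth a"
  shows "\<exists>B. \<forall>x\<in>\<Omega>. \<bar>a x\<bar> \<le> B"
proof -
  have "compact (a ` closure \<Omega>)"
    using bounded_domain by (intro compact_continuous_image smooth_continuous_on assms) simp
  from compact_imp_bounded[OF this] obtain B where "\<forall>x\<in>closure \<Omega>. \<bar>a x\<bar> \<le> B"
    unfolding bounded_iff by auto
  then show ?thesis using closure_subset by blast
qed

lemma square_integrable_smooth_mult:
  assumes a: "smooth a" and v: "v \<in> L2_on \<Omega>"
  shows "square_integrable (\<lambda>x. a x * L2_fun v x)"
  unfolding square_integrable_def
proof
  have [measurable]: "a \<in> borel_measurable borel" by (rule smooth_measurable[OF a])
  show "(\<lambda>x. a x * L2_fun v x) \<in> borel_measurable lborel" by measurable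
  obtain B where B: "\<And>x. x \<in> \<Omega> \<Longrightarrow> \<bar>a x\<bar> \<le> B" using smooth_bounded_on_domain[OF a] by blast
  show "integrable lborel (\<lambda>x. (a x * L2_fun v x)\<^sup>2)"
  proof (rule Bochner_Integration.integrable_bound)
    show "integrable lborel (\<lambda>x. B\<^sup>2 * (L2_fun v x)\<^sup>2)"
      using square_integrable_L2_fun[of v] by (simp add: square_integrable_def)
    have "AE x in lborel. x \<notin> \<Omega> \<longrightarrow> L2_fun v x = 0" using v by (simp add: L2_on_def)
    then show "AE x in lborel. norm ((a x * L2_fun v x)\<^sup>2) \<le> norm (B\<^sup>2 * (L2_fun v x)\<^sup>2)"
    proof eventually_elim
      fix x assume x: "x \<notin> \<Omega> \<longrightarrow> L2_fun v x = 0"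
      have "(a x)\<^sup>2 * (L2_fun v x)\<^sup>2 \<le> B\<^sup>2 * (L2_fun v x)\<^sup>2" if "x \<in> \<Omega>"
        using power_mono[OF B[OF that], of 2] by (intro mult_right_mono) auto
      then show "norm ((a x * L2_fun v x)\<^sup>2) \<le> norm (B\<^sup>2 * (L2_fun v x)\<^sup>2)"
        using x by (cases "x \<in> \<Omega>") (auto simp: power_mult_distrib)
    qed
  qed measurable
qed

lemma L2_fun_mult: "smooth a \<Longrightarrow> v \<in> L2_on \<Omega> \<Longrightarrow> AE x in lborel. L2_fun (mult_L2 a v) x = a x * L2_fun v x"
  unfolding mult_L2_def by (intro L2_fun_class square_integrable_smooth_mult)

lemma mult_L2_on:
  assumes "smooth a" "v \<in> L2_on \<Omega>"
  shows "mult_L2 a v \<in> L2_on \<Omega>"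
  using assms(2) L2_fun_mult[OF assms] unfolding L2_on_def by (auto elim: eventually_elim2)

lemma inner_mult_L2:
  assumes "smooth a" "v \<in> L2_on \<Omega>"
  shows "inner (mult_L2 a v) w = (\<integral>x. a x * L2_fun v x * L2_fun w x \<partial>lborel)"
  by (subst inner_commute) (simp add: mult_L2_def inner_L2_class[OF square_integrable_smooth_mult[OF assms]] mult.commute)

lemma integrable_mult_L2:
  assumes "smooth a" "v \<in> L2_on \<Omega>"
  shows "integrable lborel (\<lambda>x. a x * L2_fun v x * L2_fun w x)"
  by (rule square_integrable_mult[OF square_integrable_smooth_mult[OF assms] square_integrable_L2_fun])

lemma inner_mult_L2_class:
  assumes a: "smooth a" and v: "v \<in> L2_on \<Omega>" and phi: "\<phi> \<in> test_functions \<Omega>"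
  shows "inner (mult_L2 a v) (L2_class \<phi>) = inner v (L2_class (\<lambda>x. a x * \<phi> x))"
proof -
  note si = test_functions_square_integrable[OF phi]
    test_functions_square_integrable[OF test_functions_mult[OF phi a]]
  have [measurable]: "a \<in> borel_measurable borel" "\<phi> \<in> borel_measurable borel"
    using a si(1) by (auto simp: smooth_measurable square_integrable_def)
  have "inner (mult_L2 a v) (L2_class \<phi>) = (\<integral>x. L2_fun (mult_L2 a v) x * \<phi> x \<partial>lborel)"
    by (rule inner_L2_class[OF si(1)])
  also have "\<dots> = (\<integral>x. L2_fun v x * (a x * \<phi> x) \<partial>lborel)"
    using L2_fun_mult[OF a v] by (intro integral_cong_AE) (auto elim!: eventually_mono)
  also have "\<dots> = inner v (L2_class (\<lambda>x. a x * \<phi> x))" by (rule inner_L2_class[OF si(2), symmetric])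
  finally show ?thesis .
qed

text \<open>The factor \<open>a\<close> is moved onto the test function: a \<phi> is again a test
  function, and a times the derivative of \<phi> is the derivative of a \<phi> minus (partial a)
  \<phi>.\<close>

lemma has_weak_partial_mult:
  assumes a: "smooth a" and v: "v \<in> L2_on \<Omega>" and g: "has_weak_partial \<Omega> i v g"
  shows "has_weak_partial \<Omega> i (mult_L2 a v) (mult_L2 a g + mult_L2 (partial_deriv i a) v)"
  unfolding has_weak_partial_def
proof (intro conjI ballI)
  note da = smooth_partial_deriv[OF a, of i]
  have gO: "g \<in> L2_on \<Omega>" using g by (simp add: has_weak_partial_def)
  show "mult_L2 a g + mult_L2 (partial_deriv i a) v \<in> L2_on \<Omega>"
    by (intro subspace_add[OF subspace_L2_on] mult_L2_on a da v gO)
  fix \<phi> assume phi: "\<phi> \<in> test_functions \<Omega>"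
  note dphi = test_functions_partial_deriv[OF phi, of i]
  note aphi = test_functions_mult[OF phi a]
  have "partial_deriv i (\<lambda>x. a x * \<phi> x) = (\<lambda>x. a x * partial_deriv i \<phi> x - (- 1) * (partial_deriv i a x * \<phi> x))"
    using a test_functionsD(1)[OF phi]
    by (intro ext) (simp add: partial_deriv_mult smooth_differentiable)
  moreover have "L2_class (\<lambda>x. a x * partial_deriv i \<phi> x - (- 1) * (partial_deriv i a x * \<phi> x))
      = L2_class (\<lambda>x. a x * partial_deriv i \<phi> x) - L2_class (\<lambda>x. (- 1) * (partial_deriv i a x * \<phi> x))"
    by (intro L2_class_diff[symmetric] square_integrable_scale test_functions_square_integrable[of _ \<Omega>]
        test_functions_mult dphi phi a da)
  moreover have "L2_class (\<lambda>x. (- 1) * (partial_deriv i a x * \<phi> x)) = (- 1) *\<^sub>R L2_class (\<lambda>x. partial_deriv i a x * \<phi> x)"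
    using test_functions_square_integrable[OF test_functions_mult[OF phi da]]
    by (intro scaleR_L2.abs_eq[symmetric]) (simp add: L2_rel_def)
  ultimately have eq: "L2_class (partial_deriv i (\<lambda>x. a x * \<phi> x))
      = L2_class (\<lambda>x. a x * partial_deriv i \<phi> x) + L2_class (\<lambda>x. partial_deriv i a x * \<phi> x)" by simp
  have "inner v (L2_class (partial_deriv i (\<lambda>x. a x * \<phi> x))) = - inner g (L2_class (\<lambda>x. a x * \<phi> x))"
    using g aphi by (simp add: has_weak_partial_def)
  then show "inner (mult_L2 a v) (L2_class (partial_deriv i \<phi>))
      = - inner (mult_L2 a g + mult_L2 (partial_deriv i a) v) (L2_class \<phi>)"
    unfolding eq by (simp add: inner_add_left inner_add_right inner_mult_L2_class a da v gO phi dphi)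
qed

section \<open>Passage from test functions to \<open>H10 \<Omega>\<close> and the elliptic
  form\<close>

lemma H10_in_H1: "v \<in> H10 \<Omega> \<Longrightarrow> v \<in> H1 \<Omega>"
  by (simp add: H10_def)

lemma H10_approximation:
  assumes v: "v \<in> H10 \<Omega>"
  shows "\<exists>\<phi>. (\<forall>n. \<phi> n \<in> test_functions \<Omega>) \<and> (\<lambda>n. L2_class (\<phi> n)) \<longlonglongrightarrow> v \<and>
    (\<forall>i. (\<lambda>n. L2_class (partial_deriv i (\<phi> n))) \<longlonglongrightarrow> weak_partial \<Omega> i v)"
proof -
  have "\<exists>\<phi>\<in>test_functions \<Omega>. H1_norm \<Omega> (v - L2_class \<phi>) < inverse (real (Suc n))" for n
    using v unfolding H10_def by simp
  then obtain \<phi> where phi: "\<And>n. \<phi> n \<in> test_functions \<Omega>"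
    and close: "\<And>n. H1_norm \<Omega> (v - L2_class (\<phi> n)) < inverse (real (Suc n))" by metis
  have wp: "weak_partial \<Omega> i (v - L2_class (\<phi> n)) = weak_partial \<Omega> i v - L2_class (partial_deriv i (\<phi> n))" for i n
    by (intro weak_partial_eq has_weak_partial_diff H1_has_weak_partial H10_in_H1 v has_weak_partial_test_function phi)
  have norm_le: "norm (v - L2_class (\<phi> n)) \<le> inverse (real (Suc n))" for n
    using norm_le_H1_norm[of "v - L2_class (\<phi> n)" \<Omega>] close[of n] by simp
  have grad_le: "norm (weak_partial \<Omega> i v - L2_class (partial_deriv i (\<phi> n))) \<le> inverse (real (Suc n))" for i n
  proof -
    have "(norm (weak_partial \<Omega> i (v - L2_class (\<phi> n))))\<^sup>2 \<le> (\<Sum>i\<in>UNIV. (norm (weak_partial \<Omega> i (v - L2_class (\<phi> n))))\<^sup>2)"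
      by (rule member_le_sum) auto
    then have "norm (weak_partial \<Omega> i (v - L2_class (\<phi> n))) \<le> H1_norm \<Omega> (v - L2_class (\<phi> n))"
      unfolding H1_norm_def by (intro real_le_rsqrt) (simp add: add_increasing)
    then show ?thesis using close[of n] by (simp add: wp)
  qed
  have conv: "x \<longlonglongrightarrow> l" if xl: "\<And>n. norm (l - x n) \<le> inverse (real (Suc n))" for x and l :: "(real^'n) L2"
  proof (rule LIM_zero_cancel, rule Lim_null_comparison[OF _ LIMSEQ_inverse_real_of_nat])
    show "\<forall>\<^sub>F n in sequentially. norm (x n - l) \<le> inverse (real (Suc n))"
      using xl by (intro always_eventually allI) (simp add: norm_minus_commute)
  qed
  show ?thesis using phi conv[OF norm_le] conv[OF grad_le] by blast
qed

text \<open>The defining identity of the weak derivative is continuous in the test function and its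
  derivative, so it extends to \<open>H10 \<Omega>\<close>: Green's formula without boundary
  term.\<close>

lemma inner_weak_partial:
  assumes g: "has_weak_partial \<Omega> i g G" and v: "v \<in> H10 \<Omega>"
  shows "inner G v = - inner g (weak_partial \<Omega> i v)"
proof -
  obtain \<phi> where phi: "\<And>n. \<phi> n \<in> test_functions \<Omega>" "(\<lambda>n. L2_class (\<phi> n)) \<longlonglongrightarrow> v"
    "\<And>i. (\<lambda>n. L2_class (partial_deriv i (\<phi> n))) \<longlonglongrightarrow> weak_partial \<Omega> i v"
    using H10_approximation[OF v] by blast
  have "inner g (L2_class (partial_deriv i (\<phi> n))) = - inner G (L2_class (\<phi> n))" for n
    using g phi(1) by (simp add: has_weak_partial_def)
  moreover have "(\<lambda>n. inner g (L2_class (partial_deriv i (\<phi> n)))) \<longlonglongrightarrow> inner g (weak_partial \<Omega> i v)"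
    by (intro tendsto_intros phi)
  moreover have "(\<lambda>n. - inner G (L2_class (\<phi> n))) \<longlonglongrightarrow> - inner G v"
    by (intro tendsto_intros phi)
  ultimately show ?thesis using LIMSEQ_unique by fastforce
qed

text \<open>Compactness in the quantitative form of an Ehrling inequality: up to a small multiple of
  the gradient, finitely many functionals control the norm. \<open>E\<close> and \<open>C\<close>
  depend on \<epsilon> alone, so the estimate survives the limit from test functions.\<close>

lemma H10_compact_embedding:
  assumes eps: "0 < \<epsilon>"
  shows "\<exists>E C. finite E \<and> (\<forall>v\<in>H10 \<Omega>. (norm v)\<^sup>2
    \<le> \<epsilon> * (\<Sum>i\<in>UNIV. (norm (weak_partial \<Omega> i v))\<^sup>2) + C * (\<Sum>e\<in>E. (inner v e)\<^sup>2))"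
proof -
  define c :: real where "c = 2 * 2 ^ DIM(real^'n) * (real CARD('n))\<^sup>2"
  have c: "0 < c" by (simp add: c_def)
  \<comment> \<open>Solves c h^2 = \<epsilon> for the constant of the grid estimate.\<close>
  define h where "h = sqrt (\<epsilon> / c)"
  have h: "0 < h" using eps c by (simp add: h_def)
  have "2 * 2 ^ DIM(real^'n) * (CARD('n) * h)\<^sup>2 = c * h\<^sup>2" by (simp add: c_def power_mult_distrib)
  also have "\<dots> = \<epsilon>" using eps c by (simp add: h_def)
  finally have ch: "2 * 2 ^ DIM(real^'n) * (CARD('n) * h)\<^sup>2 = \<epsilon>" .
  obtain E C where E: "finite E" and est: "\<And>\<phi>. \<phi> \<in> test_functions \<Omega> \<Longrightarrow> (norm (L2_class \<phi>))\<^sup>2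
    \<le> \<epsilon> * (\<Sum>i\<in>UNIV. (norm (L2_class (partial_deriv i \<phi>)))\<^sup>2) + C * (\<Sum>e\<in>E. (inner (L2_class \<phi>) e)\<^sup>2)"
    using grid_estimate[OF bounded_domain h] unfolding ch by blast
  have "(norm v)\<^sup>2 \<le> \<epsilon> * (\<Sum>i\<in>UNIV. (norm (weak_partial \<Omega> i v))\<^sup>2) + C * (\<Sum>e\<in>E. (inner v e)\<^sup>2)"
    if v: "v \<in> H10 \<Omega>" for v
  proof -
    obtain \<phi> where phi: "\<And>n. \<phi> n \<in> test_functions \<Omega>" "(\<lambda>n. L2_class (\<phi> n)) \<longlonglongrightarrow> v"
      "\<And>i. (\<lambda>n. L2_class (partial_deriv i (\<phi> n))) \<longlonglongrightarrow> weak_partial \<Omega> i v"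
      using H10_approximation[OF v] by blast
    show ?thesis
    proof (rule LIMSEQ_le)
      show "(\<lambda>n. (norm (L2_class (\<phi> n)))\<^sup>2) \<longlonglongrightarrow> (norm v)\<^sup>2" by (intro tendsto_intros phi)
      show "(\<lambda>n. \<epsilon> * (\<Sum>i\<in>UNIV. (norm (L2_class (partial_deriv i (\<phi> n))))\<^sup>2) + C * (\<Sum>e\<in>E. (inner (L2_class (\<phi> n)) e)\<^sup>2))
        \<longlonglongrightarrow> \<epsilon> * (\<Sum>i\<in>UNIV. (norm (weak_partial \<Omega> i v))\<^sup>2) + C * (\<Sum>e\<in>E. (inner v e)\<^sup>2)"
        by (intro tendsto_intros phi)
    qed (use est phi(1) in auto)
  qed
  with E show ?thesis by blast
qed

text \<open>Membership in \<open>H2 \<Omega>\<close> gives the flux components weak derivatives via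
  the product rule; membership in \<open>H10 \<Omega>\<close> allows integration by parts against
  \<open>v\<close>. Ellipticity then bounds the quadratic form pointwise from below.\<close>

lemma elliptic_form_coercive:
  assumes M_smooth: "\<And>i k. smooth (\<lambda>x. M x $ i $ k)"
    and M_posdef: "\<And>x \<xi>. x \<in> \<Omega> \<Longrightarrow> c * (norm \<xi>)\<^sup>2 \<le> \<xi> \<bullet> (M x *v \<xi>)"
    and a0_smooth: "smooth a\<^sub>0" and a0_nonneg: "\<And>x. x \<in> \<Omega> \<Longrightarrow> 0 \<le> a\<^sub>0 x"
    and v: "v \<in> elliptic_dom \<Omega>"
  shows "c * (\<Sum>i\<in>UNIV. (norm (weak_partial \<Omega> i v))\<^sup>2) \<le> inner (elliptic_op \<Omega> M a\<^sub>0 v) v"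
proof -
  have vH: "v \<in> H2 \<Omega>" "v \<in> H10 \<Omega>" and vO: "v \<in> L2_on \<Omega>"
    using v by (auto simp: elliptic_dom_def H10_def H1_def)
  define w where "w i = weak_partial \<Omega> i v" for i
  have wH1: "w i \<in> H1 \<Omega>" for i using vH by (simp add: w_def H2_def)
  then have wO: "w i \<in> L2_on \<Omega>" for i by (simp add: H1_def)
  define g where "g i = (\<Sum>j\<in>UNIV. mult_L2 (\<lambda>x. M x $ i $ j) (w j))" for i
  have "has_weak_partial \<Omega> i (g i) (weak_partial \<Omega> i (g i))" for i
  proof -
    have hw: "has_weak_partial \<Omega> i (g i) (\<Sum>j\<in>UNIV. mult_L2 (\<lambda>x. M x $ i $ j) (weak_partial \<Omega> i (w j))
        + mult_L2 (partial_deriv i (\<lambda>x. M x $ i $ j)) (w j))"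
      unfolding g_def by (intro has_weak_partial_sum has_weak_partial_mult M_smooth wO H1_has_weak_partial wH1)
    show ?thesis unfolding weak_partial_eq[OF hw] by (rule hw)
  qed
  from inner_weak_partial[OF this vH(2)]
  have parts: "inner (weak_partial \<Omega> i (g i)) v = - inner (g i) (w i)" for i by (simp add: w_def)
  have int_M: "integrable lborel (\<lambda>x. M x $ i $ j * L2_fun (w j) x * L2_fun (w i) x)" for i j
    by (rule integrable_mult_L2[OF M_smooth wO])
  have int_a: "integrable lborel (\<lambda>x. a\<^sub>0 x * L2_fun v x * L2_fun v x)"
    by (rule integrable_mult_L2[OF a0_smooth vO])
  have sq: "integrable lborel (\<lambda>x. (L2_fun (w i) x)\<^sup>2)" for i
    using square_integrable_L2_fun by (simp add: square_integrable_def)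
  have "inner (elliptic_op \<Omega> M a\<^sub>0 v) v = (\<Sum>i\<in>UNIV. inner (g i) (w i)) + inner (mult_L2 a\<^sub>0 v) v"
    unfolding elliptic_op_def w_def[symmetric] g_def[symmetric]
    by (simp add: inner_add_left inner_diff_left inner_sum_left parts sum_negf)
  also have "\<dots> = (\<Sum>i\<in>UNIV. \<Sum>j\<in>UNIV. \<integral>x. M x $ i $ j * L2_fun (w j) x * L2_fun (w i) x \<partial>lborel)
      + (\<integral>x. a\<^sub>0 x * L2_fun v x * L2_fun v x \<partial>lborel)"
    by (simp add: g_def inner_sum_left inner_mult_L2 M_smooth wO a0_smooth vO)
  also have "\<dots> = (\<integral>x. (\<Sum>i\<in>UNIV. \<Sum>j\<in>UNIV. M x $ i $ j * L2_fun (w j) x * L2_fun (w i) x)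
      + a\<^sub>0 x * L2_fun v x * L2_fun v x \<partial>lborel)"
    using int_M int_a by (simp add: Bochner_Integration.integral_sum)
  finally have form: "inner (elliptic_op \<Omega> M a\<^sub>0 v) v = \<dots>" .
  have "c * (\<Sum>i\<in>UNIV. (norm (w i))\<^sup>2) = (\<integral>x. c * (\<Sum>i\<in>UNIV. (L2_fun (w i) x)\<^sup>2) \<partial>lborel)"
    unfolding norm_L2_power2 using sq by (simp add: Bochner_Integration.integral_sum)
  also have "\<dots> \<le> inner (elliptic_op \<Omega> M a\<^sub>0 v) v"
    unfolding form
  proof (rule integral_mono_AE)
    show "integrable lborel (\<lambda>x. c * (\<Sum>i\<in>UNIV. (L2_fun (w i) x)\<^sup>2))" using sq by auto
    show "integrable lborel (\<lambda>x. (\<Sum>i\<in>UNIV. \<Sum>j\<in>UNIV. M x $ i $ j * L2_fun (w j) x * L2_fun (w i) x)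
      + a\<^sub>0 x * L2_fun v x * L2_fun v x)" using int_M int_a by auto
    \<comment> \<open>Positivity of \<open>M\<close> and \<open>a\<^sub>0\<close> is available
      inside \<Omega> only; outside, all functions involved vanish almost everywhere and both sides
      are 0.\<close>
    have "AE x in lborel. \<forall>i. x \<notin> \<Omega> \<longrightarrow> L2_fun (w i) x = 0"
      unfolding AE_all_countable using wO by (auto simp: L2_on_def)
    moreover have "AE x in lborel. x \<notin> \<Omega> \<longrightarrow> L2_fun v x = 0" using vO by (simp add: L2_on_def)
    ultimately show "AE x in lborel. c * (\<Sum>i\<in>UNIV. (L2_fun (w i) x)\<^sup>2)
      \<le> (\<Sum>i\<in>UNIV. \<Sum>j\<in>UNIV. M x $ i $ j * L2_fun (w j) x * L2_fun (w i) x) + a\<^sub>0 x * L2_fun v x * L2_fun v x"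
    proof eventually_elim
      fix x assume out: "\<forall>i. x \<notin> \<Omega> \<longrightarrow> L2_fun (w i) x = 0" "x \<notin> \<Omega> \<longrightarrow> L2_fun v x = 0"
      define \<xi> where "\<xi> = (\<chi> i. L2_fun (w i) x)"
      have n: "(norm \<xi>)\<^sup>2 = (\<Sum>i\<in>UNIV. (L2_fun (w i) x)\<^sup>2)"
        by (simp add: \<xi>_def norm_vec_def L2_set_def sum_nonneg)
      have q: "\<xi> \<bullet> (M x *v \<xi>) = (\<Sum>i\<in>UNIV. \<Sum>j\<in>UNIV. M x $ i $ j * L2_fun (w j) x * L2_fun (w i) x)"
        by (simp add: \<xi>_def inner_vec_def matrix_vector_mult_def sum_distrib_left mult_ac)
      show "c * (\<Sum>i\<in>UNIV. (L2_fun (w i) x)\<^sup>2)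
        \<le> (\<Sum>i\<in>UNIV. \<Sum>j\<in>UNIV. M x $ i $ j * L2_fun (w j) x * L2_fun (w i) x) + a\<^sub>0 x * L2_fun v x * L2_fun v x"
      proof (cases "x \<in> \<Omega>")
        case True
        have "0 \<le> a\<^sub>0 x * (L2_fun v x * L2_fun v x)" using a0_nonneg[OF True] by simp
        then show ?thesis using M_posdef[OF True, of \<xi>] unfolding n q by (simp add: mult.assoc)
      qed (use out in simp)
    qed
  qed
  finally show ?thesis by (simp add: w_def)
qed

end

section \<open>The theorem\<close>

theorem theorem4p1:
  fixes \<Omega> :: "(real^'n::finite) set"
    and M :: "real^'n \<Rightarrow> real^'n^'n" and a\<^sub>0 :: "real^'n \<Rightarrow> real"
    and \<alpha> \<delta> lambda1 :: real
    and A S :: "(real^'n) L2 \<Rightarrow> (real^'n) L2" and D :: "(real^'n) L2 set"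
    and f u\<^sub>0 u\<^sub>1 u_inf :: "(real^'n) L2"
    and u w :: "real \<Rightarrow> (real^'n) L2"
    and j :: nat
  assumes domain: "\<exists>P. polytope P \<and> \<Omega> = interior P" "\<Omega> \<noteq> {}"
    and M_smooth: "\<And>i k. smooth (\<lambda>x. M x $ i $ k)"
    and M_sym: "\<And>x. x \<in> \<Omega> \<Longrightarrow> transpose (M x) = M x"
    and M_posdef: "\<exists>c>0. \<forall>x\<in>\<Omega>. \<forall>\<xi>. c * (norm \<xi>)\<^sup>2 \<le> \<xi> \<bullet> (M x *v \<xi>)"
    and a0_smooth: "smooth a\<^sub>0"
    and a0_nonneg: "\<And>x. x \<in> \<Omega> \<Longrightarrow> 0 \<le> a\<^sub>0 x"
    and A: "A = elliptic_op \<Omega> M a\<^sub>0" and D: "D = elliptic_dom \<Omega>"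
    and A_self_adjoint: "self_adjoint_on (L2_on \<Omega>) D A"
    and S_sqrt: "positive_sqrt_on (L2_on \<Omega>) D A (H10 \<Omega>) S"
    and smallest: "smallest_eigenvalue_on D A lambda1"
    and alpha: "0 < \<alpha>"
    and delta: "0 < \<delta>" "\<delta> \<le> 1/3 * min \<alpha> (lambda1 / (2 * \<alpha>))"
    and f: "f \<in> L2_on \<Omega>"
    and u_sol: "damped_wave_solution D A (H10 \<Omega>) S \<alpha> f u\<^sub>0 u\<^sub>1 u"
    and steady: "u_inf \<in> D" "A u_inf = f"
    and w: "\<And>t. w t = u t - u_inf"
    and j: "1 \<le> j"
    and u_reg: "Ck_time j u" "\<And>t. 0 \<le> t \<Longrightarrow> time_deriv (j - 1) u t \<in> H10 \<Omega>"
      "continuous_on {0..} (\<lambda>t. S (time_deriv (j - 1) u t))"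
  shows "(\<forall>t\<ge>0. energy S j w t \<le> 3 * exp (- \<delta> * t) * energy S j w 0
            \<and> 3 * exp (- \<delta> * t) * energy S j w 0
              = 3 * exp (- \<delta> * t) *
                  (1/2 * ((norm (time_deriv j w 0))\<^sup>2 + (norm (S (time_deriv (j - 1) w 0)))\<^sup>2)))
         \<and> (j = 1 \<longrightarrow> time_deriv (j - 1) w 0 = w 0)
         \<and> (1 < j \<longrightarrow> time_deriv j w 0 = time_deriv j u 0)"
proof -
  obtain P where P: "polytope P" "\<Omega> = interior P" using domain(1) by blast
  have open_domain: "open \<Omega>" and bounded_domain: "bounded \<Omega>"
    using P bounded_subset[OF polytope_imp_bounded interior_subset] by auto
  have "H10 \<Omega> \<subseteq> closure (L2_class ` test_functions \<Omega>)"
  proof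
    fix v assume v: "v \<in> H10 \<Omega>"
    show "v \<in> closure (L2_class ` test_functions \<Omega>)"
      unfolding closure_approachable
    proof (intro allI impI)
      fix e :: real assume "0 < e"
      then obtain \<phi> where "\<phi> \<in> test_functions \<Omega>" "H1_norm \<Omega> (v - L2_class \<phi>) < e"
        using v unfolding H10_def by blast
      then show "\<exists>y\<in>L2_class ` test_functions \<Omega>. dist y v < e"
        using norm_le_H1_norm[of "v - L2_class \<phi>" \<Omega>]
        by (intro bexI[of _ "L2_class \<phi>"]) (auto simp: dist_norm norm_minus_commute)
    qed
  qed
  then have "closure D \<subseteq> closure (L2_class ` test_functions \<Omega>)"
    by (intro closure_minimal) (auto simp: D elliptic_dom_def)
  then interpret sobolev_domain \<Omega>
    using A_self_adjoint open_domain bounded_domain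
    by unfold_locales (auto simp: self_adjoint_on_def)
  interpret square_root_operator "L2_on \<Omega>" "H10 \<Omega>" S D A
    using S_sqrt A_self_adjoint subspace_L2_on complete_L2_on[of \<Omega>] open_domain
    by unfold_locales (auto simp: positive_sqrt_on_def)
  obtain c where c: "0 < c" "\<And>x \<xi>. x \<in> \<Omega> \<Longrightarrow> c * (norm \<xi>)\<^sup>2 \<le> \<xi> \<bullet> (M x *v \<xi>)"
    using M_posdef by blast
  \<comment> \<open>The one point where the abstract square root meets the gradient: for
    \<open>v \<in> D\<close>, |S v|^2 = <v, A v>.\<close>
  have coercive: "c * (\<Sum>i\<in>UNIV. (norm (weak_partial \<Omega> i v))\<^sup>2) \<le> (norm (S v))\<^sup>2" if "v \<in> D" for v
    using elliptic_form_coercive[OF M_smooth c(2) a0_smooth a0_nonneg, of v] inner_S_S[OF D_in_V, of v v] that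
    by (simp add: A D power2_norm_eq_inner inner_commute)
  have "\<exists>E C. finite E \<and> (\<forall>v\<in>D. (norm v)\<^sup>2 \<le> \<epsilon> * (norm (S v))\<^sup>2 + C * (\<Sum>e\<in>E. (inner v e)\<^sup>2))"
    if eps: "0 < \<epsilon>" for \<epsilon>
  proof -
    \<comment> \<open>The parameter is \<epsilon> c, so that coercivity turns the gradient term into
      \<epsilon> |S v|^2.\<close>
    obtain E C where E: "finite E" "\<And>v. v \<in> H10 \<Omega> \<Longrightarrow> (norm v)\<^sup>2
        \<le> \<epsilon> * c * (\<Sum>i\<in>UNIV. (norm (weak_partial \<Omega> i v))\<^sup>2) + C * (\<Sum>e\<in>E. (inner v e)\<^sup>2)"
      using H10_compact_embedding[of "\<epsilon> * c"] eps c(1) by auto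
    have "(norm v)\<^sup>2 \<le> \<epsilon> * (norm (S v))\<^sup>2 + C * (\<Sum>e\<in>E. (inner v e)\<^sup>2)" if "v \<in> D" for v
      using E(2)[OF D_in_V[OF that]] mult_left_mono[OF coercive[OF that] less_imp_le[OF eps]]
      by (simp add: mult.assoc)
    with E(1) show ?thesis by blast
  qed
  from lower_bound_by_smallest_eigenvalue[OF this smallest]
  have lower: "lambda1 * (norm v)\<^sup>2 \<le> (norm (S v))\<^sup>2" if "v \<in> H10 \<Omega>" for v
    using that by blast
  have w_eq: "w = (\<lambda>t. u t - u_inf)" by (rule ext) (rule w)
  have "energy S j w t \<le> 3 * exp (- \<delta> * t) * energy S j w 0" if t: "0 \<le> t" for t
    unfolding w_eq by (rule damped_wave_energy_decay[OF lower alpha delta u_sol steady j u_reg t])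
  moreover have "time_deriv j w 0 = time_deriv j u 0" if "1 < j"
    using time_deriv_diff_const[OF u_reg(1) order_refl order_refl, of u_inf] that by (simp add: w_eq)
  ultimately show ?thesis by (simp add: energy_def)
qed

end
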